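(* Let $n\in\mathbb{N}$, $0<\tau\le\infty$, let $a,k\in L^1_{loc}([0,(n+1)\tau))$ be positive functions with $k\in\mathcal{C}(0,(n+1)\tau)$, and let $\{S_1(t)\}_{t\in(0,\tau)}\subset\mathcal{B}(X)$ be a local $(a,k)$-regularized resolvent family generated by a closed operator $A$ on $X$. For $0<T<\tau$ let the family of operators $\{S_{n+1}(t)\}_{t\in(0,(n+1)T]}$ be defined recursively (starting from $\{S_1(t)\}_{t\in(0,T]}$) by $$S_{n+1}(t)x:=(k*a*S_n)(t)x,\qquad x\in X,\ t\in(0,nT],$$ and $$S_{n+1}(t)x:=\left(a^+*_2(S_n\otimes S_1)\right)(nT,t-nT)x+\int_0^{nT}k(t-r)(a*S_n)(r)x\,dr+\int_0^{t-nT}\left((k*a)^{*(n-1)}*k\right)(t-r)(a*S_1)(r)x\,dr$$ for $x\in X$ and $t\in(nT,(n+1)T]$. Then, for any $T<\tau$, $\{S_{n+1}(t)\}_{t\in(0,(n+1)T]}$ is a local $(a,(k*a)^{*n}*k)$-regularized resolvent family generated by $A$. Consequently $A$ generates a local $(a,(k*a)^{*n}*k)$-regularized resolvent family $\{S_{n+1}(t)\}_{t\in(0,(n+1)\tau)}$.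
   Context: $X$ is a complex Banach space and $\mathcal{B}(X)$ the bounded linear operators on $X$. Convolution: $(f*g)(t)=\int_0^t f(t-s)g(s)\,ds$; for an operator family, $(f*S)(t)x=\int_0^t f(t-s)S(s)x\,ds$; $f^{*n}$ is the $n$-fold convolution power and $f^{*0}*g:=g$. For functions of two variables, $(F*_2G)(t,s)=\int_0^t\int_0^s F(t-u,s-v)G(u,v)\,dv\,du$; $a^+(t,s):=a(t+s)$; $(S\otimes R)(t,s):=S(t)R(s)$ (composition), so $(a^+*_2(S\otimes R))(t,s)x=\int_0^t\int_0^s a(t+s-r_1-r_2)S(r_1)R(r_2)x\,dr_2\,dr_1$. Definition. Let $0<\tau\le\infty$, $a,k\in L^1_{loc}([0,\tau))$, $k\in\mathcal{C}(0,\tau)$ with $k(t)\ne0$ for all $t\in(0,\sigma)$ for some small $\sigma>0$, and let $A$ be a closed operator on $X$ with domain $D(A)$. A strongly continuous family $\{S(t)\}_{t\in(0,\tau)}\subset\mathcal{B}(X)$ is a local (global if $\tau=\infty$) $(a,k)$-regularized resolvent family generated by $A$ if: (i) $\lim_{t\to0^+}S(t)x/k(t)=x$ for all $x\in X$; (ii) $S(t)A\subset AS(t)$ for $t\in(0,\tau)$; (iii) $(a*S)(t)x\in D(A)$ and $A(a*S)(t)x=S(t)x-k(t)x$ for all $x\in X$, $t\in(0,\tau)$. The same definition is used with a half-closed interval $(0,T]$ in place of $(0,\tau)$.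
   Formalization: The kernel (k*a)^{*n}*k is additionally assumed continuous on (0,(n+1)τ), as the definition of a regularized resolvent family requires; without this the claim fails, e.g. n=1, τ=1, X=ℂ, A=0, a(s)=|s−1|^{-3/4}, k(s)=s^{-3/4}, where k*a*k is infinite at t=1. *)

theory Defs
  imports "HOL-Analysis.Analysis"
begin

class complex_banach = banach +
  fixes scaleC :: "complex \<Rightarrow> 'a \<Rightarrow> 'a"  (infixr \<open>*\<^sub>C\<close> 75)
  assumes scaleC_of_real: "complex_of_real r *\<^sub>C x = r *\<^sub>R x"
    and scaleC_add_right: "c *\<^sub>C (x + y) = c *\<^sub>C x + c *\<^sub>C y"
    and scaleC_add_left: "(c + d) *\<^sub>C x = c *\<^sub>C x + d *\<^sub>C x"
    and scaleC_scaleC: "c *\<^sub>C (d *\<^sub>C x) = (c * d) *\<^sub>C x"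
    and norm_scaleC: "norm (c *\<^sub>C x) = cmod c * norm x"

definition bounded_clinear :: "('a::complex_banach \<Rightarrow> 'a) \<Rightarrow> bool" where
  "bounded_clinear f \<longleftrightarrow> bounded_linear f \<and> (\<forall>c x. f (c *\<^sub>C x) = c *\<^sub>C f x)"

text \<open>An unbounded operator is given by its domain \<open>D\<close> and a function \<open>A\<close>, of which only the
  values on \<open>D\<close> matter.\<close>

definition closed_operator :: "'a::complex_banach set \<Rightarrow> ('a \<Rightarrow> 'a) \<Rightarrow> bool" where
  "closed_operator D A \<longleftrightarrow>
     0 \<in> D \<and>
     (\<forall>x\<in>D. \<forall>y\<in>D. x + y \<in> D \<and> A (x + y) = A x + A y) \<and>
     (\<forall>c. \<forall>x\<in>D. c *\<^sub>C x \<in> D \<and> A (c *\<^sub>C x) = c *\<^sub>C A x) \<and>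
     closed {(x, A x) | x. x \<in> D}"

text \<open>The library's Bochner integral is restricted to separable spaces, and \<open>X\<close> is not assumed
  separable. Vector-valued integrals are therefore gauge integrals, which coincide with the Bochner
  integral on Bochner integrable functions. \<open>convolution_exists\<close> also requires the norm of the
  integrand to be integrable; for the integrands used here, products of a locally integrable scalar
  function with a function that is continuous on \<open>{0<..t}\<close>, this is Bochner integrability.\<close>

definition convolution ::
  "(real \<Rightarrow> real) \<Rightarrow> (real \<Rightarrow> 'b::real_normed_vector) \<Rightarrow> real \<Rightarrow> 'b" where
  "convolution f g t = integral {0..t} (\<lambda>s. f (t - s) *\<^sub>R g s)"

definition convolution_exists ::
  "(real \<Rightarrow> real) \<Rightarrow> (real \<Rightarrow> 'b::real_normed_vector) \<Rightarrow> real \<Rightarrow> bool" where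
  "convolution_exists f g t \<longleftrightarrow>
     (\<lambda>s. f (t - s) *\<^sub>R g s) integrable_on {0..t} \<and>
     (\<lambda>s. norm (f (t - s) *\<^sub>R g s)) integrable_on {0..t}"

text \<open>\<open>convolution_power f n g\<close> is $f^{*n} * g$, with $f^{*0} * g = g$.\<close>

definition convolution_power ::
  "(real \<Rightarrow> real) \<Rightarrow> nat \<Rightarrow> (real \<Rightarrow> real) \<Rightarrow> real \<Rightarrow> real" where
  "convolution_power f n g = (convolution f ^^ n) g"

definition convolution2 ::
  "(real \<Rightarrow> real \<Rightarrow> real) \<Rightarrow> (real \<Rightarrow> real \<Rightarrow> 'b::real_normed_vector) \<Rightarrow> real \<Rightarrow> real \<Rightarrow> 'b" where
  "convolution2 F G t s =
     integral {0..t} (\<lambda>u. integral {0..s} (\<lambda>v. F (t - u) (s - v) *\<^sub>R G u v))"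

definition time_interval :: "ereal \<Rightarrow> real set" where
  "time_interval \<tau> = {t. 0 < t \<and> ereal t < \<tau>}"

text \<open>For \<open>J = time_interval \<tau>\<close> this is $L^1_{loc}([0,\tau))$, with integrability up to the
  left endpoint; for \<open>J = {0<..T}\<close> it is $L^1([0,T])$.\<close>

definition locally_integrable :: "real set \<Rightarrow> (real \<Rightarrow> real) \<Rightarrow> bool" where
  "locally_integrable J f \<longleftrightarrow> (\<forall>t\<in>J. f absolutely_integrable_on {0..t})"

text \<open>The index set \<open>J\<close> is meant to be \<open>time_interval \<tau>\<close> or \<open>{0<..T}\<close>.
  \<open>S\<close> is only constrained on \<open>J\<close>.\<close>

definition regularized_resolvent_family ::
  "real set \<Rightarrow> (real \<Rightarrow> real) \<Rightarrow> (real \<Rightarrow> real) \<Rightarrow> 'a::complex_banach set \<Rightarrow> ('a \<Rightarrow> 'a)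
    \<Rightarrow> (real \<Rightarrow> 'a \<Rightarrow> 'a) \<Rightarrow> bool" where
  "regularized_resolvent_family J a k D A S \<longleftrightarrow>
     locally_integrable J a \<and> locally_integrable J k \<and> continuous_on J k \<and>
     (\<exists>\<sigma>>0. \<forall>t\<in>J. t < \<sigma> \<longrightarrow> k t \<noteq> 0) \<and>
     closed_operator D A \<and>
     (\<forall>t\<in>J. bounded_clinear (S t)) \<and>
     (\<forall>x. continuous_on J (\<lambda>t. S t x)) \<and>
     (\<forall>x. ((\<lambda>t. (1 / k t) *\<^sub>R S t x) \<longlongrightarrow> x) (at_right 0)) \<and>
     (\<forall>t\<in>J. \<forall>x\<in>D. S t x \<in> D \<and> A (S t x) = S t (A x)) \<and>
     (\<forall>t\<in>J. \<forall>x. convolution_exists a (\<lambda>s. S s x) t \<and>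
        convolution a (\<lambda>s. S s x) t \<in> D \<and>
        A (convolution a (\<lambda>s. S s x) t) = S t x - k t *\<^sub>R x)"

text \<open>With \<open>S = S\<^sub>1\<close>, the family \<open>extended_family a k S T n\<close> is $S_{n+1}$, relevant on
  \<open>{0<..(n+1) * T}\<close>. So in the second equation the left-hand side is $S_{n+2}$, built from $S_{n+1}$.\<close>

primrec extended_family ::
  "(real \<Rightarrow> real) \<Rightarrow> (real \<Rightarrow> real) \<Rightarrow> (real \<Rightarrow> 'a::complex_banach \<Rightarrow> 'a) \<Rightarrow> real
    \<Rightarrow> nat \<Rightarrow> real \<Rightarrow> 'a \<Rightarrow> 'a" where
  "extended_family a k S T 0 = S"
| "extended_family a k S T (Suc n) = (\<lambda>t x.
     let b = real (Suc n) * T; R = extended_family a k S T n in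
     if t \<le> b then convolution k (convolution a (\<lambda>s. R s x)) t
     else
       convolution2 (\<lambda>t s. a (t + s)) (\<lambda>u v. R u (S v x)) b (t - b)
       + integral {0..b} (\<lambda>r. k (t - r) *\<^sub>R convolution a (\<lambda>s. R s x) r)
       + integral {0..t - b}
           (\<lambda>r. convolution_power (convolution k a) n k (t - r) *\<^sub>R convolution a (\<lambda>s. S s x) r))"

end

theory Submission
  imports Defs
begin

text \<open>
  Let \<open>R\<close> be an $(a,\kappa)$-regularized family on $(0,b]$ and \<open>S\<close> an $(a,k)$-regularized one on
  $(0,T]$, both generated by \<open>A\<close>. Continue \<open>R\<close> beyond \<open>b\<close> by $\kappa(u)I$ and put $Q = a * R$. Then
  the two cases of the recursion are given by the single formula
  $$U(t)x = \int_0^{\min(b,t)} k(t-r)Q(r)x\,dr + \int_b^t Q(r)S(t-r)x\,dr, \qquad 0 < t \le b+T.$$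
  On $(0,b]$ we have $AQ = R - \kappa$, and $A(a * S) = S - k$ on $(0,T]$. Hence \<open>A\<close> can be applied under
  the integral in $a * U = \int_0^b (a*k)(t-r)Q(r)\,dr + \int_b^t Q(r)(a*S)(t-r)\,dr$, which gives
  $A(a*U) = U - k*a*\kappa$. The same identities show that $U(t)$ does not depend on \<open>b\<close>, so the
  extended families for different \<open>T\<close> agree.

  Since $\|S(t)\| \le C k(t)$ by uniform boundedness, everything is dominated by scalar convolutions.
  The intermediate kernels $(k*a)^{*m}*k$ need not be continuous and may be infinite on a null set,
  where the recursively defined operators are junk; the intermediate statements therefore hold almost
  everywhere. For the last kernel continuity implies finiteness by Fatou's lemma, and strong
  continuity of $U$ follows from dominated convergence with varying bounds.

  \<open>X\<close> need not be separable, so gauge integrals of strongly measurable functions replace the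
  library's Bochner integral.
\<close>

section \<open>Gauge integrals of vector-valued functions\<close>

text \<open>The continuation by \<kappa>(u)I is dictated by a cancellation. Put m = k*a and let Rh
  be the continued family, so Q = a*Rh. Applying \<open>A\<close> inside a*U yields the integral of
  m(t-r)(R-\<kappa>)(r) over (0,b) plus that of Q(r)(S-k)(t-r) over (b,t). Beyond b the difference
  Rh - \<kappa>I is 0, so the first integral is m*Rh - m*\<kappa>; the second is U - k*Q. Since k*Q
  = k*a*Rh = m*Rh, only U - m*\<kappa> remains. The continuation is also the origin of the last term
  of the recursion: for u > b it contributes \<kappa>(u)(a*S)(t-u), where \<kappa> is the kernel of
  the previous family.

  Scalar functions are cut off at a finite time and set to 0 on the negative axis, so that
  convolutions become integrals over the whole line and the limits of integration need no
  bookkeeping. Operator identities are proved at a point t as soon as the scalar convolutions that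
  dominate them are finite at t. At the last stage this concerns two of them, the final kernel and
  its convolution with \<open>a\<close>, and the second requires an argument of its own.\<close>

lemma integrable_L1_limit_cbox:
  fixes f :: "'n::euclidean_space \<Rightarrow> 'a::banach"
  assumes approx: "\<And>e::real. e > 0 \<Longrightarrow> \<exists>g d. g integrable_on cbox a b \<and> d integrable_on cbox a b \<and>
      (\<forall>x. norm (f x - g x) \<le> d x) \<and> integral (cbox a b) d \<le> e"
  shows "f integrable_on cbox a b"
  unfolding integrable_Cauchy
proof (intro allI impI)
  fix e :: real assume "e > 0"
  then have e3: "e/3 > 0" and e6: "e/6 > 0" by auto
  obtain g d where g: "g integrable_on cbox a b" and d: "d integrable_on cbox a b"
    and gd: "\<And>x. norm (f x - g x) \<le> d x" and de: "integral (cbox a b) d \<le> e/6"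
    using approx[OF e6] by blast
  obtain G where G: "gauge G" and gG: "\<forall>D1 D2. D1 tagged_division_of (cbox a b) \<and> G fine D1 \<and>
      D2 tagged_division_of (cbox a b) \<and> G fine D2 \<longrightarrow>
      norm ((\<Sum>(x,K)\<in>D1. measure lborel K *\<^sub>R g x) - (\<Sum>(x,K)\<in>D2. measure lborel K *\<^sub>R g x)) < e/3"
    using g[unfolded integrable_Cauchy, THEN spec, THEN mp, OF e3] by (elim exE conjE) (rule that)
  obtain H where H: "gauge H" and dH: "\<forall>D. D tagged_division_of (cbox a b) \<and> H fine D \<longrightarrow>
      norm ((\<Sum>(x,K)\<in>D. measure lborel K *\<^sub>R d x) - integral (cbox a b) d) < e/6"
    using integrable_integral[OF d, unfolded has_integral, THEN spec, THEN mp, OF e6]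
    by (elim exE conjE) (rule that)
  \<comment> \<open>On a fine division the Riemann sum of \<open>f - g\<close> is bounded by that of
    \<open>d\<close>, which lies within e/6 of an integral that is at most e/6; hence e/3.\<close>
  have close: "norm ((\<Sum>(x,K)\<in>D. measure lborel K *\<^sub>R f x) - (\<Sum>(x,K)\<in>D. measure lborel K *\<^sub>R g x)) \<le> e/3"
    if D: "D tagged_division_of (cbox a b)" "H fine D" for D
  proof -
    have "norm ((\<Sum>(x,K)\<in>D. measure lborel K *\<^sub>R f x) - (\<Sum>(x,K)\<in>D. measure lborel K *\<^sub>R g x))
        = norm (\<Sum>(x,K)\<in>D. measure lborel K *\<^sub>R (f x - g x))"
      by (simp add: sum_subtractf[symmetric] scaleR_diff_right split_def)
    also have "\<dots> \<le> (\<Sum>(x,K)\<in>D. measure lborel K *\<^sub>R d x)"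
      by (rule order_trans[OF norm_sum], rule sum_mono)
         (simp add: split_def mult_left_mono gd)
    also have "\<dots> \<le> e/3" using dH[rule_format, of D] D de unfolding real_norm_def real_scaleR_def by linarith
    finally show ?thesis .
  qed
  show "\<exists>\<gamma>. gauge \<gamma> \<and> (\<forall>D1 D2. D1 tagged_division_of (cbox a b) \<and> \<gamma> fine D1 \<and>
      D2 tagged_division_of (cbox a b) \<and> \<gamma> fine D2 \<longrightarrow>
      norm ((\<Sum>(x,K)\<in>D1. measure lborel K *\<^sub>R f x) - (\<Sum>(x,K)\<in>D2. measure lborel K *\<^sub>R f x)) < e)"
  proof (intro exI[of _ "\<lambda>x. G x \<inter> H x"] conjI allI impI, goal_cases)
    case 1 then show ?case using G H by (rule gauge_Int)
  next
    case (2 D1 D2)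
    then have *: "G fine D1" "H fine D1" "G fine D2" "H fine D2" by (auto simp: fine_Int)
    let ?S = "\<lambda>h D. \<Sum>(x,K)\<in>D. measure lborel K *\<^sub>R h x"
    have "norm ((?S f D1 - ?S g D1) + (?S g D1 - ?S g D2) - (?S f D2 - ?S g D2)) \<le>
       norm (?S f D1 - ?S g D1) + norm (?S g D1 - ?S g D2) + norm (?S f D2 - ?S g D2)"
      by (rule order_trans[OF norm_triangle_ineq4]) (intro add_mono norm_triangle_ineq order_refl)
    also have "\<dots> < e" using gG[rule_format, of D1 D2] close[of D1] close[of D2] * 2 by linarith
    finally show ?case by simp
  qed
qed

lemma integrable_L1_limit:
  fixes f :: "'n::euclidean_space \<Rightarrow> 'a::banach"
  assumes approx: "\<And>e::real. e > 0 \<Longrightarrow> \<exists>g d. g integrable_on UNIV \<and> d integrable_on UNIV \<and>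
      (\<forall>x. norm (f x - g x) \<le> d x) \<and> integral UNIV d \<le> e"
  shows "f integrable_on UNIV"
proof -
  have cb: "g integrable_on cbox a b" if "g integrable_on UNIV" for g :: "'n \<Rightarrow> 'b::banach" and a b
    using integrable_altD(1)[OF that] by simp
  have dle: "integral (cbox a b) d \<le> e"
    if "d integrable_on UNIV" "\<And>x. norm (f x - g x) \<le> d x" "integral UNIV d \<le> e" for d g e a b
  proof -
    have "0 \<le> d x" for x using norm_ge_zero that(2) by (rule order_trans)
    then have "integral (cbox a b) d \<le> integral UNIV d"
      by (intro integral_subset_le cb that) auto
    then show ?thesis using that by simp
  qed
  have fcb: "f integrable_on cbox a b" for a b
  proof (rule integrable_L1_limit_cbox)
    fix e :: real assume "e > 0"
    show "\<exists>g d. g integrable_on cbox a b \<and> d integrable_on cbox a b \<and>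
      (\<forall>x. norm (f x - g x) \<le> d x) \<and> integral (cbox a b) d \<le> e"
    proof -
      obtain g d where "g integrable_on UNIV" "d integrable_on UNIV"
        "\<And>x. norm (f x - g x) \<le> d x" "integral UNIV d \<le> e"
        using approx[OF \<open>e > 0\<close>] by blast
      then show ?thesis by (intro exI[of _ g] exI[of _ d] conjI allI cb dle)
    qed
  qed
  show ?thesis
    unfolding integrable_alt[of f]
  proof (intro conjI allI impI)
    show "(\<lambda>x. if x \<in> UNIV then f x else 0) integrable_on cbox a b" for a b
      using fcb by simp
    fix e :: real assume "e > 0"
    then have e4: "e/4 > 0" by auto
    obtain g d where g: "g integrable_on UNIV" and d: "d integrable_on UNIV"
      and gd: "\<And>x. norm (f x - g x) \<le> d x" and de: "integral UNIV d \<le> e/4"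
      using approx[OF e4] by blast
    obtain B where B: "B > 0" "\<And>a b c d. ball 0 B \<subseteq> cbox a b \<Longrightarrow> ball 0 B \<subseteq> cbox c d \<Longrightarrow>
       norm (integral (cbox a b) g - integral (cbox c d) g) < e/4"
      using integrable_altD(2)[OF g e4] by auto
    \<comment> \<open>The error is uniform in the box: \<open>d\<close> is nonnegative, so its
      integral over any box is at most the one over the whole space. Three errors of e/4 then
      suffice in the Cauchy criterion for large boxes.\<close>
    have close: "norm (integral (cbox u v) f - integral (cbox u v) g) \<le> e/4" for u v
    proof -
      have "norm (integral (cbox u v) (\<lambda>x. f x - g x)) \<le> integral (cbox u v) d"
        by (intro integral_norm_bound_integral integrable_diff fcb cb g d gd)
      also have "\<dots> \<le> e/4" using d gd de by (rule dle)
      finally show ?thesis by (simp add: integral_diff fcb cb g)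
    qed
    show "\<exists>B>0. \<forall>a b c d. ball 0 B \<subseteq> cbox a b \<and> ball 0 B \<subseteq> cbox c d \<longrightarrow>
      norm (integral (cbox a b) (\<lambda>x. if x \<in> UNIV then f x else 0) -
        integral (cbox c d) (\<lambda>x. if x \<in> UNIV then f x else 0)) < e"
    proof (intro exI[of _ B] conjI allI impI \<open>B > 0\<close>)
      fix a b c d :: 'n assume "ball 0 B \<subseteq> cbox a b \<and> ball 0 B \<subseteq> cbox c d"
      then have 1: "norm (integral (cbox a b) g - integral (cbox c d) g) < e/4" using B by blast
      have "integral (cbox a b) f - integral (cbox c d) f =
         (integral (cbox a b) f - integral (cbox a b) g) + (integral (cbox a b) g - integral (cbox c d) g)
         - (integral (cbox c d) f - integral (cbox c d) g)" by simp
      also have "norm \<dots> \<le> norm (integral (cbox a b) f - integral (cbox a b) g)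
         + norm (integral (cbox a b) g - integral (cbox c d) g)
         + norm (integral (cbox c d) f - integral (cbox c d) g)"
        by (rule order_trans[OF norm_triangle_ineq4]) (intro add_mono norm_triangle_ineq order_refl)
      also have "\<dots> < e" using 1 close[of a b] close[of c d] \<open>e > 0\<close> by linarith
      finally show "norm (integral (cbox a b) (\<lambda>x. if x \<in> UNIV then f x else 0) -
        integral (cbox c d) (\<lambda>x. if x \<in> UNIV then f x else 0)) < e" by simp
    qed
  qed
qed

section \<open>Strong measurability\<close>

text \<open>Bochner's notion: everywhere limits of simple functions. In a nonseparable space Borel
  measurability need not be preserved under sums, whereas this notion is, and it forces a separable
  range.\<close>

definition strongly_measurable :: "'m measure \<Rightarrow> ('m \<Rightarrow> 'a::metric_space) \<Rightarrow> bool" where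
  "strongly_measurable M f \<longleftrightarrow>
     (\<exists>s. (\<forall>i::nat. simple_function M (s i)) \<and> (\<forall>x\<in>space M. (\<lambda>i. s i x) \<longlonglongrightarrow> f x))"

lemma strongly_measurable_borel:
  assumes "strongly_measurable M f" shows "f \<in> borel_measurable M"
proof -
  obtain s where s: "\<And>i::nat. simple_function M (s i)" "\<And>x. x\<in>space M \<Longrightarrow> (\<lambda>i. s i x) \<longlonglongrightarrow> f x"
    using assms by (auto simp: strongly_measurable_def)
  show ?thesis
    by (rule borel_measurable_LIMSEQ_metric[of s]) (auto intro: s borel_measurable_simple_function)
qed

lemma strongly_measurable_simple:
  "simple_function M f \<Longrightarrow> strongly_measurable M f"
  unfolding strongly_measurable_def by (intro exI[of _ "\<lambda>_. f"]) auto

lemma strongly_measurable_const [intro, simp]: "strongly_measurable M (\<lambda>_. c)"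
  by (rule strongly_measurable_simple) simp

lemma strongly_measurable_of_borel:
  fixes f :: "'m \<Rightarrow> 'a::{metric_space, second_countable_topology}"
  assumes "f \<in> borel_measurable M"
  shows "strongly_measurable M f"
proof -
  obtain F where "\<forall>i. simple_function M (F i)" "\<forall>x\<in>space M. (\<lambda>i. F i x) \<longlonglongrightarrow> f x"
    using borel_measurable_implies_sequence_metric[OF assms, of undefined] by blast
  then show ?thesis unfolding strongly_measurable_def by blast
qed

lemma strongly_measurable_cong:
  assumes "\<And>x. x \<in> space M \<Longrightarrow> f x = g x"
  shows "strongly_measurable M f \<longleftrightarrow> strongly_measurable M g"
  unfolding strongly_measurable_def using assms by auto

text \<open>Approximants are combined before the limit is taken, so that only sequential continuity
  of \<open>h\<close> enters. Sums, differences, scalar multiples and pairs are instances.\<close>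

lemma strongly_measurable_continuous2:
  assumes f: "strongly_measurable M f" and g: "strongly_measurable M g"
    and h: "continuous_on UNIV (\<lambda>p. h (fst p) (snd p))"
  shows "strongly_measurable M (\<lambda>x. h (f x) (g x))"
proof -
  obtain s where s: "\<And>i::nat. simple_function M (s i)" "\<And>x. x\<in>space M \<Longrightarrow> (\<lambda>i. s i x) \<longlonglongrightarrow> f x"
    using f by (auto simp: strongly_measurable_def)
  obtain t where t: "\<And>i::nat. simple_function M (t i)" "\<And>x. x\<in>space M \<Longrightarrow> (\<lambda>i. t i x) \<longlonglongrightarrow> g x"
    using g by (auto simp: strongly_measurable_def)
  show ?thesis unfolding strongly_measurable_def
  proof (intro exI[of _ "\<lambda>i x. h (s i x) (t i x)"] conjI allI ballI)
    show "simple_function M (\<lambda>x. h (s i x) (t i x))" for i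
      by (rule simple_function_compose2[OF s(1) t(1)])
    fix x assume "x \<in> space M"
    then have "(\<lambda>i. (s i x, t i x)) \<longlonglongrightarrow> (f x, g x)" by (intro tendsto_Pair s t)
    from continuous_on_tendsto_compose[OF h this] show "(\<lambda>i. h (s i x) (t i x)) \<longlonglongrightarrow> h (f x) (g x)"
      by simp
  qed
qed

lemma strongly_measurable_add:
  fixes f g :: "'m \<Rightarrow> 'a::real_normed_vector"
  shows "strongly_measurable M f \<Longrightarrow> strongly_measurable M g \<Longrightarrow> strongly_measurable M (\<lambda>x. f x + g x)"
  by (rule strongly_measurable_continuous2[where h="(+)"]) (auto intro!: continuous_intros)

lemma strongly_measurable_diff:
  fixes f g :: "'m \<Rightarrow> 'a::real_normed_vector"
  shows "strongly_measurable M f \<Longrightarrow> strongly_measurable M g \<Longrightarrow> strongly_measurable M (\<lambda>x. f x - g x)"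
  by (rule strongly_measurable_continuous2[where h="(-)"]) (auto intro!: continuous_intros)

lemma strongly_measurable_scaleR:
  fixes g :: "'m \<Rightarrow> 'a::real_normed_vector"
  shows "f \<in> borel_measurable M \<Longrightarrow> strongly_measurable M g \<Longrightarrow> strongly_measurable M (\<lambda>x. f x *\<^sub>R g x)"
  by (rule strongly_measurable_continuous2[where h="(*\<^sub>R)"])
     (auto intro!: continuous_intros strongly_measurable_of_borel)

lemma strongly_measurable_bounded_linear:
  fixes f :: "'m \<Rightarrow> 'a::real_normed_vector"
  assumes "bounded_linear h" "strongly_measurable M f"
  shows "strongly_measurable M (\<lambda>x. h (f x))"
proof (rule strongly_measurable_continuous2[where h="\<lambda>x y. h x" and g=f])
  show "continuous_on UNIV (\<lambda>p::'a \<times> 'a. h (fst p))"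
    by (intro bounded_linear.continuous_on[OF assms(1)] continuous_on_fst continuous_on_id)
qed (fact assms(2))+

lemma strongly_measurable_sum:
  fixes f :: "'i \<Rightarrow> 'm \<Rightarrow> 'a::real_normed_vector"
  assumes "\<And>i. i \<in> I \<Longrightarrow> strongly_measurable M (f i)"
  shows "strongly_measurable M (\<lambda>x. \<Sum>i\<in>I. f i x)"
  using assms by (induction I rule: infinite_finite_induct) (auto intro: strongly_measurable_add)

lemma strongly_measurable_compose:
  assumes f: "strongly_measurable N f" and g: "g \<in> measurable M N"
  shows "strongly_measurable M (\<lambda>x. f (g x))"
proof -
  obtain s where s: "\<And>i::nat. simple_function N (s i)" "\<And>x. x\<in>space N \<Longrightarrow> (\<lambda>i. s i x) \<longlonglongrightarrow> f x"
    using f by (auto simp: strongly_measurable_def)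
  have "simple_function M (s i \<circ> g)" for i
    unfolding simple_function_def
  proof safe
    have "(s i \<circ> g) ` space M \<subseteq> s i ` space N" using measurable_space[OF g] by auto
    then show "finite ((s i \<circ> g) ` space M)" using simple_functionD(1)[OF s(1)] finite_subset by blast
    fix x
    have "(s i \<circ> g) -` {(s i \<circ> g) x} \<inter> space M = g -` (s i -` {s i (g x)} \<inter> space N) \<inter> space M"
      using measurable_space[OF g] by auto
    also have "\<dots> \<in> sets M" by (intro measurable_sets[OF g] simple_functionD(2) s)
    finally show "(s i \<circ> g) -` {(s i \<circ> g) x} \<inter> space M \<in> sets M" .
  qed
  then show ?thesis unfolding strongly_measurable_def using s(2) measurable_space[OF g]
    by (intro exI[of _ "\<lambda>i. s i \<circ> g"]) auto
qed

text \<open>One half of Pettis' theorem. Enumerate the countable set by \<open>c\<close> and let the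
  i-th approximant be the point nearest to f x among c 0, ..., c i. Taking the least index among
  ties makes the choice a measurable function with finitely many values.\<close>

lemma strongly_measurable_separable_range:
  assumes f: "f \<in> borel_measurable M" and C: "countable C" "f ` space M \<subseteq> closure C"
  shows "strongly_measurable M f"
proof (cases "space M = {}")
  case True
  then show ?thesis unfolding strongly_measurable_def
    by (intro exI[of _ "\<lambda>_ _. undefined"]) simp
next
  case False
  then have "C \<noteq> {}" using C(2) by auto
  then obtain c :: "nat \<Rightarrow> _" where c: "range c = C"
    using C(1) by (metis range_from_nat_into)
  define P where "P i x j \<longleftrightarrow> j \<le> i \<and> (\<forall>l\<in>{..i}. dist (f x) (c j) \<le> dist (f x) (c l))" for i x j
  define J where "J i x = (LEAST j. P i x j)" for i x
  have J: "P i x (J i x)" for i x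
  proof -
    obtain j where "is_arg_min (\<lambda>j. dist (f x) (c j)) (\<lambda>j. j \<in> {..i}) j"
      using ex_is_arg_min_if_finite[of "{..i}"] by blast
    then have "j \<in> {..i}" "\<forall>l\<in>{..i}. dist (f x) (c j) \<le> dist (f x) (c l)"
      by (simp_all add: is_arg_min_linorder)
    then have "P i x j" by (simp add: P_def)
    then show ?thesis unfolding J_def by (rule LeastI)
  qed
  have [measurable]: "(\<lambda>x. dist (f x) y) \<in> borel_measurable M" for y
    by (rule measurable_compose[OF f]) (intro borel_measurable_continuous_onI continuous_intros)
  have mJ: "J i \<in> measurable M (count_space UNIV)" for i
    unfolding J_def[abs_def] P_def by measurable
  have simpleJ: "simple_function M (J i)" for i
    unfolding simple_function_eq_measurable
  proof (intro conjI mJ)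
    have "J i ` space M \<subseteq> {..i}" using J by (auto simp: P_def)
    then show "finite (J i ` space M)" using finite_subset by blast
  qed
  show ?thesis unfolding strongly_measurable_def
  proof (intro exI[of _ "\<lambda>i x. c (J i x)"] conjI allI ballI)
    show "simple_function M (\<lambda>x. c (J i x))" for i
      by (rule simple_function_compose1[OF simpleJ])
    fix x assume "x \<in> space M"
    then have x: "f x \<in> closure C" using C(2) by auto
    show "(\<lambda>i. c (J i x)) \<longlonglongrightarrow> f x"
    proof (rule metric_LIMSEQ_I)
      fix e :: real assume "e > 0"
      then obtain l where l: "dist (c l) (f x) < e"
        using x c by (auto simp: closure_approachable)
      have "dist (c (J i x)) (f x) < e" if "i \<ge> l" for i
      proof -
        have "dist (f x) (c (J i x)) \<le> dist (f x) (c l)" using J[of i x] that by (auto simp: P_def)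
        then show ?thesis using l by (simp add: dist_commute)
      qed
      then show "\<exists>no. \<forall>n\<ge>no. dist (c (J n x)) (f x) < e" by blast
    qed
  qed
qed

text \<open>The values of all simple approximants of all \<open>u i\<close> form a countable set
  whose closure contains the range of the limit. Since metric limits of Borel functions are Borel,
  the separable range criterion applies, and no diagonal sequence has to be extracted.\<close>

lemma strongly_measurable_LIMSEQ:
  assumes u: "\<And>i::nat. strongly_measurable M (u i)"
    and lim: "\<And>x. x \<in> space M \<Longrightarrow> (\<lambda>i. u i x) \<longlonglongrightarrow> f x"
  shows "strongly_measurable M f"
proof -
  obtain s where s: "\<And>i j::nat. simple_function M (s i j)"
      "\<And>i x. x\<in>space M \<Longrightarrow> (\<lambda>j. s i j x) \<longlonglongrightarrow> u i x"
    using u unfolding strongly_measurable_def by metis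
  define C where "C = (\<Union>i. \<Union>j. s i j ` space M)"
  show ?thesis
  proof (rule strongly_measurable_separable_range)
    show "f \<in> borel_measurable M"
      by (rule borel_measurable_LIMSEQ_metric[OF strongly_measurable_borel[OF u] lim])
    have "countable (s i j ` space M)" for i j
      by (intro countable_finite simple_functionD(1) s(1))
    then show "countable C" unfolding C_def by simp
    show "f ` space M \<subseteq> closure C"
    proof safe
      fix x assume x: "x \<in> space M"
      have "u i x \<in> closure C" for i
      proof -
        have "\<forall>j. s i j x \<in> C" using x by (auto simp: C_def)
        then show ?thesis unfolding closure_sequential using s(2)[OF x, of i]
          by (intro exI[of _ "\<lambda>j. s i j x"] conjI)
      qed
      then show "f x \<in> closure C"
        using closed_sequentially[OF closed_closure, of "\<lambda>i. u i x"] lim[OF x] by blast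
    qed
  qed
qed

text \<open>Values of norm above 2 * norm (f x) are reset to 0. A factor larger than 1 leaves room
  for convergence: where f x is nonzero the reset happens only finitely often. Where f x = 0 the
  truncated sequence is identically 0.\<close>

lemma strongly_measurable_dominated:
  fixes f :: "'m \<Rightarrow> 'a::real_normed_vector"
  assumes "strongly_measurable M f"
  obtains s where "\<And>i::nat. simple_function M (s i)" "\<And>x. x\<in>space M \<Longrightarrow> (\<lambda>i. s i x) \<longlonglongrightarrow> f x"
    "\<And>i x. norm (s i x) \<le> 2 * norm (f x)"
proof -
  obtain s where s: "\<And>i::nat. simple_function M (s i)" "\<And>x. x\<in>space M \<Longrightarrow> (\<lambda>i. s i x) \<longlonglongrightarrow> f x"
    using assms by (auto simp: strongly_measurable_def)
  note [measurable] = strongly_measurable_borel[OF assms] borel_measurable_simple_function[OF s(1)]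
  define r where "r i x = (if norm (s i x) \<le> 2 * norm (f x) then s i x else 0)" for i x
  show thesis
  proof
    show "norm (r i x) \<le> 2 * norm (f x)" for i x by (simp add: r_def)
    show "simple_function M (r i)" for i
    proof -
      have "simple_function M (\<lambda>x. if x \<in> {x\<in>space M. norm (s i x) \<le> 2 * norm (f x)} then s i x else 0)"
        by (rule simple_function_If_set) (auto intro: s, measurable)
      then show ?thesis by (rule simple_function_cong[THEN iffD1, rotated]) (simp add: r_def)
    qed
    fix x assume x: "x \<in> space M"
    show "(\<lambda>i. r i x) \<longlonglongrightarrow> f x"
    proof (cases "f x = 0")
      case True
      then show ?thesis by (auto simp: r_def intro!: tendsto_eventually always_eventually)
    next
      case False
      have "(\<lambda>i. norm (s i x)) \<longlonglongrightarrow> norm (f x)" using s(2)[OF x] by (rule tendsto_norm)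
      moreover have "norm (f x) < 2 * norm (f x)" using False by simp
      ultimately have "eventually (\<lambda>i. norm (s i x) < 2 * norm (f x)) sequentially"
        by (rule order_tendstoD(2))
      then have "eventually (\<lambda>i. s i x = r i x) sequentially"
        by eventually_elim (simp add: r_def)
      then show ?thesis by (rule Lim_transform_eventually[OF s(2)[OF x]])
    qed
  qed
qed

section \<open>Bochner integrability and convergence in L1\<close>

definition vintegrable :: "'m measure \<Rightarrow> ('m \<Rightarrow> 'a::banach) \<Rightarrow> bool" where
  "vintegrable M f \<longleftrightarrow> strongly_measurable M f \<and> integrable M (\<lambda>x. norm (f x))"

lemma vintegrable_bound:
  assumes "strongly_measurable M f" "integrable M g" "AE x in M. norm (f x) \<le> g x"
  shows "vintegrable M f"
  unfolding vintegrable_def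
proof (intro conjI assms(1))
  show "integrable M (\<lambda>x. norm (f x))"
    by (rule Bochner_Integration.integrable_bound[OF assms(2)])
       (use strongly_measurable_borel[OF assms(1)] assms(3) in auto)
qed

lemma simple_function_sum_form:
  fixes s :: "'m \<Rightarrow> 'a::real_vector"
  assumes "simple_function M s" and x: "x \<in> space M"
  shows "s x = (\<Sum>c\<in>s ` space M. indicat_real {x\<in>space M. s x = c} x *\<^sub>R c)"
proof -
  have "(\<Sum>c\<in>s ` space M. indicat_real {x\<in>space M. s x = c} x *\<^sub>R c) = (\<Sum>c\<in>s ` space M. if s x = c then c else 0)"
    using x by (intro sum.cong refl) (simp add: indicator_def)
  also have "\<dots> = s x" using x simple_functionD(1)[OF assms(1)] by simp
  finally show ?thesis by simp
qed

text \<open>Bochner induction for \<open>vintegrable\<close>. The limit case hands over the bound 2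
  * norm (f x), so that dominated convergence is available at each use; the premise on the space
  makes convergence hold at all points of the type.\<close>

lemma vintegrable_induct [consumes 2, case_names indicator add limit]:
  fixes f :: "'m \<Rightarrow> 'a::banach"
  assumes spM: "space M = UNIV" and f: "vintegrable M f"
    and ind: "\<And>E c. E \<in> sets M \<Longrightarrow> emeasure M E < \<infinity> \<Longrightarrow> P (\<lambda>x. indicat_real E x *\<^sub>R c)"
    and add: "\<And>g h. vintegrable M g \<Longrightarrow> vintegrable M h \<Longrightarrow> P g \<Longrightarrow> P h \<Longrightarrow> P (\<lambda>x. g x + h x)"
    and lim: "\<And>f s. (\<And>i::nat. vintegrable M (s i)) \<Longrightarrow> (\<And>i. P (s i)) \<Longrightarrow> (\<And>x. (\<lambda>i. s i x) \<longlonglongrightarrow> f x)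
      \<Longrightarrow> (\<And>i x. norm (s i x) \<le> 2 * norm (f x)) \<Longrightarrow> vintegrable M f \<Longrightarrow> P f"
  shows "P f"
proof -
  have fm: "strongly_measurable M f" and fi: "integrable M (\<lambda>x. norm (f x))"
    using f by (auto simp: vintegrable_def)
  obtain s where s: "\<And>i::nat. simple_function M (s i)"
      "\<And>x. x \<in> space M \<Longrightarrow> (\<lambda>i. s i x) \<longlonglongrightarrow> f x"
      "\<And>i x. norm (s i x) \<le> 2 * norm (f x)"
    by (rule strongly_measurable_dominated[OF fm]) (rule that)
  have vind: "vintegrable M (\<lambda>x. indicat_real E x *\<^sub>R c)"
    if "E \<in> sets M" "emeasure M E < \<infinity>" for E and c :: 'a
    unfolding vintegrable_def using that
    by (auto intro!: strongly_measurable_scaleR)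
  have s_int: "vintegrable M (s i)" for i
    by (rule vintegrable_bound[where g="\<lambda>x. 2 * norm (f x)"])
       (auto intro!: strongly_measurable_simple s fi)
  have vadd: "vintegrable M (\<lambda>x. g x + h x)" if "vintegrable M g" "vintegrable M h" for g h :: "'m \<Rightarrow> 'a"
    by (rule vintegrable_bound[where g="\<lambda>x. norm (g x) + norm (h x)"])
       (use that in \<open>auto simp: vintegrable_def norm_triangle_ineq intro!: strongly_measurable_add\<close>)
  have Ps: "P (s i)" for i
  proof -
    note fin = simple_functionD(1)[OF s(1)[of i]]
    define F where "F A x = (\<Sum>c\<in>A. indicat_real {x\<in>space M. s i x = c} x *\<^sub>R c)" for A x
    have zero: "P (\<lambda>x. 0)" "vintegrable M (\<lambda>x. 0::'a)"
      using ind[of "{}" 0] vind[of "{}" 0] by auto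
    have piece: "P (\<lambda>x. indicat_real {x\<in>space M. s i x = c} x *\<^sub>R c) \<and>
        vintegrable M (\<lambda>x. indicat_real {x\<in>space M. s i x = c} x *\<^sub>R c)" for c
    \<comment> \<open>The level set of 0 may have infinite measure but contributes the zero
      function. For other values Chebyshev's inequality makes the level set finite.\<close>
    proof (cases "c = 0")
      case True then show ?thesis using zero by simp
    next
      case False
      have E: "{x\<in>space M. s i x = c} \<in> sets M"
        using simple_functionD(2)[OF s(1)[of i], of "{c}"] by (simp add: vimage_def spM)
      have "integrable M (\<lambda>x. norm (s i x) / norm c)"
        using s_int by (simp add: vintegrable_def)
      then have "integrable M (indicat_real {x\<in>space M. s i x = c})"
        by (rule Bochner_Integration.integrable_bound)
           (use E False in \<open>auto simp: indicator_def\<close>)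
      then have "emeasure M {x\<in>space M. s i x = c} < \<infinity>" using E
        by (simp add: integrable_indicator_iff spM)
      then show ?thesis using E ind vind by blast
    qed
    have "P (F A) \<and> vintegrable M (F A)" if "finite A" for A
      using that
    proof (induction A rule: finite_induct)
      case empty then show ?case using zero by (simp add: F_def[abs_def])
    next
      case (insert c A)
      then have "F (insert c A) = (\<lambda>x. indicat_real {x\<in>space M. s i x = c} x *\<^sub>R c + F A x)"
        unfolding F_def by (intro ext sum.insert)
      then show ?case using add[of "\<lambda>x. indicat_real {x\<in>space M. s i x = c} x *\<^sub>R c" "F A"] vadd insert.IH piece
        by simp
    qed
    moreover have "s i = F (s i ` space M)"
      unfolding F_def by (intro ext simple_function_sum_form s(1)) (simp add: spM)
    ultimately show ?thesis using fin by metis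
  qed
  show ?thesis by (rule lim[OF s_int Ps s(2)[unfolded spM, OF UNIV_I] s(3) f])
qed

lemma vintegrable_add: "vintegrable M f \<Longrightarrow> vintegrable M g \<Longrightarrow> vintegrable M (\<lambda>x. f x + g x)"
  by (rule vintegrable_bound[where g="\<lambda>x. norm (f x) + norm (g x)"])
     (auto simp: vintegrable_def norm_triangle_ineq intro!: strongly_measurable_add)

lemma vintegrable_diff: "vintegrable M f \<Longrightarrow> vintegrable M g \<Longrightarrow> vintegrable M (\<lambda>x. f x - g x)"
  by (rule vintegrable_bound[where g="\<lambda>x. norm (f x) + norm (g x)"])
     (auto simp: vintegrable_def norm_triangle_ineq4 intro!: strongly_measurable_diff)

lemma vintegrable_zero [simp]: "vintegrable M (\<lambda>x. 0)"
  by (simp add: vintegrable_def)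

lemma vintegrable_bounded_linear:
  fixes f :: "'m \<Rightarrow> 'a::banach" and h :: "'a \<Rightarrow> 'b::banach"
  assumes h: "bounded_linear h" and f: "vintegrable M f" shows "vintegrable M (\<lambda>x. h (f x))"
proof -
  obtain K where K: "\<And>x. norm (h x) \<le> norm x * K" using bounded_linear.bounded[OF h] by blast
  show ?thesis
    by (rule vintegrable_bound[where g="\<lambda>x. norm (f x) * K"])
       (use f K in \<open>auto simp: vintegrable_def intro!: strongly_measurable_bounded_linear[OF h]\<close>)
qed

lemma vintegrable_scaleR_left:
  fixes c :: "'a::banach"
  assumes "integrable M f" shows "vintegrable M (\<lambda>x. f x *\<^sub>R c)"
  by (rule vintegrable_bound[where g="\<lambda>x. \<bar>f x\<bar> * norm c"])
     (use assms in \<open>auto intro!: strongly_measurable_scaleR\<close>)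

text \<open>Pratt's form of dominated convergence, with majorants that vary with j. From norm (Fj -
  F) \<le> Gj + G follows norm (Fj - F) \<le> min (norm (Fj - F)) (2 G) + (Gj - G) + max 0 (G - Gj).
  The first and last terms are dominated by 2 G and G and tend to 0 pointwise; the integral of the
  middle one tends to 0 by \<open>limI\<close>.\<close>

lemma L1_convergence_varying_bound:
  fixes F :: "'m \<Rightarrow> 'a::banach"
  assumes Fj: "\<And>j::nat. vintegrable M (Fj j)" and F: "vintegrable M F"
    and Gj: "\<And>j. integrable M (Gj j)" and G: "integrable M (G :: 'm \<Rightarrow> real)"
    and limF: "AE x in M. (\<lambda>j. Fj j x) \<longlonglongrightarrow> F x" and limG: "AE x in M. (\<lambda>j. Gj j x) \<longlonglongrightarrow> G x"
    and bnd: "\<And>j x. norm (Fj j x) \<le> Gj j x" "\<And>x. norm (F x) \<le> G x"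
    and limI: "(\<lambda>j. \<integral>x. Gj j x \<partial>M) \<longlonglongrightarrow> (\<integral>x. G x \<partial>M)"
  shows "(\<lambda>j. \<integral>x. norm (Fj j x - F x) \<partial>M) \<longlonglongrightarrow> 0"
proof -
  have G0: "0 \<le> G x" for x using norm_ge_zero bnd(2) by (rule order_trans)
  have Gj0: "0 \<le> Gj j x" for j x using norm_ge_zero bnd(1) by (rule order_trans)
  have [measurable]: "G \<in> borel_measurable M" "Gj j \<in> borel_measurable M" for j
    using G Gj by (auto dest: borel_measurable_integrable)
  have d: "integrable M (\<lambda>x. norm (Fj j x - F x))" for j
    using vintegrable_diff[OF Fj F] by (simp add: vintegrable_def)
  then have [measurable]: "(\<lambda>x. norm (Fj j x - F x)) \<in> borel_measurable M" for j
    by (rule borel_measurable_integrable)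
  have i1: "integrable M (\<lambda>x. min (norm (Fj j x - F x)) (2 * G x))" for j
    by (rule Bochner_Integration.integrable_bound[of _ "\<lambda>x. 2 * G x"]) (use G G0 in \<open>auto simp: min_def\<close>)
  have i2: "integrable M (\<lambda>x. max 0 (G x - Gj j x))" for j
    by (rule Bochner_Integration.integrable_bound[OF G]) (use G0 Gj0 in \<open>auto simp: max_def\<close>)
  have "(\<lambda>j. \<integral>x. min (norm (Fj j x - F x)) (2 * G x) \<partial>M) \<longlonglongrightarrow> (\<integral>x. 0 \<partial>M)"
  proof (rule integral_dominated_convergence[where w="\<lambda>x. 2 * G x"])
    show "AE x in M. (\<lambda>j. min (norm (Fj j x - F x)) (2 * G x)) \<longlonglongrightarrow> 0"
      using limF
    proof eventually_elim
      case (elim x)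
      have "(\<lambda>j. min (norm (Fj j x - F x)) (2 * G x)) \<longlonglongrightarrow> min (norm (F x - F x)) (2 * G x)"
        by (intro tendsto_min tendsto_norm tendsto_diff elim tendsto_const)
      then show ?case using G0[of x] by simp
    qed
  qed (use G G0 in auto)
  then have l1: "(\<lambda>j. \<integral>x. min (norm (Fj j x - F x)) (2 * G x) \<partial>M) \<longlonglongrightarrow> 0" by simp
  have "(\<lambda>j. \<integral>x. max 0 (G x - Gj j x) \<partial>M) \<longlonglongrightarrow> (\<integral>x. 0 \<partial>M)"
  proof (rule integral_dominated_convergence[where w=G])
    show "AE x in M. (\<lambda>j. max 0 (G x - Gj j x)) \<longlonglongrightarrow> 0"
      using limG
    proof eventually_elim
      case (elim x)
      have "(\<lambda>j. max 0 (G x - Gj j x)) \<longlonglongrightarrow> max 0 (G x - G x)"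
        by (intro tendsto_max tendsto_diff elim tendsto_const)
      then show ?case by simp
    qed
  qed (use G G0 Gj0 in \<open>auto simp: max_def\<close>)
  then have l2: "(\<lambda>j. \<integral>x. max 0 (G x - Gj j x) \<partial>M) \<longlonglongrightarrow> 0" by simp
  have l3: "(\<lambda>j. (\<integral>x. Gj j x \<partial>M) - (\<integral>x. G x \<partial>M)) \<longlonglongrightarrow> 0"
    using limI by (simp add: LIM_zero)
  have lim: "(\<lambda>j. (\<integral>x. min (norm (Fj j x - F x)) (2 * G x) \<partial>M)
      + (((\<integral>x. Gj j x \<partial>M) - (\<integral>x. G x \<partial>M)) + (\<integral>x. max 0 (G x - Gj j x) \<partial>M))) \<longlonglongrightarrow> 0"
    using tendsto_add[OF l1 tendsto_add[OF l3 l2]] by simp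
  show ?thesis
  proof (rule tendsto_sandwich[OF _ _ tendsto_const lim])
    show "\<forall>\<^sub>F j in sequentially. 0 \<le> (\<integral>x. norm (Fj j x - F x) \<partial>M)" by simp
    show "\<forall>\<^sub>F j in sequentially. (\<integral>x. norm (Fj j x - F x) \<partial>M) \<le> (\<integral>x. min (norm (Fj j x - F x)) (2 * G x) \<partial>M)
      + (((\<integral>x. Gj j x \<partial>M) - (\<integral>x. G x \<partial>M)) + (\<integral>x. max 0 (G x - Gj j x) \<partial>M))"
    proof (rule always_eventually, rule allI)
      fix j
      have "(\<integral>x. norm (Fj j x - F x) \<partial>M) \<le>
          (\<integral>x. min (norm (Fj j x - F x)) (2 * G x) + ((Gj j x - G x) + max 0 (G x - Gj j x)) \<partial>M)"
      proof (rule integral_mono[OF d])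
        show "integrable M (\<lambda>x. min (norm (Fj j x - F x)) (2 * G x) + ((Gj j x - G x) + max 0 (G x - Gj j x)))"
          using i1 i2 G Gj by simp
        fix x
        have "norm (Fj j x - F x) \<le> Gj j x + G x"
          using norm_triangle_ineq4[of "Fj j x" "F x"] bnd(1)[of j x] bnd(2)[of x] by linarith
        then show "norm (Fj j x - F x) \<le> min (norm (Fj j x - F x)) (2 * G x) + ((Gj j x - G x) + max 0 (G x - Gj j x))"
          by (simp add: min_def max_def)
      qed
      also have "\<dots> = (\<integral>x. min (norm (Fj j x - F x)) (2 * G x) \<partial>M)
          + (((\<integral>x. Gj j x \<partial>M) - (\<integral>x. G x \<partial>M)) + (\<integral>x. max 0 (G x - Gj j x) \<partial>M))"
        using i1[of j] i2[of j] G Gj[of j] by simp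
      finally show "(\<integral>x. norm (Fj j x - F x) \<partial>M) \<le> (\<integral>x. min (norm (Fj j x - F x)) (2 * G x) \<partial>M)
          + (((\<integral>x. Gj j x \<partial>M) - (\<integral>x. G x \<partial>M)) + (\<integral>x. max 0 (G x - Gj j x) \<partial>M))" .
    qed
  qed
qed

lemma L1_convergence_dominated:
  fixes f :: "'m \<Rightarrow> 'a::banach"
  assumes "\<And>i::nat. vintegrable M (s i)" "vintegrable M f" "integrable M w"
    and "\<And>x. (\<lambda>i. s i x) \<longlonglongrightarrow> f x" "\<And>i x. norm (s i x) \<le> w x" "\<And>x. norm (f x) \<le> w x"
  shows "(\<lambda>i. \<integral>x. norm (s i x - f x) \<partial>M) \<longlonglongrightarrow> 0"
  by (rule L1_convergence_varying_bound[where Gj="\<lambda>_. w" and G=w]) (simp_all add: assms)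

section \<open>The vector-valued integral on the real line\<close>

lemma space_lborel_UNIV: "space lborel = UNIV"
  by simp

lemma negligible_AE_lborel:
  assumes "AE x in lborel. P x" shows "negligible {x. \<not> P x}"
proof -
  obtain N where "N \<in> null_sets lborel" "{x\<in>space lborel. \<not> P x} \<subseteq> N"
    using assms unfolding eventually_ae_filter by blast
  then show ?thesis
    by (metis (no_types, lifting) Collect_mono_iff negligible_iff_null_sets negligible_subset
        null_sets_completionI space_lborel space_borel UNIV_I mem_Collect_eq subset_iff)
qed

text \<open>Gauge integrability is clear for an indicator times a vector and stable under sums; in
  the limit case \<open>\<lambda>x. norm (f x - s i x)\<close> serves as the majorant
  \<open>d\<close> of \<open>integrable_L1_limit\<close>.\<close>

lemma vintegrable_imp_integrable_on:
  fixes f :: "real \<Rightarrow> 'a::banach"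
  assumes "vintegrable lborel f" shows "f integrable_on UNIV"
  using space_lborel_UNIV assms
proof (induct rule: vintegrable_induct)
  case (indicator E c)
  then have "integrable lborel (indicat_real E)" by simp
  then have "indicat_real E integrable_on UNIV" by (rule integrable_on_lborel)
  then show ?case by (rule integrable_on_scaleR_left)
next
  case (add g h)
  then show ?case by (intro integrable_add)
next
  case (limit f s)
  have fi: "integrable lborel (\<lambda>x. norm (f x))" using limit(5) by (simp add: vintegrable_def)
  have dint: "vintegrable lborel (\<lambda>x. f x - s i x)" for i by (rule vintegrable_diff[OF limit(5,1)])
  have "(\<lambda>i. \<integral>x. norm (s i x - f x) \<partial>lborel) \<longlonglongrightarrow> 0"
    by (rule L1_convergence_dominated[where w="\<lambda>x. 2 * norm (f x)"]) (use limit fi in auto)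
  then have lim0: "(\<lambda>i. \<integral>x. norm (f x - s i x) \<partial>lborel) \<longlonglongrightarrow> 0" by (simp only: norm_minus_commute)
  show ?case
  proof (rule integrable_L1_limit)
    fix e :: real assume "e > 0"
    with lim0 obtain i where i: "norm ((\<integral>x. norm (f x - s i x) \<partial>lborel) - 0) < e"
      by (meson LIMSEQ_D order_refl)
    have di: "integrable lborel (\<lambda>x. norm (f x - s i x))" using dint[of i] by (simp add: vintegrable_def)
    show "\<exists>g d. g integrable_on UNIV \<and> d integrable_on UNIV \<and>
      (\<forall>x. norm (f x - g x) \<le> d x) \<and> integral UNIV d \<le> e"
      using limit(2)[of i] integrable_on_lborel[OF di] integral_lborel[OF di] i
      by (intro exI[of _ "s i"] exI[of _ "\<lambda>x. norm (f x - s i x)"]) auto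
  qed
qed

text \<open>The value is 0 off the Bochner integrable functions, even where the gauge integral
  exists. With this default, parameter integrals are strongly measurable in the parameter without
  exceptional points.\<close>

definition vint :: "(real \<Rightarrow> 'a::banach) \<Rightarrow> 'a" where
  "vint f = (if vintegrable lborel f then integral UNIV f else 0)"

lemma vint_eq: "vintegrable lborel f \<Longrightarrow> vint f = integral UNIV f"
  by (simp add: vint_def)

lemma norm_vint_le:
  assumes "vintegrable lborel f" shows "norm (vint f) \<le> (\<integral>x. norm (f x) \<partial>lborel)"
proof -
  have i: "integrable lborel (\<lambda>x. norm (f x))" using assms by (simp add: vintegrable_def)
  show ?thesis unfolding vint_eq[OF assms] integral_lborel[OF i, symmetric]
    by (rule integral_norm_bound_integral[OF vintegrable_imp_integrable_on[OF assms] integrable_on_lborel[OF i]]) simp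
qed

lemma vint_zero [simp]: "vint (\<lambda>x. 0) = 0"
  by (simp add: vint_def)

lemma vint_add: "vintegrable lborel f \<Longrightarrow> vintegrable lborel g \<Longrightarrow> vint (\<lambda>x. f x + g x) = vint f + vint g"
  by (simp add: vint_eq vintegrable_add integral_add vintegrable_imp_integrable_on)

lemma vint_diff: "vintegrable lborel f \<Longrightarrow> vintegrable lborel g \<Longrightarrow> vint (\<lambda>x. f x - g x) = vint f - vint g"
  by (simp add: vint_eq vintegrable_diff integral_diff vintegrable_imp_integrable_on)

lemma vint_bounded_linear:
  assumes "bounded_linear h" "vintegrable lborel f" shows "vint (\<lambda>x. h (f x)) = h (vint f)"
  using integral_linear[OF vintegrable_imp_integrable_on[OF assms(2)] assms(1)]
  by (simp add: vint_eq vintegrable_bounded_linear assms o_def)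

lemma vint_scaleR_right: "vintegrable lborel f \<Longrightarrow> vint (\<lambda>x. (c::real) *\<^sub>R f x) = c *\<^sub>R vint f"
  by (rule vint_bounded_linear[OF bounded_linear_scaleR_right])

lemma vint_scaleR_left:
  fixes c :: "'a::banach"
  assumes "integrable lborel f" shows "vint (\<lambda>x. f x *\<^sub>R c) = (\<integral>x. f x \<partial>lborel) *\<^sub>R c"
proof -
  have v: "vintegrable lborel f" unfolding vintegrable_def
    using assms by (auto intro!: strongly_measurable_of_borel)
  show ?thesis
    using vint_bounded_linear[OF bounded_linear_scaleR_left v, of c] vint_eq[OF v]
      integral_lborel[OF assms] by simp
qed

lemma vint_cong_AE:
  assumes "strongly_measurable lborel f" "strongly_measurable lborel g"
    and ae: "AE x in lborel. f x = g x"
  shows "vint f = vint g" "vintegrable lborel f \<longleftrightarrow> vintegrable lborel g"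
proof -
  note [measurable] = assms(1,2)[THEN strongly_measurable_borel]
  have "integrable lborel (\<lambda>x. norm (f x)) \<longleftrightarrow> integrable lborel (\<lambda>x. norm (g x))"
    by (rule integrable_cong_AE) (use ae in auto)
  then show 1: "vintegrable lborel f \<longleftrightarrow> vintegrable lborel g" using assms by (simp add: vintegrable_def)
  have "integral UNIV f = integral UNIV g"
    by (rule integral_spike[OF negligible_AE_lborel[OF ae]]) auto
  with 1 show "vint f = vint g" by (simp add: vint_def)
qed

lemma vint_eq_integral_AE:
  assumes "vintegrable lborel f" and ae: "AE x in lborel. f x = g x"
  shows "g integrable_on UNIV" "integral UNIV g = vint f"
proof -
  note n = negligible_AE_lborel[OF ae]
  show "g integrable_on UNIV"
    by (rule integrable_spike[OF vintegrable_imp_integrable_on[OF assms(1)] n]) auto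
  show "integral UNIV g = vint f" unfolding vint_eq[OF assms(1)]
    by (rule integral_spike[OF n]) auto
qed

lemma vint_LIMSEQ_L1:
  assumes s: "\<And>i::nat. vintegrable lborel (s i)" and f: "vintegrable lborel f"
    and lim: "(\<lambda>i. \<integral>x. norm (s i x - f x) \<partial>lborel) \<longlonglongrightarrow> 0"
  shows "(\<lambda>i. vint (s i)) \<longlonglongrightarrow> vint f"
proof -
  have "(\<lambda>i. vint (s i) - vint f) \<longlonglongrightarrow> 0"
  proof (rule Lim_null_comparison[OF _ lim], rule always_eventually, rule allI)
    fix i
    show "norm (vint (s i) - vint f) \<le> (\<integral>x. norm (s i x - f x) \<partial>lborel)"
      using norm_vint_le[OF vintegrable_diff[OF s f], of i] vint_diff[OF s f, of i] by simp
  qed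
  then show ?thesis by (simp add: LIM_zero_iff)
qed

lemma vint_LIMSEQ_dominated:
  assumes s: "\<And>i::nat. strongly_measurable lborel (s i)"
    and lim: "\<And>x. (\<lambda>i. s i x) \<longlonglongrightarrow> f x"
    and dom: "\<And>i x. norm (s i x) \<le> w x" and w: "integrable lborel w"
  shows "(\<lambda>i. vint (s i)) \<longlonglongrightarrow> vint f" "vintegrable lborel f" "\<And>i. vintegrable lborel (s i)"
proof -
  have fm: "strongly_measurable lborel f" by (rule strongly_measurable_LIMSEQ[OF s lim])
  have fw: "norm (f x) \<le> w x" for x
    by (rule LIMSEQ_le_const2[OF tendsto_norm[OF lim]]) (use dom in blast)
  show si: "vintegrable lborel (s i)" for i by (rule vintegrable_bound[OF s w]) (use dom in simp)
  show fi: "vintegrable lborel f" by (rule vintegrable_bound[OF fm w]) (use fw in simp)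
  show "(\<lambda>i. vint (s i)) \<longlonglongrightarrow> vint f"
    by (intro vint_LIMSEQ_L1 L1_convergence_dominated[OF _ _ w] si fi lim dom fw)
qed

text \<open>The values m = -1 and m = 1 give the reflections and translations by which variables are
  changed in convolutions. Scalar substitution settles indicators, and dominated convergence on both
  sides settles limits.\<close>

lemma vint_affine:
  fixes f :: "real \<Rightarrow> 'a::banach"
  assumes f: "vintegrable lborel f" and m: "\<bar>m\<bar> = 1"
  shows "vintegrable lborel (\<lambda>x. f (t + m * x)) \<and> vint (\<lambda>x. f (t + m * x)) = vint f"
  using space_lborel_UNIV f
proof (induct rule: vintegrable_induct)
  case (indicator E c)
  have m0: "m \<noteq> 0" using m by auto
  have i: "integrable lborel (indicat_real E)" using indicator by simp
  have j: "integrable lborel (\<lambda>x. indicat_real E (t + m * x))"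
    using lborel_integrable_real_affine_iff[OF m0] i by blast
  have "(\<integral>x. indicat_real E (t + m * x) \<partial>lborel) = (\<integral>x. indicat_real E x \<partial>lborel)"
    using lborel_integral_real_affine[OF m0, of "indicat_real E" t] m by simp
  then show ?case using vint_scaleR_left[OF i, of c] vint_scaleR_left[OF j, of c] vintegrable_scaleR_left[OF j, of c]
    by simp
next
  case (add g h)
  then show ?case by (simp add: vintegrable_add vint_add)
next
  case (limit f s)
  have m0: "m \<noteq> 0" using m by auto
  have sm: "strongly_measurable lborel (s i)" for i using limit(1) by (simp add: vintegrable_def)
  have w: "integrable lborel (\<lambda>x. 2 * norm (f x))" using limit(5) by (simp add: vintegrable_def)
  have w': "integrable lborel (\<lambda>x. 2 * norm (f (t + m * x)))"
    using lborel_integrable_real_affine_iff[OF m0, of "\<lambda>x. 2 * norm (f x)" t] w by blast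
  have sm': "strongly_measurable lborel (\<lambda>x. s i (t + m * x))" for i
    by (rule strongly_measurable_compose[OF sm]) simp
  note a = vint_LIMSEQ_dominated[OF sm limit(3,4) w]
  note b = vint_LIMSEQ_dominated[OF sm' limit(3) limit(4) w']
  have "(\<lambda>i. vint (s i)) \<longlonglongrightarrow> vint (\<lambda>x. f (t + m * x))"
    using b(1) limit(2) by simp
  from LIMSEQ_unique[OF a(1) this] b(2) show ?case by simp
qed

lemma vint_reflect:
  "vintegrable lborel f \<Longrightarrow> vintegrable lborel (\<lambda>x. f (t - x)) \<and> vint (\<lambda>x. f (t - x)) = vint f"
  using vint_affine[of f "-1" t] by simp

lemma vint_shift:
  "vintegrable lborel f \<Longrightarrow> vintegrable lborel (\<lambda>x. f (x - t)) \<and> vint (\<lambda>x. f (x - t)) = vint f"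
  using vint_affine[of f 1 "-t"] by simp

section \<open>Fubini's theorem\<close>

lemma vint_sum:
  assumes "finite I" "\<And>i. i \<in> I \<Longrightarrow> vintegrable lborel (f i)"
  shows "vintegrable lborel (\<lambda>x. \<Sum>i\<in>I. f i x) \<and> vint (\<lambda>x. \<Sum>i\<in>I. f i x) = (\<Sum>i\<in>I. vint (f i))"
  using assms by (induction I rule: finite_induct) (simp_all add: vintegrable_add vint_add)

text \<open>If f is not integrable and c is nonzero, both sides are 0 by default. This makes the
  formula applicable to all sections of a function on the plane, of which only almost every one is
  integrable.\<close>

lemma vint_scaleR_left':
  fixes c :: "'a::banach"
  assumes [measurable]: "f \<in> borel_measurable lborel"
  shows "vint (\<lambda>x. f x *\<^sub>R c) = (\<integral>x. f x \<partial>lborel) *\<^sub>R c"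
proof (cases "integrable lborel f \<or> c = 0")
  case True then show ?thesis using vint_scaleR_left[of f c] by auto
next
  case False
  then have "\<not> vintegrable lborel (\<lambda>x. f x *\<^sub>R c)"
    using integrable_norm_iff[of f lborel] by (auto simp: vintegrable_def)
  then show ?thesis using False by (simp add: vint_def not_integrable_integral_eq)
qed

lemma strongly_measurable_section:
  "strongly_measurable (N \<Otimes>\<^sub>M lborel) f \<Longrightarrow> x \<in> space N \<Longrightarrow> strongly_measurable lborel (\<lambda>y. f (x, y))"
  by (rule strongly_measurable_compose) auto

text \<open>The set \<open>G\<close> of parameters whose section is integrable is measurable. On
  \<open>G\<close> the integrals of dominated simple approximants converge to that of f; off
  \<open>G\<close> the default gives 0, matched by the factor \<open>indicat_real G x\<close>. For a
  simple function the integral is a finite sum of vectors with measurable scalar integrals as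
  coefficients.\<close>

lemma strongly_measurable_vint:
  fixes f :: "'n \<times> real \<Rightarrow> 'a::banach"
  assumes f: "strongly_measurable (N \<Otimes>\<^sub>M lborel) f"
  shows "strongly_measurable N (\<lambda>x. vint (\<lambda>y. f (x, y)))"
proof -
  let ?M = "N \<Otimes>\<^sub>M (lborel :: real measure)"
  obtain s where s: "\<And>i::nat. simple_function ?M (s i)"
      "\<And>x. x \<in> space ?M \<Longrightarrow> (\<lambda>i. s i x) \<longlonglongrightarrow> f x"
      "\<And>i x. norm (s i x) \<le> 2 * norm (f x)"
    by (rule strongly_measurable_dominated[OF f]) (rule that)
  have [measurable]: "f \<in> borel_measurable ?M" by (rule strongly_measurable_borel[OF f])
  define G where "G = {x\<in>space N. (\<integral>\<^sup>+y. ennreal (norm (f (x, y))) \<partial>lborel) < \<infinity>}"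
  have [measurable]: "G \<in> sets N" unfolding G_def by measurable
  have G: "vintegrable lborel (\<lambda>y. f (x, y)) \<longleftrightarrow> x \<in> G" if "x \<in> space N" for x
  proof -
    have "(\<lambda>y. f (x, y)) \<in> borel_measurable lborel"
      by (rule strongly_measurable_borel[OF strongly_measurable_section[OF f that]])
    then show ?thesis
      using that strongly_measurable_section[OF f that]
      by (auto simp: vintegrable_def G_def integrable_iff_bounded)
  qed
  show ?thesis
  proof (rule strongly_measurable_LIMSEQ)
    fix x assume x: "x \<in> space N"
    have sm: "strongly_measurable lborel (\<lambda>y. s i (x, y))" for i
      by (rule strongly_measurable_section[OF strongly_measurable_simple[OF s(1)] x])
    show "(\<lambda>i. indicat_real G x *\<^sub>R vint (\<lambda>y. s i (x, y))) \<longlonglongrightarrow> vint (\<lambda>y. f (x, y))"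
    proof (cases "x \<in> G")
      case True
      then have "integrable lborel (\<lambda>y. 2 * norm (f (x, y)))"
        using G[OF x] by (simp add: vintegrable_def)
      moreover have "(\<lambda>i. s i (x, y)) \<longlonglongrightarrow> f (x, y)" for y
        by (rule s(2)) (simp add: space_pair_measure x)
      ultimately have "(\<lambda>i. vint (\<lambda>y. s i (x, y))) \<longlonglongrightarrow> vint (\<lambda>y. f (x, y))"
        by (intro vint_LIMSEQ_dominated[OF sm _ s(3)])
      then show ?thesis using True by simp
    next
      case False
      then show ?thesis using G[OF x] by (simp add: vint_def)
    qed
  next
    fix i
    define C where "C = s i ` space ?M"
    define E where "E c = {p\<in>space ?M. s i p = c}" for c
    have fin: "finite C" unfolding C_def by (rule simple_functionD(1)[OF s(1)])
    have [measurable]: "E c \<in> sets ?M" for c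
    proof -
      have "E c = s i -` {c} \<inter> space ?M" by (auto simp: E_def)
      then show ?thesis using simple_functionD(2)[OF s(1)] by simp
    qed
    define h where "h x = (\<Sum>c\<in>C. (\<integral>y. indicat_real (E c) (x, y) \<partial>lborel) *\<^sub>R c)" for x
    have eq: "vint (\<lambda>y. s i (x, y)) = h x" if x: "x \<in> G" for x
    proof -
      have xN: "x \<in> space N" using x by (simp add: G_def)
      have fi: "integrable lborel (\<lambda>y. norm (f (x, y)))" using G[OF xN] x by (simp add: vintegrable_def)
      have [measurable]: "(\<lambda>y. indicat_real (E c) (x, y)) \<in> borel_measurable lborel" for c
        using xN by measurable
      have v: "vintegrable lborel (\<lambda>y. indicat_real (E c) (x, y) *\<^sub>R c)" for c
      proof (rule vintegrable_bound[where g="\<lambda>y. 2 * norm (f (x, y))"])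
        show "strongly_measurable lborel (\<lambda>y. indicat_real (E c) (x, y) *\<^sub>R c)"
          by (intro strongly_measurable_scaleR strongly_measurable_const) measurable
        show "integrable lborel (\<lambda>y. 2 * norm (f (x, y)))" using fi by simp
        show "AE y in lborel. norm (indicat_real (E c) (x, y) *\<^sub>R c) \<le> 2 * norm (f (x, y))"
          using s(3)[of i] by (intro AE_I2) (auto simp: indicator_def E_def)
      qed
      have "(\<lambda>y. s i (x, y)) = (\<lambda>y. \<Sum>c\<in>C. indicat_real (E c) (x, y) *\<^sub>R c)"
        unfolding C_def E_def
        by (intro ext simple_function_sum_form s(1)) (simp add: space_pair_measure xN)
      then have "vint (\<lambda>y. s i (x, y)) = (\<Sum>c\<in>C. vint (\<lambda>y. indicat_real (E c) (x, y) *\<^sub>R c))"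
        using vint_sum[OF fin v] by simp
      also have "\<dots> = h x" unfolding h_def by (intro sum.cong refl vint_scaleR_left') measurable
      finally show ?thesis .
    qed
    have "strongly_measurable N (\<lambda>x. indicat_real G x *\<^sub>R h x)"
      unfolding h_def
      by (intro strongly_measurable_scaleR strongly_measurable_sum strongly_measurable_const
          borel_measurable_indicator lborel.borel_measurable_lebesgue_integral) (simp_all add: case_prod_unfold)
    then show "strongly_measurable N (\<lambda>x. indicat_real G x *\<^sub>R vint (\<lambda>y. s i (x, y)))"
      by (rule strongly_measurable_cong[THEN iffD1, rotated]) (auto simp: indicator_def eq)
  qed
qed

abbreviation (input) lborel2 :: "(real \<times> real) measure" where "lborel2 \<equiv> lborel \<Otimes>\<^sub>M lborel"

lemma vintegrable_section_AE:
  fixes f :: "real \<times> real \<Rightarrow> 'a::banach"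
  assumes f: "vintegrable lborel2 f"
  shows "AE x in lborel. vintegrable lborel (\<lambda>y. f (x, y))"
proof -
  have "AE x in lborel. integrable lborel (\<lambda>y. norm (f (x, y)))"
    using f lborel_pair.AE_integrable_fst'[of "\<lambda>p. norm (f p)"] by (simp add: vintegrable_def)
  then show ?thesis
    by eventually_elim (use f in \<open>auto simp: vintegrable_def intro: strongly_measurable_section\<close>)
qed

text \<open>The L1 norm on the plane controls the iterated integral. This contraction is what lets
  Fubini's theorem pass to L1 limits.\<close>

lemma vint_iterated_bound:
  fixes f :: "real \<times> real \<Rightarrow> 'a::banach"
  assumes f: "vintegrable lborel2 f"
  shows "vintegrable lborel (\<lambda>x. vint (\<lambda>y. f (x, y)))"
    "norm (vint (\<lambda>x. vint (\<lambda>y. f (x, y)))) \<le> (\<integral>p. norm (f p) \<partial>lborel2)"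
proof -
  have i: "integrable lborel2 (\<lambda>p. norm (f p))" using f by (simp add: vintegrable_def)
  have j: "integrable lborel (\<lambda>x. \<integral>y. norm (f (x, y)) \<partial>lborel)"
    using lborel_pair.integrable_fst'[OF i] by simp
  have ae: "AE x in lborel. norm (vint (\<lambda>y. f (x, y))) \<le> (\<integral>y. norm (f (x, y)) \<partial>lborel)"
    using vintegrable_section_AE[OF f] by eventually_elim (rule norm_vint_le)
  show v: "vintegrable lborel (\<lambda>x. vint (\<lambda>y. f (x, y)))"
    by (rule vintegrable_bound[OF _ j ae]) (use f in \<open>auto simp: vintegrable_def intro: strongly_measurable_vint\<close>)
  have "norm (vint (\<lambda>x. vint (\<lambda>y. f (x, y)))) \<le> (\<integral>x. norm (vint (\<lambda>y. f (x, y))) \<partial>lborel)"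
    by (rule norm_vint_le[OF v])
  also have "\<dots> \<le> (\<integral>x. \<integral>y. norm (f (x, y)) \<partial>lborel \<partial>lborel)"
    by (rule integral_mono_AE[OF _ j ae]) (use v in \<open>simp add: vintegrable_def\<close>)
  also have "\<dots> = (\<integral>p. norm (f p) \<partial>lborel2)" by (rule lborel_pair.integral_fst'[OF i])
  finally show "norm (vint (\<lambda>x. vint (\<lambda>y. f (x, y)))) \<le> (\<integral>p. norm (f p) \<partial>lborel2)" .
qed

lemma vint_iterated_add:
  fixes f g :: "real \<times> real \<Rightarrow> 'a::banach"
  assumes f: "vintegrable lborel2 f" and g: "vintegrable lborel2 g"
  shows "vint (\<lambda>x. vint (\<lambda>y. f (x, y) + g (x, y))) = vint (\<lambda>x. vint (\<lambda>y. f (x, y))) + vint (\<lambda>x. vint (\<lambda>y. g (x, y)))"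
proof -
  have sm: "strongly_measurable lborel (\<lambda>x. vint (\<lambda>y. h (x, y)))" if "vintegrable lborel2 h" for h :: "real \<times> real \<Rightarrow> 'a"
    using that by (auto simp: vintegrable_def intro: strongly_measurable_vint)
  have "vint (\<lambda>x. vint (\<lambda>y. f (x, y) + g (x, y))) = vint (\<lambda>x. vint (\<lambda>y. f (x, y)) + vint (\<lambda>y. g (x, y)))"
  proof (rule vint_cong_AE)
    show "AE x in lborel. vint (\<lambda>y. f (x, y) + g (x, y)) = vint (\<lambda>y. f (x, y)) + vint (\<lambda>y. g (x, y))"
      using vintegrable_section_AE[OF f] vintegrable_section_AE[OF g]
      by eventually_elim (rule vint_add)
  qed (use sm[OF vintegrable_add[OF f g]] strongly_measurable_add[OF sm[OF f] sm[OF g]] in simp_all)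
  also have "\<dots> = vint (\<lambda>x. vint (\<lambda>y. f (x, y))) + vint (\<lambda>x. vint (\<lambda>y. g (x, y)))"
    by (intro vint_add vint_iterated_bound f g)
  finally show ?thesis .
qed

lemma vint_iterated_uminus:
  fixes f :: "real \<times> real \<Rightarrow> 'a::banach"
  assumes f: "vintegrable lborel2 f"
  shows "vint (\<lambda>x. vint (\<lambda>y. - f (x, y))) = - vint (\<lambda>x. vint (\<lambda>y. f (x, y)))"
proof -
  have m: "vintegrable lborel2 (\<lambda>p. - f p)"
    by (rule vintegrable_bounded_linear[OF _ f]) (intro bounded_linear_minus bounded_linear_ident)
  show ?thesis using vint_iterated_add[OF f m] by (simp add: eq_neg_iff_add_eq_0 add.commute)
qed

lemma vint_iterated_LIMSEQ:
  fixes f :: "real \<times> real \<Rightarrow> 'a::banach"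
  assumes s: "\<And>i::nat. vintegrable lborel2 (s i)" and f: "vintegrable lborel2 f"
    and lim: "(\<lambda>i. \<integral>p. norm (s i p - f p) \<partial>lborel2) \<longlonglongrightarrow> 0"
  shows "(\<lambda>i. vint (\<lambda>x. vint (\<lambda>y. s i (x, y)))) \<longlonglongrightarrow> vint (\<lambda>x. vint (\<lambda>y. f (x, y)))"
proof -
  have m: "vintegrable lborel2 (\<lambda>p. - f p)"
    by (rule vintegrable_bounded_linear[OF _ f]) (intro bounded_linear_minus bounded_linear_ident)
  have "(\<lambda>i. vint (\<lambda>x. vint (\<lambda>y. s i (x, y))) - vint (\<lambda>x. vint (\<lambda>y. f (x, y)))) \<longlonglongrightarrow> 0"
  proof (rule Lim_null_comparison[OF _ lim], rule always_eventually, rule allI)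
    fix i
    show "norm (vint (\<lambda>x. vint (\<lambda>y. s i (x, y))) - vint (\<lambda>x. vint (\<lambda>y. f (x, y)))) \<le> (\<integral>p. norm (s i p - f p) \<partial>lborel2)"
      using vint_iterated_bound(2)[OF vintegrable_add[OF s[of i] m]] vint_iterated_add[OF s[of i] m] vint_iterated_uminus[OF f]
      by simp
  qed
  then show ?thesis by (simp add: LIM_zero_iff)
qed

lemma vintegrable_swap:
  fixes F :: "real \<times> real \<Rightarrow> 'a::banach"
  assumes "vintegrable lborel2 F"
  shows "vintegrable lborel2 (\<lambda>(x, y). F (y, x))"
  using assms strongly_measurable_compose[of lborel2 F "\<lambda>(x, y). (y, x)" lborel2]
    lborel_pair.integrable_product_swap_iff[of "\<lambda>p. norm (F p)"]
  by (simp add: vintegrable_def case_prod_unfold measurable_pair_swap')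

text \<open>Indicators reduce to the scalar theorem. Both iterated integrals are additive and
  continuous in L1; for the order with y outside, these facts are applied to the function with its
  arguments exchanged.\<close>

theorem vint_Fubini:
  fixes f :: "real \<times> real \<Rightarrow> 'a::banach"
  assumes f: "vintegrable lborel2 f"
  shows "vint (\<lambda>x. vint (\<lambda>y. f (x, y))) = vint (\<lambda>y. vint (\<lambda>x. f (x, y)))"
proof -
  have sp: "space lborel2 = UNIV" by (simp add: space_pair_measure)
  note swap = vintegrable_swap
  show ?thesis
    using sp f
  proof (induct rule: vintegrable_induct)
    case (indicator E c)
    then have [measurable]: "E \<in> sets lborel2" by simp
    have i: "integrable lborel2 (case_prod (\<lambda>x y. indicat_real E (x, y)))"
      using indicator by (simp add: case_prod_unfold)
    have 1: "vint (\<lambda>y. indicat_real E (x, y) *\<^sub>R c) = (\<integral>y. indicat_real E (x, y) \<partial>lborel) *\<^sub>R c" for x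
      by (rule vint_scaleR_left') measurable
    have 2: "vint (\<lambda>x. indicat_real E (x, y) *\<^sub>R c) = (\<integral>x. indicat_real E (x, y) \<partial>lborel) *\<^sub>R c" for y
      by (rule vint_scaleR_left') measurable
    show ?case unfolding 1 2
      using lborel_pair.Fubini_integral[OF i]
      by (simp add: vint_scaleR_left lborel_pair.integrable_fst[OF i] lborel_pair.integrable_snd[OF i])
  next
    case (add g h)
    then show ?case
      using vint_iterated_add[OF add(1,2)] vint_iterated_add[OF swap[OF add(1)] swap[OF add(2)]]
      by simp
  next
    case (limit f s)
    have w: "integrable lborel2 (\<lambda>p. norm (f p))" using limit(5) by (simp add: vintegrable_def)
    have lim0: "(\<lambda>i. \<integral>p. norm (s i p - f p) \<partial>lborel2) \<longlonglongrightarrow> 0"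
      by (rule L1_convergence_dominated[where w="\<lambda>p. 2 * norm (f p)"]) (use limit w in auto)
    have lim0': "(\<lambda>i. \<integral>p. norm ((\<lambda>(x, y). s i (y, x)) p - (\<lambda>(x, y). f (y, x)) p) \<partial>lborel2) \<longlonglongrightarrow> 0"
    proof -
      have "(\<integral>p. norm ((\<lambda>(x, y). s i (y, x)) p - (\<lambda>(x, y). f (y, x)) p) \<partial>lborel2) = (\<integral>p. norm (s i p - f p) \<partial>lborel2)" for i
      proof -
        have [measurable]: "(\<lambda>p. norm (s i p - f p)) \<in> borel_measurable lborel2"
          using vintegrable_diff[OF limit(1) limit(5), of i] by (auto simp: vintegrable_def)
        show ?thesis
          using lborel_pair.integral_product_swap[of "\<lambda>p. norm (s i p - f p)"]
          by (simp add: case_prod_unfold)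
      qed
      then show ?thesis using lim0 by simp
    qed
    have "(\<lambda>i. vint (\<lambda>y. vint (\<lambda>x. s i (x, y)))) \<longlonglongrightarrow> vint (\<lambda>y. vint (\<lambda>x. f (x, y)))"
      using vint_iterated_LIMSEQ[OF swap[OF limit(1)] swap[OF limit(5)] lim0'] by simp
    then have "(\<lambda>i. vint (\<lambda>x. vint (\<lambda>y. s i (x, y)))) \<longlonglongrightarrow> vint (\<lambda>y. vint (\<lambda>x. f (x, y)))"
      using limit(2) by simp
    with vint_iterated_LIMSEQ[OF limit(1) limit(5) lim0] show ?case by (rule LIMSEQ_unique)
  qed
qed

section \<open>Closed operators and uniform boundedness\<close>

text \<open>Riemann sums of f lie in \<open>G\<close> because it is a subspace. The integral over a
  box is a limit of such sums, and the integral over the line a limit of box integrals.\<close>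

lemma integral_in_closed_subspace:
  fixes f :: "real \<Rightarrow> 'a::banach"
  assumes f: "f integrable_on UNIV" and G: "closed G" "subspace G" and fG: "\<And>x. f x \<in> G"
  shows "integral UNIV f \<in> G"
proof -
  have near: "y \<in> G" if "\<And>e::real. e > 0 \<Longrightarrow> \<exists>z\<in>G. dist z y < e" for y
    using that G(1) by (metis closure_approachable closure_closed)
  have cb: "integral (cbox a b) f \<in> G" for a b
  proof (rule near)
    fix e :: real assume "e > 0"
    have "f integrable_on cbox a b" using integrable_altD(1)[OF f] by simp
    from integrable_integral[OF this, unfolded has_integral, THEN spec, THEN mp, OF \<open>e > 0\<close>]
    obtain \<gamma> where "gauge \<gamma>" and *: "\<forall>\<D>. \<D> tagged_division_of cbox a b \<and> \<gamma> fine \<D> \<longrightarrow>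
        norm ((\<Sum>(x,k)\<in>\<D>. measure lborel k *\<^sub>R f x) - integral (cbox a b) f) < e"
      by (elim exE conjE) (rule that)
    obtain \<D> where D: "\<D> tagged_division_of cbox a b" "\<gamma> fine \<D>"
      using fine_division_exists[OF \<open>gauge \<gamma>\<close>] by blast
    have "(\<Sum>(x,k)\<in>\<D>. measure lborel k *\<^sub>R f x) \<in> G"
      using subspace_sum[OF G(2), of \<D> "\<lambda>(x,k). measure lborel k *\<^sub>R f x"]
      by (auto intro: subspace_scale[OF G(2)] fG)
    with *[THEN spec, THEN mp, OF conjI[OF D]]
    show "\<exists>z\<in>G. dist z (integral (cbox a b) f) < e"
      unfolding dist_norm by (intro bexI)
  qed
  show ?thesis
  proof (rule near)
    fix e :: real assume "e > 0"
    have "\<nexists>a b. (UNIV::real set) = cbox a b" by (simp add: eq_commute)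
    then obtain B where B: "\<forall>a b. ball 0 B \<subseteq> cbox a b \<longrightarrow>
        (\<exists>z. ((\<lambda>x. if x \<in> UNIV then f x else 0) has_integral z) (cbox a b) \<and> norm (z - integral UNIV f) < e)"
      by (rule has_integral_altD[OF integrable_integral[OF f] _ \<open>e > 0\<close>])
    have "ball 0 B \<subseteq> cbox (-B) B" by (auto simp: dist_norm)
    from B[rule_format, OF this] obtain z where z: "(f has_integral z) (cbox (-B) B)" "norm (z - integral UNIV f) < e"
      by auto
    then show "\<exists>z\<in>G. dist z (integral UNIV f) < e"
      using cb[of "-B" B] by (intro bexI[of _ z]) (simp_all add: dist_norm integral_unique)
  qed
qed

lemma vint_in_closed_subspace:
  assumes f: "vintegrable lborel f" and G: "closed G" "subspace G" and ae: "AE x in lborel. f x \<in> G"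
  shows "vint f \<in> G"
proof -
  define g where "g x = (if f x \<in> G then f x else 0)" for x
  have ae': "AE x in lborel. f x = g x" using ae by eventually_elim (simp add: g_def)
  note v = vint_eq_integral_AE[OF f ae']
  have "integral UNIV g \<in> G"
    by (rule integral_in_closed_subspace[OF v(1) G]) (simp add: g_def subspace_0[OF G(2)])
  with v(2) show ?thesis by simp
qed

lemma scaleR_eq_scaleC: "c *\<^sub>R (x::'a::complex_banach) = complex_of_real c *\<^sub>C x"
  by (simp add: scaleC_of_real)

lemma bounded_linear_scaleC: "bounded_linear (\<lambda>x::'a::complex_banach. c *\<^sub>C x)"
proof (rule bounded_linear_intro[where K="cmod c"])
  show "c *\<^sub>C (r *\<^sub>R x) = r *\<^sub>R (c *\<^sub>C x)" for r and x :: 'a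
    by (simp add: scaleR_eq_scaleC scaleC_scaleC mult.commute)
qed (simp_all add: scaleC_add_right norm_scaleC mult.commute)

lemma closed_operator_graph:
  assumes "closed_operator D A"
  shows "closed {(x, A x) |x. x \<in> D}" "subspace {(x, A x) |x. x \<in> D}"
proof -
  note A = assms[unfolded closed_operator_def]
  show "closed {(x, A x) |x. x \<in> D}" using A by blast
  have sc: "c *\<^sub>R x \<in> D \<and> A (c *\<^sub>R x) = c *\<^sub>R A x" if "x \<in> D" for c x
    using A that by (simp add: scaleR_eq_scaleC)
  have 0: "0 \<in> D" "A 0 = 0" using A sc[of 0 0] by auto
  show "subspace {(x, A x) |x. x \<in> D}"
    unfolding subspace_def
  proof (intro conjI ballI allI)
    show "0 \<in> {(x, A x) |x. x \<in> D}" using 0 by (auto simp: zero_prod_def)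
  qed (use A sc in auto)
qed

text \<open>Hille's theorem. The pair \<open>(f x, g x)\<close> lies for almost every x in the
  graph, which is a closed subspace of the product; hence so does its integral, whose components are
  \<open>vint f\<close> and \<open>vint g\<close>.\<close>

lemma vint_closed_operator:
  fixes f g :: "real \<Rightarrow> 'a::complex_banach"
  assumes A: "closed_operator D A" and f: "vintegrable lborel f" and g: "vintegrable lborel g"
    and ae: "AE x in lborel. f x \<in> D \<and> A (f x) = g x"
  shows "vint f \<in> D \<and> A (vint f) = vint g"
proof -
  have h: "vintegrable lborel (\<lambda>x. (f x, g x))"
  proof (rule vintegrable_bound)
    show "strongly_measurable lborel (\<lambda>x. (f x, g x))"
      by (rule strongly_measurable_continuous2[where h=Pair])
         (use f g in \<open>auto simp: vintegrable_def\<close>)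
    show "integrable lborel (\<lambda>x. norm (f x) + norm (g x))" using f g by (simp add: vintegrable_def)
    show "AE x in lborel. norm (f x, g x) \<le> norm (f x) + norm (g x)"
      by (intro AE_I2 norm_Pair_le)
  qed
  have "vint (\<lambda>x. (f x, g x)) \<in> {(x, A x) |x. x \<in> D}"
    by (rule vint_in_closed_subspace[OF h closed_operator_graph[OF A]]) (use ae in eventually_elim, auto)
  then show ?thesis
    using vint_bounded_linear[OF bounded_linear_fst h] vint_bounded_linear[OF bounded_linear_snd h] by auto
qed

text \<open>The step functions sample f at t rounded up to the grid of mesh 1/(i+1) and capped at
  \<open>T\<close>. Rounding up keeps the sample points inside (0,T], away from 0 where f may blow
  up, and there are finitely many of them.\<close>

lemma strongly_measurable_continuous_on:
  fixes f :: "real \<Rightarrow> 'a::real_normed_vector"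
  assumes f: "continuous_on {0<..T} f"
  shows "strongly_measurable lborel (\<lambda>t. if 0 < t \<and> t \<le> T then f t else 0)"
proof -
  \<comment> \<open>The value -1 marks arguments outside (0,T]; \<open>h\<close> below sends it to
    0.\<close>
  define r where "r i t = (if 0 < t \<and> t \<le> T then min T (of_int \<lceil>t * (real i + 1)\<rceil> / (real i + 1)) else -1)" for i t
  have simple: "simple_function lborel (r i)" for i
  proof (rule simple_function_borel_measurable)
    show "r i \<in> borel_measurable lborel" unfolding r_def by measurable
    have "r i ` space lborel \<subseteq> insert (-1) (insert T ((\<lambda>k. of_int k / (real i + 1)) ` {0..\<lceil>T * (real i + 1)\<rceil>}))"
    proof (rule image_subsetI, rule ccontr)
      fix t assume "r i t \<notin> insert (-1) (insert T ((\<lambda>k. of_int k / (real i + 1)) ` {0..\<lceil>T * (real i + 1)\<rceil>}))"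
      then have *: "r i t \<notin> (\<lambda>k. of_int k / (real i + 1)) ` {0..\<lceil>T * (real i + 1)\<rceil>}" "r i t \<noteq> T" "r i t \<noteq> - 1"
        by blast+
      then have t: "0 < t" "t \<le> T" "r i t = of_int \<lceil>t * (real i + 1)\<rceil> / (real i + 1)"
        by (auto simp: r_def min_def split: if_splits)
      have "\<lceil>t * (real i + 1)\<rceil> \<in> {0..\<lceil>T * (real i + 1)\<rceil>}"
      proof -
        have "t * (real i + 1) \<le> T * (real i + 1)" "0 < t * (real i + 1)" using t(1,2) by simp_all
        from ceiling_mono[OF this(1)] this(2) show ?thesis by simp
      qed
      then have "r i t \<in> (\<lambda>k. of_int k / (real i + 1)) ` {0..\<lceil>T * (real i + 1)\<rceil>}"
        unfolding t(3) by (rule imageI)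
      with *(1) show False by (rule notE)
    qed
    then show "finite (r i ` space lborel)" by (rule finite_subset) simp
  qed
  define h where "h x = (if x = -1 then 0 else f x)" for x
  show ?thesis unfolding strongly_measurable_def
  proof (intro exI[of _ "\<lambda>i t. h (r i t)"] conjI allI ballI)
    show "simple_function lborel (\<lambda>t. h (r i t))" for i by (rule simple_function_compose1[OF simple])
    fix t :: real
    show "(\<lambda>i. h (r i t)) \<longlonglongrightarrow> (if 0 < t \<and> t \<le> T then f t else 0)"
    proof (cases "0 < t \<and> t \<le> T")
      case False then have "r i t = -1" for i by (auto simp: r_def)
      then show ?thesis using False by (auto simp: h_def)
    next
      case True
      have b: "t \<le> r i t \<and> r i t \<le> t + 1 / (real i + 1) \<and> r i t \<le> T" for i
      proof -
        have "t * (real i + 1) \<le> of_int \<lceil>t * (real i + 1)\<rceil>" "of_int \<lceil>t * (real i + 1)\<rceil> \<le> t * (real i + 1) + 1"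
          by linarith+
        then have "t \<le> of_int \<lceil>t * (real i + 1)\<rceil> / (real i + 1)"
            "of_int \<lceil>t * (real i + 1)\<rceil> / (real i + 1) \<le> (t * (real i + 1) + 1) / (real i + 1)"
          by (simp_all add: pos_le_divide_eq divide_right_mono)
        moreover have "(t * (real i + 1) + 1) / (real i + 1) = t + 1 / (real i + 1)"
          using of_nat_0_le_iff[of i] by (simp add: add_divide_distrib)
        ultimately have "t \<le> of_int \<lceil>t * (real i + 1)\<rceil> / (real i + 1)"
            "of_int \<lceil>t * (real i + 1)\<rceil> / (real i + 1) \<le> t + 1 / (real i + 1)" by simp_all
        then show ?thesis using True by (auto simp: r_def min_def)
      qed
      have "(\<lambda>i. t + 1 / (real i + 1)) \<longlonglongrightarrow> t + 0"
        by (intro tendsto_add tendsto_const) (use LIMSEQ_inverse_real_of_nat in \<open>simp add: inverse_eq_divide add.commute\<close>)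
      then have "(\<lambda>i. r i t) \<longlonglongrightarrow> t"
        by (intro tendsto_sandwich[of "\<lambda>_. t" "\<lambda>i. r i t" sequentially "\<lambda>i. t + 1 / (real i + 1)"])
           (use b in auto)
      then have "(\<lambda>i. f (r i t)) \<longlonglongrightarrow> f t"
        by (rule continuous_on_tendsto_compose[OF f])
           (use b True in \<open>auto intro!: always_eventually less_le_trans[of 0 t]\<close>)
      moreover have "h (r i t) = f (r i t)" for i using b[of i] True by (simp add: h_def)
      ultimately show ?thesis using True by simp
    qed
  qed
qed

lemma uniform_boundedness:
  fixes F :: "'i \<Rightarrow> 'a::banach \<Rightarrow> 'b::real_normed_vector"
  assumes lin: "\<And>i. i \<in> I \<Longrightarrow> bounded_linear (F i)"
    and bdd: "\<And>x. \<exists>M. \<forall>i\<in>I. norm (F i x) \<le> M"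
  obtains C where "C \<ge> 0" "\<And>i x. i \<in> I \<Longrightarrow> norm (F i x) \<le> C * norm x"
proof -
  define E where "E n = {x. \<forall>i\<in>I. norm (F i x) \<le> real n}" for n :: nat
  have clE: "closed (E n)" for n
  proof -
    have "closed {x. norm (F i x) \<le> real n}" if "i \<in> I" for i
      using lin[OF that] by (intro closed_Collect_le continuous_intros) (simp add: linear_continuous_on)
    then have "closed (\<Inter>i\<in>I. {x. norm (F i x) \<le> real n})" by blast
    moreover have "(\<Inter>i\<in>I. {x. norm (F i x) \<le> real n}) = E n" by (auto simp: E_def)
    ultimately show ?thesis by simp
  qed
  have "\<exists>n. interior (E n) \<noteq> {}"
  proof (rule ccontr)
    assume "\<not> ?thesis"
    then have "interior (\<Union>(range E)) = {}"
      using Met_TC.metric_Baire_category_alt[of "range E"] clE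
      by (auto simp: complete_UNIV mtopology_is_euclidean mcomplete_iff_complete)
    moreover have "\<Union>(range E) = UNIV"
    proof (intro set_eqI iffI UNIV_I)
      fix x
      obtain M where M: "\<forall>i\<in>I. norm (F i x) \<le> M" using bdd by blast
      obtain n :: nat where "M \<le> real n" using real_arch_simple by blast
      with M have "x \<in> E n" by (force simp: E_def)
      then show "x \<in> \<Union>(range E)" by blast
    qed
    ultimately show False by simp
  qed
  then obtain n z where "z \<in> interior (E n)" by blast
  then obtain e where e: "e > 0" "cball z e \<subseteq> E n"
    by (meson mem_interior_cball)
  show thesis
  proof
    \<comment> \<open>The ball of radius e around z lies in \<open>E n\<close>. For y of norm e
      therefore norm (F i y) \<le> norm (F i (z + y)) + norm (F i z) \<le> 2 n, and scaling gives
      the constant 2 n / e.\<close>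
    show "0 \<le> 2 * real n / e" using e by simp
    fix i x assume i: "i \<in> I"
    interpret bounded_linear "F i" by (rule lin[OF i])
    show "norm (F i x) \<le> 2 * real n / e * norm x"
    proof (cases "x = 0")
      case True then show ?thesis by (simp add: zero)
    next
      case False
      define y where "y = (e / norm x) *\<^sub>R x"
      have "norm y = e" using False e by (simp add: y_def)
      then have "z + y \<in> E n" "z \<in> E n" using e by (auto simp: dist_norm intro!: subsetD[OF e(2)])
      then have "norm (F i (z + y)) \<le> n" "norm (F i z) \<le> n" using i by (auto simp: E_def)
      then have "norm (F i y) \<le> 2 * real n"
        using norm_triangle_ineq4[of "F i (z + y)" "F i z"] by (simp add: add)
      then have "e / norm x * norm (F i x) \<le> 2 * real n" using e by (simp add: y_def scaleR)
      then show ?thesis using False e by (simp add: field_simps)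
    qed
  qed
qed

section \<open>Convolution of nonnegative functions\<close>

text \<open>For functions that vanish on the negative axis this is the convolution over [0,t]. With
  values in \<open>ennreal\<close>, commutativity and associativity hold at every point, including
  those where the value is infinite.\<close>

definition nconv :: "(real \<Rightarrow> ennreal) \<Rightarrow> (real \<Rightarrow> ennreal) \<Rightarrow> real \<Rightarrow> ennreal" where
  "nconv f g t = (\<integral>\<^sup>+s. f (t - s) * g s \<partial>lborel)"

lemma nconv_measurable [measurable]:
  assumes [measurable]: "f \<in> borel_measurable borel" "g \<in> borel_measurable borel"
  shows "nconv f g \<in> borel_measurable borel"
proof -
  have "nconv f g \<in> borel_measurable lborel" unfolding nconv_def by measurable
  then show ?thesis by simp
qed

lemma nn_integral_reflect:
  fixes f :: "real \<Rightarrow> ennreal"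
  assumes [measurable]: "f \<in> borel_measurable borel"
  shows "(\<integral>\<^sup>+s. f (t - s) \<partial>lborel) = (\<integral>\<^sup>+s. f s \<partial>lborel)"
  using nn_integral_real_affine[of f "-1" t] by simp

lemma nn_integral_shift:
  fixes f :: "real \<Rightarrow> ennreal"
  assumes [measurable]: "f \<in> borel_measurable borel"
  shows "(\<integral>\<^sup>+s. f (s - t) \<partial>lborel) = (\<integral>\<^sup>+s. f s \<partial>lborel)"
  using nn_integral_real_affine[of f 1 "-t"] by simp

lemma nconv_commute:
  assumes [measurable]: "f \<in> borel_measurable borel" "g \<in> borel_measurable borel"
  shows "nconv f g t = nconv g f t"
  unfolding nconv_def
  using nn_integral_reflect[of "\<lambda>s. f (t - s) * g s" t] by (simp add: mult.commute)

lemma nconv_assoc: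
  assumes [measurable]: "f \<in> borel_measurable borel" "g \<in> borel_measurable borel" "h \<in> borel_measurable borel"
  shows "nconv f (nconv g h) t = nconv (nconv f g) h t"
proof -
  have "nconv f (nconv g h) t = (\<integral>\<^sup>+s. \<integral>\<^sup>+r. f (t - s) * (g (s - r) * h r) \<partial>lborel \<partial>lborel)"
    unfolding nconv_def by (simp add: nn_integral_cmult)
  also have "\<dots> = (\<integral>\<^sup>+r. \<integral>\<^sup>+s. f (t - s) * (g (s - r) * h r) \<partial>lborel \<partial>lborel)"
    by (rule lborel_pair.Fubini') measurable
  also have "\<dots> = (\<integral>\<^sup>+r. nconv f g (t - r) * h r \<partial>lborel)"
  proof (rule nn_integral_cong)
    fix r
    have "(\<integral>\<^sup>+s. f (t - s) * (g (s - r) * h r) \<partial>lborel) = (\<integral>\<^sup>+s. f (t - s) * g (s - r) \<partial>lborel) * h r"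
      by (simp add: nn_integral_multc[symmetric] mult.assoc)
    also have "(\<integral>\<^sup>+s. f (t - s) * g (s - r) \<partial>lborel) = nconv f g (t - r)"
      using nn_integral_shift[of "\<lambda>s. f (t - r - s) * g s" r] by (simp add: nconv_def algebra_simps)
    finally show "(\<integral>\<^sup>+s. f (t - s) * (g (s - r) * h r) \<partial>lborel) = nconv f g (t - r) * h r" .
  qed
  finally show ?thesis by (simp add: nconv_def)
qed

lemma nn_integral_nconv:
  assumes [measurable]: "f \<in> borel_measurable borel" "g \<in> borel_measurable borel"
  shows "(\<integral>\<^sup>+t. nconv f g t \<partial>lborel) = (\<integral>\<^sup>+t. f t \<partial>lborel) * (\<integral>\<^sup>+t. g t \<partial>lborel)"
proof -
  have "(\<integral>\<^sup>+t. nconv f g t \<partial>lborel) = (\<integral>\<^sup>+s. \<integral>\<^sup>+t. f (t - s) * g s \<partial>lborel \<partial>lborel)"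
    unfolding nconv_def by (rule lborel_pair.Fubini') measurable
  also have "\<dots> = (\<integral>\<^sup>+s. (\<integral>\<^sup>+t. f t \<partial>lborel) * g s \<partial>lborel)"
    by (simp add: nn_integral_multc nn_integral_shift)
  finally show ?thesis by (simp add: nn_integral_cmult)
qed

lemma nconv_cong_AE:
  assumes "AE s in lborel. g s = g' s"
  shows "nconv f g t = nconv f g' t"
  unfolding nconv_def by (rule nn_integral_cong_AE) (use assms in eventually_elim, simp)

lemma nconv_zero:
  assumes "\<And>s. s \<le> 0 \<Longrightarrow> f s = 0" "\<And>s. s \<le> 0 \<Longrightarrow> g s = 0" "t \<le> 0"
  shows "nconv f g t = 0"
proof -
  have "(\<lambda>s. f (t - s) * g s) = (\<lambda>s. 0)"
  proof
    show "f (t - s) * g s = 0" for s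
      using assms(1)[of "t - s"] assms(2)[of s] assms(3) by (cases "s \<le> 0") auto
  qed
  then show ?thesis unfolding nconv_def by (simp only: nn_integral_const mult_zero_left)
qed

text \<open>For nonnegative functions, with the junk value \<open>0\<close> where the convolution is infinite.\<close>

definition pconv :: "(real \<Rightarrow> real) \<Rightarrow> (real \<Rightarrow> real) \<Rightarrow> real \<Rightarrow> real" where
  "pconv f g t = enn2real (nconv (\<lambda>s. ennreal (f s)) (\<lambda>s. ennreal (g s)) t)"

abbreviation (input) pconv_finite :: "(real \<Rightarrow> real) \<Rightarrow> (real \<Rightarrow> real) \<Rightarrow> real \<Rightarrow> bool" where
  "pconv_finite f g t \<equiv> nconv (\<lambda>s. ennreal (f s)) (\<lambda>s. ennreal (g s)) t < \<infinity>"

text \<open>The model is a positive integrable function on (0,L] extended by 0. Vanishing at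
  nonpositive arguments encodes the limits of integration of all convolutions below; a blow-up at 0+
  is permitted.\<close>

definition kernel :: "(real \<Rightarrow> real) \<Rightarrow> bool" where
  "kernel f \<longleftrightarrow> f \<in> borel_measurable borel \<and> (\<forall>t. 0 \<le> f t) \<and> (\<forall>t\<le>0. f t = 0) \<and> integrable lborel f"

lemma kernelD:
  assumes "kernel f"
  shows "f \<in> borel_measurable borel" "\<And>t. 0 \<le> f t" "\<And>t. t \<le> 0 \<Longrightarrow> f t = 0" "integrable lborel f"
    "(\<lambda>s. ennreal (f s)) \<in> borel_measurable borel" "(\<integral>\<^sup>+t. ennreal (f t) \<partial>lborel) < \<infinity>"
proof -
  show f: "f \<in> borel_measurable borel" "\<And>t. 0 \<le> f t" "\<And>t. t \<le> 0 \<Longrightarrow> f t = 0" "integrable lborel f"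
    using assms by (auto simp: kernel_def)
  show "(\<lambda>s. ennreal (f s)) \<in> borel_measurable borel" using f(1) by measurable
  show "(\<integral>\<^sup>+t. ennreal (f t) \<partial>lborel) < \<infinity>"
    using f(2,4) by (simp add: nn_integral_eq_integral)
qed

lemma kernel_enn2real:
  assumes [measurable]: "K \<in> borel_measurable borel" and z: "\<And>t. t \<le> 0 \<Longrightarrow> K t = 0"
    and fin: "(\<integral>\<^sup>+t. K t \<partial>lborel) < \<infinity>"
  shows "kernel (\<lambda>t. enn2real (K t))"
  unfolding kernel_def
proof (intro conjI allI impI)
  show m: "(\<lambda>t. enn2real (K t)) \<in> borel_measurable borel" by measurable
  show "integrable lborel (\<lambda>t. enn2real (K t))"
  proof (rule integrableI_nonneg)
    have "(\<integral>\<^sup>+t. ennreal (enn2real (K t)) \<partial>lborel) \<le> (\<integral>\<^sup>+t. K t \<partial>lborel)"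
      by (intro nn_integral_mono) (metis ennreal_enn2real_if top_greatest order_refl zero_le)
    from this fin show "(\<integral>\<^sup>+t. ennreal (enn2real (K t)) \<partial>lborel) < \<infinity>" by (rule order_le_less_trans)
  qed (use m in simp_all)
qed (use z in auto)

lemma AE_enn2real:
  assumes [measurable]: "K \<in> borel_measurable borel" and fin: "(\<integral>\<^sup>+t. K t \<partial>lborel) < \<infinity>"
  shows "AE t in lborel. ennreal (enn2real (K t)) = K t" "AE t in lborel. K t < \<infinity>"
proof -
  show 1: "AE t in lborel. K t < \<infinity>"
    using nn_integral_PInf_AE[of K lborel] fin by (auto simp: less_top)
  then show "AE t in lborel. ennreal (enn2real (K t)) = K t"
    by eventually_elim (simp add: less_top)
qed

text \<open>The integral of a convolution is the product of the integrals, so the convolution is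
  finite almost everywhere. The default value changes it only on a null set.\<close>

lemma pconv_kernel:
  assumes f: "kernel f" and g: "kernel g"
  shows "kernel (pconv f g)" "AE t in lborel. ennreal (pconv f g t) = nconv (\<lambda>s. ennreal (f s)) (\<lambda>s. ennreal (g s)) t"
    "AE t in lborel. pconv_finite f g t"
proof -
  note [measurable] = kernelD(5)[OF f] kernelD(5)[OF g]
  have fin: "(\<integral>\<^sup>+t. nconv (\<lambda>s. ennreal (f s)) (\<lambda>s. ennreal (g s)) t \<partial>lborel) < \<infinity>"
    by (simp add: nn_integral_nconv ennreal_mult_less_top kernelD(6)[OF f, unfolded infinity_ennreal_def] kernelD(6)[OF g, unfolded infinity_ennreal_def])
  show "kernel (pconv f g)" unfolding pconv_def[abs_def]
    by (rule kernel_enn2real[OF _ nconv_zero fin]) (simp_all add: kernelD(3)[OF f] kernelD(3)[OF g])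
  show "AE t in lborel. ennreal (pconv f g t) = nconv (\<lambda>s. ennreal (f s)) (\<lambda>s. ennreal (g s)) t"
    "AE t in lborel. pconv_finite f g t"
    unfolding pconv_def using AE_enn2real[OF _ fin] by measurable
qed

section \<open>Convolution of operator families\<close>

lemma strongly_measurable_If:
  assumes f: "strongly_measurable M f" and g: "strongly_measurable M g" and P: "{x\<in>space M. P x} \<in> sets M"
  shows "strongly_measurable M (\<lambda>x. if P x then f x else g x)"
proof -
  obtain s where s: "\<And>i::nat. simple_function M (s i)" "\<And>x. x\<in>space M \<Longrightarrow> (\<lambda>i. s i x) \<longlonglongrightarrow> f x"
    using f by (auto simp: strongly_measurable_def)
  obtain t where t: "\<And>i::nat. simple_function M (t i)" "\<And>x. x\<in>space M \<Longrightarrow> (\<lambda>i. t i x) \<longlonglongrightarrow> g x"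
    using g by (auto simp: strongly_measurable_def)
  show ?thesis unfolding strongly_measurable_def
  proof (intro exI[of _ "\<lambda>i x. if P x then s i x else t i x"] conjI allI ballI)
    show "simple_function M (\<lambda>x. if P x then s i x else t i x)" for i
      by (rule simple_function_If[OF s(1) t(1) P])
    fix x assume "x \<in> space M"
    then show "(\<lambda>i. if P x then s i x else t i x) \<longlonglongrightarrow> (if P x then f x else g x)"
      using s(2) t(2) by simp
  qed
qed

text \<open>With a kernel for \<open>h\<close>, the bound forces \<open>H u = 0\<close> at all u
  \<le> 0. The requirement 1 \<le> C makes \<kappa>(u)I obey the same bound as a family dominated by
  \<kappa>. Measurability is required for each orbit only.\<close>

definition op_family :: "'a::complex_banach set \<Rightarrow> ('a \<Rightarrow> 'a) \<Rightarrow> real \<Rightarrow> (real \<Rightarrow> real) \<Rightarrow> (real \<Rightarrow> 'a \<Rightarrow> 'a) \<Rightarrow> bool" where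
  "op_family D A C h H \<longleftrightarrow> 1 \<le> C \<and> (\<forall>u. bounded_clinear (H u)) \<and>
     (\<forall>u x. norm (H u x) \<le> C * h u * norm x) \<and>
     (\<forall>x. strongly_measurable lborel (\<lambda>u. H u x)) \<and>
     (\<forall>u. \<forall>x\<in>D. H u x \<in> D \<and> A (H u x) = H u (A x))"

lemma op_familyD:
  assumes "op_family D A C h H"
  shows "1 \<le> C" "bounded_clinear (H u)" "bounded_linear (H u)" "norm (H u x) \<le> C * h u * norm x"
    "strongly_measurable lborel (\<lambda>u. H u x)" "x \<in> D \<Longrightarrow> H u x \<in> D" "x \<in> D \<Longrightarrow> A (H u x) = H u (A x)"
    "H u (c *\<^sub>C x) = c *\<^sub>C H u x"
  using assms by (auto simp: op_family_def bounded_clinear_def)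

text \<open>The default is decided by the scalar majorant \<open>h\<close> alone and not by x, so
  that the result is a bounded linear operator in every case. The zero operator also maps
  \<open>D\<close> into itself and commutes with \<open>A\<close> there.\<close>

definition opint :: "(real \<Rightarrow> real) \<Rightarrow> (real \<Rightarrow> 'a \<Rightarrow> 'a::banach) \<Rightarrow> 'a \<Rightarrow> 'a" where
  "opint h H x = (if (\<integral>\<^sup>+r. ennreal (h r) \<partial>lborel) < \<infinity> then vint (\<lambda>r. H r x) else 0)"

lemma op_family_vintegrable:
  assumes H: "op_family D A C h H" and h: "h \<in> borel_measurable borel" "\<And>r. 0 \<le> h r"
    and fin: "(\<integral>\<^sup>+r. ennreal (h r) \<partial>lborel) < \<infinity>"
  shows "vintegrable lborel (\<lambda>r. H r x)" "integrable lborel h"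
proof -
  show hi: "integrable lborel h" using h fin by (intro integrableI_nonneg) auto
  show "vintegrable lborel (\<lambda>r. H r x)"
    by (rule vintegrable_bound[OF op_familyD(5)[OF H], where g="\<lambda>r. C * h r * norm x"])
       (use hi op_familyD(4)[OF H] in auto)
qed

lemma opint_operator:
  assumes A: "closed_operator D A" and H: "op_family D A C h H"
    and h: "h \<in> borel_measurable borel" "\<And>r. 0 \<le> h r"
  shows "bounded_clinear (opint h H)"
    "norm (opint h H x) \<le> C * enn2real (\<integral>\<^sup>+r. ennreal (h r) \<partial>lborel) * norm x"
    "x \<in> D \<Longrightarrow> opint h H x \<in> D \<and> A (opint h H x) = opint h H (A x)"
proof -
  have A0: "0 \<in> D" "A 0 = 0"
    using subspace_0[OF closed_operator_graph(2)[OF A]] by (auto simp: zero_prod_def)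
  let ?I = "\<integral>\<^sup>+r. ennreal (h r) \<partial>lborel"
  have bnd: "norm (opint h H x) \<le> C * enn2real ?I * norm x" for x
  proof (cases "?I < \<infinity>")
    case True
    note v = op_family_vintegrable[OF H h True]
    have "norm (vint (\<lambda>r. H r x)) \<le> (\<integral>r. norm (H r x) \<partial>lborel)" by (rule norm_vint_le[OF v(1)])
    also have "\<dots> \<le> (\<integral>r. C * h r * norm x \<partial>lborel)"
      by (rule integral_mono) (use v op_familyD(4)[OF H] in \<open>auto simp: vintegrable_def\<close>)
    also have "\<dots> = C * (\<integral>r. h r \<partial>lborel) * norm x" by simp
    also have "(\<integral>r. h r \<partial>lborel) = enn2real ?I"
      using nn_integral_eq_integral[OF v(2)] h(2) by (simp add: integral_nonneg_AE)
    finally show ?thesis using True by (simp add: opint_def)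
  next
    case False then show ?thesis using op_familyD(1)[OF H] by (simp add: opint_def)
  qed
  then show "norm (opint h H x) \<le> C * enn2real ?I * norm x" .
  note lin = linear_simps[OF op_familyD(3)[OF H]]
  have add: "opint h H (x + y) = opint h H x + opint h H y" for x y
    using op_family_vintegrable(1)[OF H h] by (simp add: opint_def lin vint_add)
  have scC: "opint h H (c *\<^sub>C x) = c *\<^sub>C opint h H x" for c x
    using vint_bounded_linear[OF bounded_linear_scaleC op_family_vintegrable(1)[OF H h], of c]
      linear_0[OF bounded_linear.linear[OF bounded_linear_scaleC[of c]]]
    by (auto simp: opint_def op_familyD(8)[OF H])
  have "bounded_linear (opint h H)"
    by (rule bounded_linear_intro[where K="C * enn2real ?I", OF add])
       (use bnd scC in \<open>auto simp: scaleR_eq_scaleC mult.commute\<close>)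
  then show "bounded_clinear (opint h H)" using scC by (simp add: bounded_clinear_def)
  show "opint h H x \<in> D \<and> A (opint h H x) = opint h H (A x)" if "x \<in> D"
  proof (cases "?I < \<infinity>")
    case True
    note v = op_family_vintegrable[OF H h True]
    have "vint (\<lambda>r. H r x) \<in> D \<and> A (vint (\<lambda>r. H r x)) = vint (\<lambda>r. H r (A x))"
      by (rule vint_closed_operator[OF A v(1) v(1)]) (use op_familyD(6,7)[OF H that] in auto)
    then show ?thesis using True by (simp add: opint_def)
  next
    case False then show ?thesis using A0 by (simp add: opint_def)
  qed
qed

text \<open>Operator families are closed under integration in r with a parameter t, and the new
  scalar majorant is the integral of the old one. Both \<open>volterra\<close> and
  \<open>extension\<close> are obtained in this way.\<close>

lemma opint_family:
  assumes A: "closed_operator D A" and H: "\<And>t. op_family D A C (h t) (H t)"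
    and h: "(\<lambda>(t, r). h t r) \<in> borel_measurable lborel2" "\<And>t r. 0 \<le> h t r"
    and sm: "\<And>x. strongly_measurable lborel2 (\<lambda>(t, r). H t r x)"
  shows "op_family D A C (\<lambda>t. enn2real (\<integral>\<^sup>+r. ennreal (h t r) \<partial>lborel)) (\<lambda>t. opint (h t) (H t))"
proof -
  note [measurable] = h(1)
  have hm: "h t \<in> borel_measurable borel" for t
    using measurable_compose[OF measurable_Pair1'[of t lborel lborel] h(1)] by simp
  have "strongly_measurable lborel (\<lambda>t. opint (h t) (H t) x)" for x
    unfolding opint_def
  proof (rule strongly_measurable_If)
    show "strongly_measurable lborel (\<lambda>t. vint (\<lambda>r. H t r x))"
      using strongly_measurable_vint[OF sm] by simp
    have "{t \<in> space lborel. (\<integral>\<^sup>+r. ennreal ((\<lambda>(t, r). h t r) (t, r)) \<partial>lborel) < \<infinity>} \<in> sets lborel"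
      by measurable
    then show "{t \<in> space lborel. (\<integral>\<^sup>+r. ennreal (h t r) \<partial>lborel) < \<infinity>} \<in> sets lborel" by simp
  qed simp
  then show ?thesis
    unfolding op_family_def
    using opint_operator[OF A H hm h(2)] op_familyD(1)[OF H] by blast
qed

text \<open>The family is measurable orbit by orbit and not in operator norm. With g replaced by a
  simple function, only orbits of finitely many fixed vectors occur; continuity of each operator
  \<open>Q r\<close> carries the limit through.\<close>

lemma op_family_apply_measurable:
  assumes Q: "op_family D A C h Q" and g: "strongly_measurable N g"
  shows "strongly_measurable ((lborel :: real measure) \<Otimes>\<^sub>M N) (\<lambda>(r, v). Q r (g v))"
proof -
  obtain s where s: "\<And>i::nat. simple_function N (s i)" "\<And>x. x\<in>space N \<Longrightarrow> (\<lambda>i. s i x) \<longlonglongrightarrow> g x"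
    using g by (auto simp: strongly_measurable_def)
  show ?thesis
  proof (rule strongly_measurable_LIMSEQ)
    fix p assume p: "p \<in> space ((lborel :: real measure) \<Otimes>\<^sub>M N)"
    then have "snd p \<in> space N" by (auto simp: space_pair_measure)
    then have "(\<lambda>i. Q (fst p) (s i (snd p))) \<longlonglongrightarrow> Q (fst p) (g (snd p))"
      by (intro bounded_linear.tendsto[OF op_familyD(3)[OF Q]] s)
    then show "(\<lambda>i. (\<lambda>(r, v). Q r (s i v)) p) \<longlonglongrightarrow> (\<lambda>(r, v). Q r (g v)) p"
      by (simp add: case_prod_unfold)
  next
    fix i
    define E where "E c = {v\<in>space N. s i v = c}" for c
    have E: "E c \<in> sets N" for c
    proof -
      have "E c = s i -` {c} \<inter> space N" by (auto simp: E_def)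
      then show ?thesis using simple_functionD(2)[OF s(1)] by simp
    qed
    have "strongly_measurable ((lborel :: real measure) \<Otimes>\<^sub>M N) (\<lambda>p. \<Sum>c\<in>s i ` space N. indicat_real (E c) (snd p) *\<^sub>R Q (fst p) c)"
    proof (intro strongly_measurable_sum strongly_measurable_scaleR)
      show "(\<lambda>p. indicat_real (E c) (snd p)) \<in> borel_measurable ((lborel :: real measure) \<Otimes>\<^sub>M N)" for c
        using E[of c] by measurable
      show "strongly_measurable ((lborel :: real measure) \<Otimes>\<^sub>M N) (\<lambda>p. Q (fst p) c)" for c
        by (rule strongly_measurable_compose[OF op_familyD(5)[OF Q] measurable_fst])
    qed
    then show "strongly_measurable ((lborel :: real measure) \<Otimes>\<^sub>M N) (\<lambda>(r, v). Q r (s i v))"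
    proof (rule strongly_measurable_cong[THEN iffD1, rotated])
      fix p assume "p \<in> space ((lborel :: real measure) \<Otimes>\<^sub>M N)"
      then have v: "snd p \<in> space N" by (auto simp: space_pair_measure)
      interpret bounded_linear "Q (fst p)" by (rule op_familyD(3)[OF Q])
      have "Q (fst p) (s i (snd p)) = Q (fst p) (\<Sum>c\<in>s i ` space N. indicat_real (E c) (snd p) *\<^sub>R c)"
        unfolding E_def using simple_function_sum_form[OF s(1)[of i] v] by (rule arg_cong)
      then show "(\<Sum>c\<in>s i ` space N. indicat_real (E c) (snd p) *\<^sub>R Q (fst p) c) = (\<lambda>(r, v). Q r (s i v)) p"
        by (simp add: case_prod_unfold sum scaleR)
    qed
  qed
qed

definition hat :: "real \<Rightarrow> (real \<Rightarrow> real) \<Rightarrow> (real \<Rightarrow> 'a \<Rightarrow> 'a::real_normed_vector) \<Rightarrow> real \<Rightarrow> 'a \<Rightarrow> 'a" where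
  "hat b \<kappa> R u x = (if u \<le> b then R u x else \<kappa> u *\<^sub>R x)"

text \<open>\<open>volterra a \<kappa> R r\<close> is $(a * R)(r)$ for a family \<open>R\<close> bounded by a multiple of \<open>\<kappa>\<close>.\<close>

definition volterra :: "(real \<Rightarrow> real) \<Rightarrow> (real \<Rightarrow> real) \<Rightarrow> (real \<Rightarrow> 'a \<Rightarrow> 'a::banach) \<Rightarrow> real \<Rightarrow> 'a \<Rightarrow> 'a" where
  "volterra a \<kappa> R r = opint (\<lambda>u. a (r - u) * \<kappa> u) (\<lambda>u x. a (r - u) *\<^sub>R R u x)"

lemma nconv_kernel:
  assumes "kernel f" "kernel g"
  shows "nconv (\<lambda>s. ennreal (f s)) (\<lambda>s. ennreal (g s)) t = (\<integral>\<^sup>+s. ennreal (f (t - s) * g s) \<partial>lborel)"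
  unfolding nconv_def using kernelD(2) assms by (simp add: ennreal_mult)

lemma closed_operator_scaleR:
  assumes "closed_operator D A" "x \<in> D"
  shows "c *\<^sub>R x \<in> D" "A (c *\<^sub>R x) = c *\<^sub>R A x"
  using assms unfolding closed_operator_def by (simp_all add: scaleR_eq_scaleC)

lemma closed_operator_zero:
  assumes "closed_operator D A" shows "0 \<in> D" "A 0 = 0"
  using subspace_0[OF closed_operator_graph(2)[OF assms]] by (auto simp: zero_prod_def)

lemma bounded_clinear_scaleR: "bounded_clinear f \<Longrightarrow> bounded_clinear (\<lambda>x. c *\<^sub>R f x)"
  unfolding bounded_clinear_def
  by (auto simp: scaleR_eq_scaleC scaleC_scaleC mult.commute
      intro: bounded_linear_compose[OF bounded_linear_scaleC])

lemma bounded_clinear_ident: "bounded_clinear (\<lambda>x. x)"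
  by (simp add: bounded_clinear_def bounded_linear_ident)

lemma bounded_clinear_compose: "bounded_clinear f \<Longrightarrow> bounded_clinear g \<Longrightarrow> bounded_clinear (\<lambda>x. f (g x))"
  by (auto simp: bounded_clinear_def intro: bounded_linear_compose)

lemma op_family_hat:
  assumes A: "closed_operator D A" and R: "op_family D A C \<kappa> R" and \<kappa>: "kernel \<kappa>"
  shows "op_family D A C \<kappa> (hat b \<kappa> R)"
  unfolding op_family_def
proof (intro conjI allI ballI)
  note C = op_familyD(1)[OF R]
  show "1 \<le> C" by (rule C)
  show "bounded_clinear (hat b \<kappa> R u)" for u
    by (cases "u \<le> b") (simp_all add: hat_def[abs_def] op_familyD(2)[OF R] bounded_clinear_scaleR[OF bounded_clinear_ident])
  show "norm (hat b \<kappa> R u x) \<le> C * \<kappa> u * norm x" for u x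
  proof -
    have "1 * (\<kappa> u * norm x) \<le> C * (\<kappa> u * norm x)" using C kernelD(2)[OF \<kappa>] by (intro mult_right_mono) auto
    then show ?thesis using op_familyD(4)[OF R] kernelD(2)[OF \<kappa>] by (simp add: hat_def mult.assoc)
  qed
  show "strongly_measurable lborel (\<lambda>u. hat b \<kappa> R u x)" for x
    unfolding hat_def by (intro strongly_measurable_If strongly_measurable_scaleR op_familyD(5)[OF R] strongly_measurable_const)
      (use kernelD(1)[OF \<kappa>] in auto)
  fix u x assume "x \<in> D"
  then show "hat b \<kappa> R u x \<in> D" "A (hat b \<kappa> R u x) = hat b \<kappa> R u (A x)"
    using op_familyD(6,7)[OF R] closed_operator_scaleR[OF A] by (auto simp: hat_def)
qed

lemma op_family_volterra_integrand:
  assumes A: "closed_operator D A" and R: "op_family D A C \<kappa> R" and \<kappa>: "kernel \<kappa>" and a: "kernel a"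
  shows "op_family D A C (\<lambda>u. a (r - u) * \<kappa> u) (\<lambda>u x. a (r - u) *\<^sub>R R u x)"
  unfolding op_family_def
proof (intro conjI allI ballI)
  show "1 \<le> C" by (rule op_familyD(1)[OF R])
  show "bounded_clinear (\<lambda>x. a (r - u) *\<^sub>R R u x)" for u
    by (rule bounded_clinear_scaleR[OF op_familyD(2)[OF R]])
  show "norm (a (r - u) *\<^sub>R R u x) \<le> C * (a (r - u) * \<kappa> u) * norm x" for u x
    using mult_left_mono[OF op_familyD(4)[OF R, of u x] kernelD(2)[OF a, of "r - u"]] kernelD(2)[OF a, of "r - u"]
    by (simp add: mult_ac)
  note [measurable] = kernelD(1)[OF a]
  show "strongly_measurable lborel (\<lambda>u. a (r - u) *\<^sub>R R u x)" for x
    by (rule strongly_measurable_scaleR[OF _ op_familyD(5)[OF R]]) measurable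
  fix u x assume "x \<in> D"
  then show "a (r - u) *\<^sub>R R u x \<in> D" "A (a (r - u) *\<^sub>R R u x) = a (r - u) *\<^sub>R R u (A x)"
    using op_familyD(6,7)[OF R] closed_operator_scaleR[OF A] by auto
qed

lemma op_family_volterra:
  assumes A: "closed_operator D A" and R: "op_family D A C \<kappa> R" and \<kappa>: "kernel \<kappa>" and a: "kernel a"
  shows "op_family D A C (pconv a \<kappa>) (volterra a \<kappa> R)"
proof -
  note [measurable] = kernelD(1)[OF a] kernelD(1)[OF \<kappa>]
  have "op_family D A C (\<lambda>r. enn2real (\<integral>\<^sup>+u. ennreal (a (r - u) * \<kappa> u) \<partial>lborel))
      (\<lambda>r. opint (\<lambda>u. a (r - u) * \<kappa> u) (\<lambda>u x. a (r - u) *\<^sub>R R u x))"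
  proof (rule opint_family[OF A op_family_volterra_integrand[OF A R \<kappa> a]])
    show "(\<lambda>(r, u). a (r - u) * \<kappa> u) \<in> borel_measurable lborel2" by measurable
    show "0 \<le> a (r - u) * \<kappa> u" for r u using kernelD(2)[OF a] kernelD(2)[OF \<kappa>] by simp
    show "strongly_measurable lborel2 (\<lambda>(r, u). a (r - u) *\<^sub>R R u x)" for x
      unfolding case_prod_unfold
      by (intro strongly_measurable_scaleR strongly_measurable_compose[OF op_familyD(5)[OF R] measurable_snd]) measurable
  qed
  moreover have "(\<lambda>r. enn2real (\<integral>\<^sup>+u. ennreal (a (r - u) * \<kappa> u) \<partial>lborel)) = pconv a \<kappa>"
    by (simp add: fun_eq_iff pconv_def nconv_kernel[OF a \<kappa>])
  ultimately show ?thesis by (simp add: volterra_def[abs_def])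
qed

section \<open>The extension step\<close>

text \<open>Where the convolution is infinite, the Lebesgue integral and \<open>enn2real\<close>
  both give 0, so the equation holds for all t and r.\<close>

lemma integral_conv_eq:
  assumes f: "kernel f" and g: "kernel g"
  shows "(\<integral>s. f (t - s) * g (s - r) \<partial>lborel) = pconv f g (t - r)"
proof -
  note [measurable] = kernelD(1)[OF f] kernelD(1)[OF g]
  have "(\<integral>s. f (t - s) * g (s - r) \<partial>lborel) = enn2real (\<integral>\<^sup>+s. ennreal (f (t - s) * g (s - r)) \<partial>lborel)"
    by (rule integral_eq_nn_integral) (use kernelD(2)[OF f] kernelD(2)[OF g] in auto)
  also have "(\<integral>\<^sup>+s. ennreal (f (t - s) * g (s - r)) \<partial>lborel) = (\<integral>\<^sup>+s. ennreal (f (t - r - s) * g s) \<partial>lborel)"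
    using nn_integral_shift[of "\<lambda>s. ennreal (f (t - r - s) * g s)" r] by (simp add: algebra_simps)
  finally show ?thesis by (simp add: pconv_def nconv_kernel[OF f g])
qed

lemma AE_reflect:
  assumes "AE x in lborel. P (x::real)"
  shows "AE x in lborel. P (t - x)"
proof -
  obtain N where N: "N \<in> sets borel" "emeasure lborel N = 0" "{x. \<not> P x} \<subseteq> N"
    using assms by (auto elim!: AE_E)
  have [measurable]: "N \<in> sets borel" by fact
  have "(\<integral>\<^sup>+x. indicator N (t - x) \<partial>lborel) = (\<integral>\<^sup>+x. indicator N x \<partial>lborel)"
    by (rule nn_integral_reflect) measurable
  also have "\<dots> = 0" using N by simp
  finally have "AE x in lborel. indicator N (t - x) = (0::ennreal)"
    by (subst (asm) nn_integral_0_iff_AE) auto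
  then show ?thesis
    by eventually_elim (use N(3) in \<open>auto simp: indicator_def split: if_splits\<close>)
qed

text \<open>By Tonelli the double integral of the majorant is the scalar triple convolution at t.
  Each application of Fubini's theorem below rests on this criterion.\<close>

lemma vintegrable_triple:
  assumes f: "kernel f" and g: "kernel g" and h: "kernel h"
    and fin: "nconv (\<lambda>s. ennreal (f s)) (nconv (\<lambda>s. ennreal (g s)) (\<lambda>s. ennreal (h s))) t < \<infinity>"
    and F: "strongly_measurable lborel2 F" "\<And>s r. norm (F (s, r)) \<le> c * (f (t - s) * (g (s - r) * h r))"
  shows "vintegrable lborel2 F"
proof -
  note [measurable] = kernelD(1)[OF f] kernelD(1)[OF g] kernelD(1)[OF h]
  have "(\<integral>\<^sup>+p. ennreal (f (t - fst p) * (g (fst p - snd p) * h (snd p))) \<partial>lborel2)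
     = (\<integral>\<^sup>+s. \<integral>\<^sup>+r. ennreal (f (t - s) * (g (s - r) * h r)) \<partial>lborel \<partial>lborel)"
    by (subst lborel.nn_integral_fst[symmetric]) simp_all
  also have "\<dots> = nconv (\<lambda>s. ennreal (f s)) (nconv (\<lambda>s. ennreal (g s)) (\<lambda>s. ennreal (h s))) t"
    unfolding nconv_def using kernelD(2)[OF f] kernelD(2)[OF g] kernelD(2)[OF h]
    by (simp add: ennreal_mult nn_integral_cmult)
  finally have "integrable lborel2 (\<lambda>p. f (t - fst p) * (g (fst p - snd p) * h (snd p)))"
    using fin kernelD(2)[OF f] kernelD(2)[OF g] kernelD(2)[OF h]
    by (intro integrableI_nonneg) auto
  then have "integrable lborel2 (\<lambda>p. c * (f (t - fst p) * (g (fst p - snd p) * h (snd p))))" by simp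
  then show ?thesis
    by (rule vintegrable_bound[OF F(1)]) (use F(2) in auto)
qed

text \<open>Replacing infinite values of the inner convolution by 0 alters it on a null set, which
  the outer integral does not see.\<close>

lemma nconv_pconv_right:
  assumes "kernel g" "kernel h"
  shows "nconv f (\<lambda>s. ennreal (pconv g h s)) t = nconv f (nconv (\<lambda>s. ennreal (g s)) (\<lambda>s. ennreal (h s))) t"
  by (rule nconv_cong_AE[OF pconv_kernel(2)[OF assms]])

lemma nconv_pconv_left:
  assumes g: "kernel g" and h: "kernel h" and [measurable]: "f \<in> borel_measurable borel"
  shows "nconv (\<lambda>s. ennreal (pconv g h s)) f t = nconv (nconv (\<lambda>s. ennreal (g s)) (\<lambda>s. ennreal (h s))) f t"
proof -
  note [measurable] = kernelD(5)[OF pconv_kernel(1)[OF g h]] kernelD(5)[OF g] kernelD(5)[OF h]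
  show ?thesis
    by (subst (1 2) nconv_commute) (simp_all add: nconv_pconv_right[OF g h])
qed

lemma volterra_eq_vint:
  assumes a: "kernel a" and \<kappa>: "kernel \<kappa>" and fin: "pconv_finite a \<kappa> t"
  shows "volterra a \<kappa> R t x = vint (\<lambda>u. a (t - u) *\<^sub>R R u x)"
  using fin by (simp add: volterra_def opint_def nconv_kernel[OF a \<kappa>])

lemma volterra_vintegrable:
  assumes A: "closed_operator D A" and R: "op_family D A C \<kappa> R" and a: "kernel a" and \<kappa>: "kernel \<kappa>"
    and fin: "pconv_finite a \<kappa> t"
  shows "vintegrable lborel (\<lambda>u. a (t - u) *\<^sub>R R u x)"
proof -
  note [measurable] = kernelD(1)[OF a] kernelD(1)[OF \<kappa>]
  show ?thesis
    by (rule op_family_vintegrable[OF op_family_volterra_integrand[OF A R \<kappa> a]])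
       (use fin kernelD(2)[OF a] kernelD(2)[OF \<kappa>] in \<open>auto simp: nconv_kernel[OF a \<kappa>]\<close>)
qed

lemma op_family_zero:
  assumes "op_family D A C h H" "h u = 0" shows "H u x = 0"
  using op_familyD(4)[OF assms(1), of u x] assms(2) by simp

text \<open>Fubini's theorem: for fixed r the integral over s is scalar and equals f*g at t - r.
  Finiteness of the scalar triple convolution at t makes the integrand integrable on the
  plane.\<close>

lemma volterra_assoc:
  assumes A: "closed_operator D A" and H: "op_family D A C \<kappa> H"
    and f: "kernel f" and g: "kernel g" and \<kappa>: "kernel \<kappa>"
    and fin: "pconv_finite f (pconv g \<kappa>) t"
  shows "volterra f (pconv g \<kappa>) (volterra g \<kappa> H) t x = volterra (pconv f g) \<kappa> H t x"
proof -
  note [measurable] = kernelD(1)[OF f] kernelD(1)[OF g] kernelD(1)[OF \<kappa>] kernelD(5)[OF f] kernelD(5)[OF g] kernelD(5)[OF \<kappa>]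
  have fin': "nconv (\<lambda>s. ennreal (f s)) (nconv (\<lambda>s. ennreal (g s)) (\<lambda>s. ennreal (\<kappa> s))) t < \<infinity>"
    using fin by (simp add: nconv_pconv_right[OF g \<kappa>])
  have fin2: "pconv_finite (pconv f g) \<kappa> t"
    using fin' by (simp add: nconv_pconv_left[OF f g] nconv_assoc)
  define F where "F p = f (t - fst p) *\<^sub>R g (fst p - snd p) *\<^sub>R H (snd p) x" for p
  have v: "vintegrable lborel2 F"
  proof (rule vintegrable_triple[OF f g \<kappa> fin'])
    show "strongly_measurable lborel2 F" unfolding F_def
      by (intro strongly_measurable_scaleR strongly_measurable_compose[OF op_familyD(5)[OF H] measurable_snd]) measurable
    fix s r
    have "f (t - s) * (g (s - r) * norm (H r x)) \<le> f (t - s) * (g (s - r) * (C * \<kappa> r * norm x))"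
      by (intro mult_left_mono op_familyD(4)[OF H] kernelD(2)[OF f] kernelD(2)[OF g])
    then show "norm (F (s, r)) \<le> (C * norm x) * (f (t - s) * (g (s - r) * \<kappa> r))"
      using kernelD(2)[OF f] kernelD(2)[OF g] by (simp add: F_def mult_ac)
  qed
  have smF: "strongly_measurable lborel (\<lambda>s. vint (\<lambda>r. F (s, r)))"
    using v by (auto simp: vintegrable_def intro: strongly_measurable_vint)
  have ker: "kernel (pconv g \<kappa>)" by (rule pconv_kernel(1)[OF g \<kappa>])
  have "volterra f (pconv g \<kappa>) (volterra g \<kappa> H) t x = vint (\<lambda>s. f (t - s) *\<^sub>R volterra g \<kappa> H s x)"
    by (rule volterra_eq_vint[OF f ker fin])
  also have "\<dots> = vint (\<lambda>s. vint (\<lambda>r. F (s, r)))"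
  proof (rule vint_cong_AE(1)[OF _ smF])
    show "strongly_measurable lborel (\<lambda>s. f (t - s) *\<^sub>R volterra g \<kappa> H s x)"
      using volterra_vintegrable[OF A op_family_volterra[OF A H \<kappa> g] f ker fin] by (simp add: vintegrable_def)
    show "AE s in lborel. f (t - s) *\<^sub>R volterra g \<kappa> H s x = vint (\<lambda>r. F (s, r))"
      using pconv_kernel(3)[OF g \<kappa>]
    proof eventually_elim
      case (elim s)
      show ?case
        unfolding volterra_eq_vint[OF g \<kappa> elim] F_def
        using vint_scaleR_right[OF volterra_vintegrable[OF A H g \<kappa> elim], of "f (t - s)" x] by simp
    qed
  qed
  also have "\<dots> = vint (\<lambda>r. vint (\<lambda>s. F (s, r)))" by (rule vint_Fubini[OF v])
  also have "\<dots> = vint (\<lambda>r. pconv f g (t - r) *\<^sub>R H r x)"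
  proof (rule arg_cong[of _ _ vint], rule ext)
    fix r
    have "vint (\<lambda>s. F (s, r)) = vint (\<lambda>s. (f (t - s) * g (s - r)) *\<^sub>R H r x)" by (simp add: F_def)
    also have "\<dots> = pconv f g (t - r) *\<^sub>R H r x"
      by (subst vint_scaleR_left') (simp_all add: integral_conv_eq[OF f g])
    finally show "vint (\<lambda>s. F (s, r)) = pconv f g (t - r) *\<^sub>R H r x" .
  qed
  also have "\<dots> = volterra (pconv f g) \<kappa> H t x"
    by (rule volterra_eq_vint[symmetric, OF pconv_kernel(1)[OF f g] \<kappa> fin2])
  finally show ?thesis .
qed

text \<open>For u \<ge> r the factor a(r-u) is 0, so what happens beyond b is invisible up to r =
  b.\<close>

lemma volterra_hat:
  assumes "kernel a" "r \<le> b"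
  shows "volterra a \<kappa> (hat b \<kappa> R) r = volterra a \<kappa> R r"
proof -
  have "(\<lambda>u x. a (r - u) *\<^sub>R hat b \<kappa> R u x) = (\<lambda>u x. a (r - u) *\<^sub>R R u x)"
  proof (intro ext)
    fix u x
    show "a (r - u) *\<^sub>R hat b \<kappa> R u x = a (r - u) *\<^sub>R R u x"
    using assms(2) kernelD(3)[OF assms(1), of "r - u"] by (cases "u \<le> b") (auto simp: hat_def)
  qed
  then show ?thesis unfolding volterra_def by (simp only:)
qed

section \<open>The extended family and its resolvent equation\<close>

text \<open>The exceptional null set is chosen before x. This is essential where the equation at r
  is applied to a vector that itself depends on r, as in
  \<open>extension_independent\<close>.\<close>

definition resolvent_on :: "(real \<Rightarrow> real) \<Rightarrow> 'a::banach set \<Rightarrow> ('a \<Rightarrow> 'a) \<Rightarrow> real \<Rightarrow> (real \<Rightarrow> real) \<Rightarrow> (real \<Rightarrow> 'a \<Rightarrow> 'a) \<Rightarrow> bool" where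
  "resolvent_on a D A b \<kappa> R \<longleftrightarrow>
     (AE r in lborel. r \<le> b \<longrightarrow> (\<forall>x. volterra a \<kappa> R r x \<in> D \<and> A (volterra a \<kappa> R r x) = R r x - \<kappa> r *\<^sub>R x))"

text \<open>The integrand of the extended family, to be used with v = t - r. Since k and S vanish at
  nonpositive times, the upper limits min(b,t) and t arise by themselves.\<close>

definition glue :: "(real \<Rightarrow> real) \<Rightarrow> (real \<Rightarrow> 'a \<Rightarrow> 'a) \<Rightarrow> real \<Rightarrow> (real \<Rightarrow> 'a \<Rightarrow> 'a::real_normed_vector) \<Rightarrow> real \<Rightarrow> real \<Rightarrow> 'a \<Rightarrow> 'a" where
  "glue k S b Q r v x = (if r < b then k v *\<^sub>R Q r x else Q r (S v x))"

text \<open>The family $U$ above: $\int_0^b k(t-r)Q(r)\,dr + \int_b^t Q(r)S(t-r)\,dr$.\<close>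

definition extension :: "(real \<Rightarrow> real) \<Rightarrow> (real \<Rightarrow> real) \<Rightarrow> (real \<Rightarrow> 'a \<Rightarrow> 'a) \<Rightarrow> real \<Rightarrow> (real \<Rightarrow> real)
    \<Rightarrow> (real \<Rightarrow> 'a \<Rightarrow> 'a) \<Rightarrow> real \<Rightarrow> 'a \<Rightarrow> 'a::banach" where
  "extension a k S b \<kappa> R t =
     opint (\<lambda>r. k (t - r) * pconv a \<kappa> r) (\<lambda>r. glue k S b (volterra a \<kappa> (hat b \<kappa> R)) r (t - r))"

locale resolvent_setting =
  fixes a k :: "real \<Rightarrow> real" and D :: "'a::complex_banach set" and A :: "'a \<Rightarrow> 'a"
    and S :: "real \<Rightarrow> 'a \<Rightarrow> 'a" and CS :: real
  assumes a: "kernel a" and k: "kernel k" and A: "closed_operator D A" and S: "op_family D A CS k S"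
begin

lemma op_family_glue:
  assumes Q: "op_family D A C q Q" and q: "kernel q"
  shows "op_family D A (C * CS) (\<lambda>r. k (t - r) * q r) (\<lambda>r. glue k S b Q r (t - r))"
    "strongly_measurable lborel2 (\<lambda>(t, r). glue k S b Q r (t - r) x)"
proof -
  have C1: "1 \<le> C" "1 \<le> CS" using op_familyD(1) Q S by blast+
  note [measurable] = kernelD(1)[OF k] kernelD(1)[OF q]
  have ap: "strongly_measurable lborel2 (\<lambda>(r, v). Q r (S v x))" for x
    by (rule op_family_apply_measurable[OF Q op_familyD(5)[OF S]])
  have m1: "(\<lambda>p. (snd p, fst p - snd p)) \<in> lborel2 \<rightarrow>\<^sub>M lborel2" by measurable
  have m2: "(\<lambda>r. (r, t - r)) \<in> lborel \<rightarrow>\<^sub>M lborel2" by measurable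
  show "strongly_measurable lborel2 (\<lambda>(t, r). glue k S b Q r (t - r) x)"
    unfolding glue_def case_prod_unfold
  proof (intro strongly_measurable_If strongly_measurable_scaleR)
    show "strongly_measurable lborel2 (\<lambda>p. Q (snd p) x)"
      by (rule strongly_measurable_compose[OF op_familyD(5)[OF Q] measurable_snd])
    show "strongly_measurable lborel2 (\<lambda>p. Q (snd p) (S (fst p - snd p) x))"
      using strongly_measurable_compose[OF ap m1] by simp
    show "(\<lambda>p. k (fst p - snd p)) \<in> borel_measurable lborel2" by measurable
    show "{p \<in> space lborel2. snd p < b} \<in> sets lborel2" by measurable
  qed
  show "op_family D A (C * CS) (\<lambda>r. k (t - r) * q r) (\<lambda>r. glue k S b Q r (t - r))"
    unfolding op_family_def
  proof (intro conjI allI ballI)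
    show "1 \<le> C * CS" using mult_mono[OF C1] C1 by simp
    show "bounded_clinear (glue k S b Q r (t - r))" for r
      by (cases "r < b") (simp_all add: glue_def[abs_def] bounded_clinear_scaleR bounded_clinear_compose op_familyD(2)[OF Q] op_familyD(2)[OF S])
    show "norm (glue k S b Q r (t - r) x) \<le> C * CS * (k (t - r) * q r) * norm x" for r x
    proof (cases "r < b")
      case True
      have "norm (glue k S b Q r (t - r) x) = 1 * (k (t - r) * norm (Q r x))"
        using True kernelD(2)[OF k] by (simp add: glue_def)
      also have "\<dots> \<le> CS * (k (t - r) * (C * q r * norm x))"
        using C1 kernelD(2)[OF k] by (intro mult_mono op_familyD(4)[OF Q] order_refl mult_nonneg_nonneg) auto
      finally show ?thesis by (simp add: mult_ac)
    next
      case False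
      have "norm (glue k S b Q r (t - r) x) \<le> C * q r * norm (S (t - r) x)"
        using False op_familyD(4)[OF Q] by (simp add: glue_def)
      also have "\<dots> \<le> C * q r * (CS * k (t - r) * norm x)"
        using C1 kernelD(2)[OF q] by (intro mult_left_mono op_familyD(4)[OF S]) auto
      finally show ?thesis by (simp add: mult_ac)
    qed
    show "strongly_measurable lborel (\<lambda>r. glue k S b Q r (t - r) x)" for x
      unfolding glue_def
    proof (intro strongly_measurable_If strongly_measurable_scaleR op_familyD(5)[OF Q])
      show "strongly_measurable lborel (\<lambda>r. Q r (S (t - r) x))"
        using strongly_measurable_compose[OF ap m2] by simp
    qed measurable
    fix r x assume "x \<in> D"
    then show "glue k S b Q r (t - r) x \<in> D"
      "A (glue k S b Q r (t - r) x) = glue k S b Q r (t - r) (A x)"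
      using op_familyD(6,7)[OF Q] op_familyD(6,7)[OF S] closed_operator_scaleR[OF A] by (auto simp: glue_def)
  qed
qed

lemma op_family_extension:
  assumes R: "op_family D A C \<kappa> R" and \<kappa>: "kernel \<kappa>"
  shows "op_family D A (C * CS) (pconv k (pconv a \<kappa>)) (extension a k S b \<kappa> R)"
proof -
  have q: "kernel (pconv a \<kappa>)" by (rule pconv_kernel(1)[OF a \<kappa>])
  note [measurable] = kernelD(1)[OF k] kernelD(1)[OF q]
  note Q = op_family_volterra[OF A op_family_hat[OF A R \<kappa>] \<kappa> a, of b]
  have "op_family D A (C * CS) (\<lambda>t. enn2real (\<integral>\<^sup>+r. ennreal (k (t - r) * pconv a \<kappa> r) \<partial>lborel))
     (\<lambda>t. opint (\<lambda>r. k (t - r) * pconv a \<kappa> r) (\<lambda>r. glue k S b (volterra a \<kappa> (hat b \<kappa> R)) r (t - r)))"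
    by (rule opint_family[OF A op_family_glue(1)[OF Q q]])
       (use kernelD(2)[OF k] kernelD(2)[OF q] op_family_glue(2)[OF Q q] in auto)
  moreover have "(\<lambda>t. enn2real (\<integral>\<^sup>+r. ennreal (k (t - r) * pconv a \<kappa> r) \<partial>lborel)) = pconv k (pconv a \<kappa>)"
    by (rule ext) (simp only: pconv_def[of k] nconv_kernel[OF k q])
  ultimately show ?thesis by (simp add: extension_def[abs_def])
qed

end

context resolvent_setting
begin

lemma glue_vintegrable:
  assumes Q: "op_family D A C q Q" and q: "kernel q" and fin: "pconv_finite k q t"
  shows "vintegrable lborel (\<lambda>r. glue k S b Q r (t - r) x)"
proof -
  note [measurable] = kernelD(1)[OF k] kernelD(1)[OF q]
  show ?thesis
    by (rule op_family_vintegrable[OF op_family_glue(1)[OF Q q]])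
       (use fin kernelD(2)[OF k] kernelD(2)[OF q] in \<open>auto simp: nconv_kernel[OF k q]\<close>)
qed

lemma extension_eq_vint:
  assumes \<kappa>: "kernel \<kappa>" and fin: "pconv_finite k (pconv a \<kappa>) t"
  shows "extension a k S b \<kappa> R t x = vint (\<lambda>r. glue k S b (volterra a \<kappa> (hat b \<kappa> R)) r (t - r) x)"
  using fin by (simp add: extension_def opint_def nconv_kernel[OF k pconv_kernel(1)[OF a \<kappa>]])

lemma op_family_apply_conv_measurable:
  assumes Q: "op_family D A C q Q" and B: "op_family D A C' h B"
  shows "strongly_measurable lborel (\<lambda>r. Q r (B (t - r) x))"
proof -
  have m2: "(\<lambda>r. (r, t - r)) \<in> lborel \<rightarrow>\<^sub>M lborel2" by measurable
  show ?thesis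
    using strongly_measurable_compose[OF op_family_apply_measurable[OF Q op_familyD(5)[OF B]] m2] by simp
qed

text \<open>Convolution with \<open>a\<close> turns the integrand built from k and S into the one
  built from a*k and a*S. After Fubini's theorem the inner integral is a translated convolution; for
  r < b it is scalar, for r \<ge> b the operator \<open>Q r\<close> is taken out of it.\<close>

lemma volterra_glue:
  fixes q :: "real \<Rightarrow> real" and Q :: "real \<Rightarrow> 'a \<Rightarrow> 'a"
  assumes Q: "op_family D A C q Q" and q: "kernel q"
    and fin: "pconv_finite a (pconv k q) t"
  shows "vintegrable lborel (\<lambda>r. glue (pconv a k) (volterra a k S) b Q r (t - r) x)"
    "vint (\<lambda>s. a (t - s) *\<^sub>R opint (\<lambda>r. k (s - r) * q r) (\<lambda>r. glue k S b Q r (s - r)) x)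
      = vint (\<lambda>r. glue (pconv a k) (volterra a k S) b Q r (t - r) x)"
proof -
  note [measurable] = kernelD(1)[OF a] kernelD(1)[OF k] kernelD(1)[OF q] kernelD(5)[OF a] kernelD(5)[OF k] kernelD(5)[OF q]
  have C1: "1 \<le> C" "1 \<le> CS" using op_familyD(1) Q S by blast+
  have fin': "nconv (\<lambda>s. ennreal (a s)) (nconv (\<lambda>s. ennreal (k s)) (\<lambda>s. ennreal (q s))) t < \<infinity>"
    using fin by (simp add: nconv_pconv_right[OF k q])
  have fin2: "nconv (nconv (\<lambda>s. ennreal (a s)) (\<lambda>s. ennreal (k s))) (\<lambda>s. ennreal (q s)) t < \<infinity>"
    using fin' by (simp add: nconv_assoc)
  define F where "F p = a (t - fst p) *\<^sub>R glue k S b Q (snd p) (fst p - snd p) x" for p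
  have v: "vintegrable lborel2 F"
  proof (rule vintegrable_triple[OF a k q fin'])
    show "strongly_measurable lborel2 F" unfolding F_def
      using op_family_glue(2)[OF Q q, of b x]
      by (intro strongly_measurable_scaleR) (simp_all add: case_prod_unfold)
    fix s r
    have "a (t - s) * norm (glue k S b Q r (s - r) x) \<le> a (t - s) * (C * CS * (k (s - r) * q r) * norm x)"
      by (intro mult_left_mono op_familyD(4)[OF op_family_glue(1)[OF Q q]] kernelD(2)[OF a])
    then show "norm (F (s, r)) \<le> (C * CS * norm x) * (a (t - s) * (k (s - r) * q r))"
      using kernelD(2)[OF a] by (simp add: F_def mult_ac)
  qed
  have smF: "strongly_measurable lborel (\<lambda>s. vint (\<lambda>r. F (s, r)))"
    using v by (auto simp: vintegrable_def intro: strongly_measurable_vint)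
  note v' = vintegrable_swap[OF v]
  have vF': "vintegrable lborel (\<lambda>r. vint (\<lambda>s. F (s, r)))"
    using vint_iterated_bound(1)[OF v'] by simp
  have aS: "op_family D A CS (pconv a k) (volterra a k S)" by (rule op_family_volterra[OF A S k a])
  have inner: "AE r in lborel. vint (\<lambda>s. F (s, r)) = glue (pconv a k) (volterra a k S) b Q r (t - r) x"
  proof -
    \<comment> \<open>The product being finite for almost every r, the convolution a*k is finite at
      t - r wherever q r is nonzero. Where q r = 0, the operator \<open>Q r\<close> is 0 and both
      sides agree.\<close>
    have "AE r in lborel. nconv (\<lambda>s. ennreal (a s)) (\<lambda>s. ennreal (k s)) (t - r) * ennreal (q r) \<noteq> \<infinity>"
      by (rule nn_integral_noteq_infinite) (use fin2 in \<open>auto simp: nconv_def[of "nconv _ _"]\<close>)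
    then show ?thesis
    proof eventually_elim
      case (elim r)
      show ?case
      proof (cases "r < b")
        case True
        have "vint (\<lambda>s. F (s, r)) = vint (\<lambda>s. (a (t - s) * k (s - r)) *\<^sub>R Q r x)"
          using True by (simp add: F_def glue_def)
        also have "\<dots> = pconv a k (t - r) *\<^sub>R Q r x"
          by (subst vint_scaleR_left') (simp_all add: integral_conv_eq[OF a k])
        finally show ?thesis using True by (simp add: glue_def)
      next
        case False
        show ?thesis
        proof (cases "q r = 0")
          case True
          then have "Q r x = 0" for x by (rule op_family_zero[OF Q])
          then show ?thesis using False by (simp add: F_def glue_def)
        next
          case q0: False
          then have "0 < q r" using kernelD(2)[OF q, of r] by simp
          then have fin3: "pconv_finite a k (t - r)"
            using elim by (auto simp: ennreal_mult_eq_top_iff less_top)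
          have vs: "vintegrable lborel (\<lambda>s. a (t - r - s) *\<^sub>R S s x)"
            by (rule volterra_vintegrable[OF A S a k fin3])
          have "vint (\<lambda>s. F (s, r)) = vint (\<lambda>s. Q r (a (t - s) *\<^sub>R S (s - r) x))"
            using False by (simp add: F_def glue_def linear_simps[OF op_familyD(3)[OF Q]])
          also have "\<dots> = vint (\<lambda>s. Q r (a (t - r - s) *\<^sub>R S s x))"
            using vint_shift[OF vintegrable_bounded_linear[OF op_familyD(3)[OF Q] vs], of r r] by (simp add: algebra_simps)
          also have "\<dots> = Q r (vint (\<lambda>s. a (t - r - s) *\<^sub>R S s x))"
            by (rule vint_bounded_linear[OF op_familyD(3)[OF Q] vs])
          also have "\<dots> = Q r (volterra a k S (t - r) x)"
            by (simp only: volterra_eq_vint[OF a k fin3])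
          finally show ?thesis using False by (simp add: glue_def)
        qed
      qed
    qed
  qed
  have smW: "strongly_measurable lborel (\<lambda>r. glue (pconv a k) (volterra a k S) b Q r (t - r) x)"
    unfolding glue_def
  proof (intro strongly_measurable_If strongly_measurable_scaleR op_familyD(5)[OF Q] op_family_apply_conv_measurable[OF Q aS])
    note [measurable] = kernelD(1)[OF pconv_kernel(1)[OF a k]]
    show "(\<lambda>r. pconv a k (t - r)) \<in> borel_measurable lborel" by measurable
  qed measurable
  note cong = vint_cong_AE[OF _ smW inner]
  have smF': "strongly_measurable lborel (\<lambda>r. vint (\<lambda>s. F (s, r)))" using vF' by (simp add: vintegrable_def)
  show "vintegrable lborel (\<lambda>r. glue (pconv a k) (volterra a k S) b Q r (t - r) x)"
    using cong(2)[OF smF'] vF' by simp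
  have "vint (\<lambda>s. a (t - s) *\<^sub>R opint (\<lambda>r. k (s - r) * q r) (\<lambda>r. glue k S b Q r (s - r)) x) = vint (\<lambda>s. vint (\<lambda>r. F (s, r)))"
  proof (rule vint_cong_AE(1)[OF _ smF])
    have "op_family D A (C * CS) (\<lambda>s. enn2real (\<integral>\<^sup>+r. ennreal (k (s - r) * q r) \<partial>lborel))
        (\<lambda>s. opint (\<lambda>r. k (s - r) * q r) (\<lambda>r. glue k S b Q r (s - r)))"
      by (rule opint_family[OF A op_family_glue(1)[OF Q q]])
         (use kernelD(2)[OF k] kernelD(2)[OF q] op_family_glue(2)[OF Q q] in auto)
    then show "strongly_measurable lborel (\<lambda>s. a (t - s) *\<^sub>R opint (\<lambda>r. k (s - r) * q r) (\<lambda>r. glue k S b Q r (s - r)) x)"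
      by (intro strongly_measurable_scaleR op_familyD(5)) measurable
    show "AE s in lborel. a (t - s) *\<^sub>R opint (\<lambda>r. k (s - r) * q r) (\<lambda>r. glue k S b Q r (s - r)) x = vint (\<lambda>r. F (s, r))"
      using pconv_kernel(3)[OF k q]
    proof eventually_elim
      case (elim s)
      then have "opint (\<lambda>r. k (s - r) * q r) (\<lambda>r. glue k S b Q r (s - r)) x = vint (\<lambda>r. glue k S b Q r (s - r) x)"
        by (simp add: opint_def nconv_kernel[OF k q])
      then show ?case
        using vint_scaleR_right[OF glue_vintegrable[OF Q q elim], of "a (t - s)" b x] by (simp add: F_def)
    qed
  qed
  also have "\<dots> = vint (\<lambda>r. vint (\<lambda>s. F (s, r)))" by (rule vint_Fubini[OF v])
  also have "\<dots> = vint (\<lambda>r. glue (pconv a k) (volterra a k S) b Q r (t - r) x)"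
    by (rule cong(1)[OF smF'])
  finally show "vint (\<lambda>s. a (t - s) *\<^sub>R opint (\<lambda>r. k (s - r) * q r) (\<lambda>r. glue k S b Q r (s - r)) x)
      = vint (\<lambda>r. glue (pconv a k) (volterra a k S) b Q r (t - r) x)" .
qed

lemma extension_resolvent_equation:
  assumes R: "op_family D A C \<kappa> R" and \<kappa>: "kernel \<kappa>"
    and resR: "resolvent_on a D A b \<kappa> R" and resS: "resolvent_on a D A T k S"
    and t: "t \<le> b + T" and fin1: "pconv_finite k (pconv a \<kappa>) t"
    and fin2: "pconv_finite a (pconv k (pconv a \<kappa>)) t"
  defines "\<kappa>' \<equiv> pconv k (pconv a \<kappa>)" and "U \<equiv> extension a k S b \<kappa> R"
  shows "volterra a \<kappa>' U t x \<in> D \<and> A (volterra a \<kappa>' U t x) = U t x - \<kappa>' t *\<^sub>R x"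
proof -
  define q where "q = pconv a \<kappa>"
  define Rh where "Rh = hat b \<kappa> R"
  define Q where "Q = volterra a \<kappa> Rh"
  define m where "m = pconv k a"
  have Rh: "op_family D A C \<kappa> Rh" unfolding Rh_def by (rule op_family_hat[OF A R \<kappa>])
  have q: "kernel q" unfolding q_def by (rule pconv_kernel(1)[OF a \<kappa>])
  have mk: "kernel m" unfolding m_def by (rule pconv_kernel(1)[OF k a])
  have Q: "op_family D A C q Q" unfolding Q_def q_def by (rule op_family_volterra[OF A Rh \<kappa> a])
  have \<kappa>': "kernel \<kappa>'" unfolding \<kappa>'_def by (rule pconv_kernel(1)[OF k q[unfolded q_def]])
  have C1: "1 \<le> C" "1 \<le> CS" using op_familyD(1) Q S by blast+
  note [measurable] = kernelD(1)[OF a] kernelD(1)[OF k] kernelD(1)[OF q] kernelD(1)[OF mk] kernelD(1)[OF \<kappa>]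
    kernelD(5)[OF a] kernelD(5)[OF k] kernelD(5)[OF q] kernelD(5)[OF \<kappa>]
  have m_eq: "pconv a k = m"
    by (simp add: fun_eq_iff m_def pconv_def nconv_commute)
  have nc: "nconv (\<lambda>s. ennreal (m s)) (\<lambda>s. ennreal (\<kappa> s)) t
      = nconv (\<lambda>s. ennreal (k s)) (\<lambda>s. ennreal (pconv a \<kappa> s)) t"
    by (simp add: m_def nconv_pconv_left[OF k a] nconv_pconv_right[OF a \<kappa>] nconv_assoc)
  have fin_mk: "pconv_finite m \<kappa> t" using fin1 by (simp only: nc)
  have mk_eq: "pconv m \<kappa> t = \<kappa>' t"
    unfolding \<kappa>'_def pconv_def[of m] pconv_def[of k] by (simp only: nc)
  note fin1' = fin1[folded q_def]
  let ?W = "\<lambda>r. glue m (volterra a k S) b Q r (t - r) x"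
  \<comment> \<open>This is the image of \<open>?W r\<close> under \<open>A\<close>. For r < b the
    resolvent equation of R is applied to Q r x; for r \<ge> b that of S is applied to (a*S)(t-r)x,
    which lies in \<open>D\<close>, and \<open>A\<close> is moved past \<open>Q r\<close>.\<close>
  let ?Z = "\<lambda>r. if r < b then m (t - r) *\<^sub>R (Rh r x - \<kappa> r *\<^sub>R x) else Q r (S (t - r) x - k (t - r) *\<^sub>R x)"
  have volt: "volterra a \<kappa>' U t x = vint ?W" and vW: "vintegrable lborel ?W"
  proof -
    have "volterra a \<kappa>' U t x = vint (\<lambda>s. a (t - s) *\<^sub>R U s x)"
      by (rule volterra_eq_vint[OF a \<kappa>' fin2[folded \<kappa>'_def]])
    also have "\<dots> = vint ?W"
      using volterra_glue(2)[OF Q q fin2[folded q_def], of b x]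
      unfolding U_def extension_def m_eq[symmetric] Q_def Rh_def q_def .
    finally show "volterra a \<kappa>' U t x = vint ?W" .
    show "vintegrable lborel ?W"
      using volterra_glue(1)[OF Q q fin2[folded q_def], of b x] unfolding m_eq .
  qed
  \<comment> \<open>At r = b the continued family is R b and not \<kappa> b times the identity, so
    this one point is removed.\<close>
  have ZF: "AE r in lborel. ?Z r = (glue k S b Q r (t - r) x - k (t - r) *\<^sub>R Q r x)
      + (m (t - r) *\<^sub>R Rh r x - m (t - r) *\<^sub>R \<kappa> r *\<^sub>R x)"
    using AE_lborel_singleton[of b]
  proof eventually_elim
    case (elim r)
    show ?case
    proof (cases "r < b")
      case True then show ?thesis by (simp add: glue_def scaleR_diff_right)
    next
      case False
      then have "Rh r x = \<kappa> r *\<^sub>R x" using elim by (simp add: Rh_def hat_def)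
      then show ?thesis using False by (simp add: glue_def linear_simps[OF op_familyD(3)[OF Q]])
    qed
  qed
  have v1: "vintegrable lborel (\<lambda>r. glue k S b Q r (t - r) x)" by (rule glue_vintegrable[OF Q q fin1'])
  have v2: "vintegrable lborel (\<lambda>r. k (t - r) *\<^sub>R Q r x)" by (rule volterra_vintegrable[OF A Q k q fin1'])
  have v3: "vintegrable lborel (\<lambda>r. m (t - r) *\<^sub>R Rh r x)" by (rule volterra_vintegrable[OF A Rh mk \<kappa> fin_mk])
  have i4: "integrable lborel (\<lambda>r. m (t - r) * \<kappa> r)"
    using fin_mk kernelD(2)[OF mk] kernelD(2)[OF \<kappa>] by (intro integrableI_nonneg) (auto simp: nconv_kernel[OF mk \<kappa>])
  have v4: "vintegrable lborel (\<lambda>r. m (t - r) *\<^sub>R \<kappa> r *\<^sub>R x)"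
    using vintegrable_scaleR_left[OF i4, of x] by simp
  have vsum: "vintegrable lborel (\<lambda>r. (glue k S b Q r (t - r) x - k (t - r) *\<^sub>R Q r x)
      + (m (t - r) *\<^sub>R Rh r x - m (t - r) *\<^sub>R \<kappa> r *\<^sub>R x))"
    by (intro vintegrable_add vintegrable_diff v1 v2 v3 v4)
  have smZ: "strongly_measurable lborel ?Z"
  proof (intro strongly_measurable_If strongly_measurable_scaleR strongly_measurable_diff op_familyD(5)[OF Rh] strongly_measurable_const)
    show "strongly_measurable lborel (\<lambda>r. Q r (S (t - r) x - k (t - r) *\<^sub>R x))"
    proof -
      have "strongly_measurable lborel (\<lambda>r. Q r (S (t - r) x) - k (t - r) *\<^sub>R Q r x)"
        by (intro strongly_measurable_diff strongly_measurable_scaleR op_familyD(5)[OF Q] op_family_apply_conv_measurable[OF Q S]) measurable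
      then show ?thesis by (simp add: linear_simps[OF op_familyD(3)[OF Q]])
    qed
  qed (use kernelD(1)[OF \<kappa>] in \<open>auto\<close>)
  have smsum: "strongly_measurable lborel (\<lambda>r. (glue k S b Q r (t - r) x - k (t - r) *\<^sub>R Q r x)
      + (m (t - r) *\<^sub>R Rh r x - m (t - r) *\<^sub>R \<kappa> r *\<^sub>R x))" using vsum by (simp add: vintegrable_def)
  have vZ: "vintegrable lborel ?Z" using vint_cong_AE(2)[OF smZ smsum ZF] vsum by simp
  have Z_eq: "vint ?Z = U t x - \<kappa>' t *\<^sub>R x"
  proof -
    have "vint ?Z = (vint (\<lambda>r. glue k S b Q r (t - r) x) - vint (\<lambda>r. k (t - r) *\<^sub>R Q r x))
      + (vint (\<lambda>r. m (t - r) *\<^sub>R Rh r x) - vint (\<lambda>r. m (t - r) *\<^sub>R \<kappa> r *\<^sub>R x))"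
      unfolding vint_cong_AE(1)[OF smZ smsum ZF]
      by (simp only: vint_add[OF vintegrable_diff[OF v1 v2] vintegrable_diff[OF v3 v4]] vint_diff[OF v1 v2] vint_diff[OF v3 v4])
    moreover have "vint (\<lambda>r. glue k S b Q r (t - r) x) = U t x"
      unfolding U_def Q_def Rh_def by (rule extension_eq_vint[symmetric, OF \<kappa> fin1])
    \<comment> \<open>By associativity k*(a*Rh) = (k*a)*Rh, so the second and the third of the four
      integrals cancel.\<close>
    moreover have "vint (\<lambda>r. k (t - r) *\<^sub>R Q r x) = vint (\<lambda>r. m (t - r) *\<^sub>R Rh r x)"
      using volterra_assoc[OF A Rh k a \<kappa> fin1, of x, folded q_def Q_def m_def]
      by (simp only: volterra_eq_vint[OF k q fin1'] volterra_eq_vint[OF mk \<kappa> fin_mk])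
    moreover have "vint (\<lambda>r. m (t - r) *\<^sub>R \<kappa> r *\<^sub>R x) = \<kappa>' t *\<^sub>R x"
    proof -
      have "vint (\<lambda>r. m (t - r) *\<^sub>R \<kappa> r *\<^sub>R x) = (\<integral>r. m (t - r) * \<kappa> r \<partial>lborel) *\<^sub>R x"
        using vint_scaleR_left[OF i4, of x] by simp
      also have "(\<integral>r. m (t - r) * \<kappa> r \<partial>lborel) = pconv m \<kappa> t"
        using integral_conv_eq[OF mk \<kappa>, of t 0] by simp
      finally show ?thesis by (simp only: mk_eq)
    qed
    ultimately show ?thesis by simp
  qed
  have graph: "AE r in lborel. ?W r \<in> D \<and> A (?W r) = ?Z r"
    using resR[unfolded resolvent_on_def] AE_reflect[OF resS[unfolded resolvent_on_def], of t]
  proof eventually_elim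
    case (elim r)
    show ?case
    proof (cases "r < b")
      case True
      then have "Q r x \<in> D \<and> A (Q r x) = Rh r x - \<kappa> r *\<^sub>R x"
        using elim(1) volterra_hat[OF a, of r b \<kappa> R] by (simp add: Q_def Rh_def hat_def)
      then show ?thesis using True closed_operator_scaleR[OF A, of "Q r x" "m (t - r)"] by (simp add: glue_def)
    next
      case False
      then have "t - r \<le> T" using t by simp
      with elim(2) have "volterra a k S (t - r) x \<in> D \<and> A (volterra a k S (t - r) x) = S (t - r) x - k (t - r) *\<^sub>R x"
        by blast
      then show ?thesis using False op_familyD(6,7)[OF Q] by (simp add: glue_def)
    qed
  qed
  from vint_closed_operator[OF A vW vZ graph] show ?thesis by (simp only: volt Z_eq)
qed

end

section \<open>Splitting the extension and moving the break point\<close>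

context resolvent_setting
begin

text \<open>Fubini's theorem moves the integral over \<open>H\<close> outside, and v = t - s turns
  the constraint s \<ge> b into v \<le> t - b. For r \<ge> b that constraint is vacuous, because
  a(t-r-v) = 0 once v \<ge> t - r; what remains is H r applied to (a*S)(t-r)x. It is used for the
  continued family and for the difference of two continuations.\<close>

lemma conv_tail:
  fixes b :: real and x :: 'a
  assumes H: "op_family D A C \<kappa> H" and \<kappa>: "kernel \<kappa>" and fin: "pconv_finite k (pconv a \<kappa>) t"
  defines "g \<equiv> \<lambda>r v. if v \<le> t - b then a (t - r - v) *\<^sub>R H r (S v x) else 0"
  shows "vint (\<lambda>s. if s < b then 0 else volterra a \<kappa> H s (S (t - s) x)) = vint (\<lambda>r. vint (g r))"
    "vintegrable lborel (\<lambda>r. vint (g r))"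
    "AE r in lborel. vintegrable lborel (g r)"
    "AE r in lborel. b \<le> r \<longrightarrow> vint (g r) = H r (volterra a k S (t - r) x)"
proof -
  note [measurable] = kernelD(1)[OF a] kernelD(1)[OF k] kernelD(1)[OF \<kappa>] kernelD(5)[OF a] kernelD(5)[OF k] kernelD(5)[OF \<kappa>]
  have C1: "1 \<le> C" "1 \<le> CS" using op_familyD(1) H S by blast+
  have fin': "nconv (\<lambda>s. ennreal (k s)) (nconv (\<lambda>s. ennreal (a s)) (\<lambda>s. ennreal (\<kappa> s))) t < \<infinity>"
    using fin by (simp add: nconv_pconv_right[OF a \<kappa>])
  define F where "F p = (if fst p < b then 0 else a (fst p - snd p) *\<^sub>R H (snd p) (S (t - fst p) x))" for p
  have v: "vintegrable lborel2 F"
  proof (rule vintegrable_triple[OF k a \<kappa> fin'])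
    have ap: "strongly_measurable lborel2 (\<lambda>(r, v). H r (S v x))"
      by (rule op_family_apply_measurable[OF H op_familyD(5)[OF S]])
    have m1: "(\<lambda>p. (snd p, t - fst p)) \<in> lborel2 \<rightarrow>\<^sub>M lborel2" by measurable
    have "strongly_measurable lborel2 (\<lambda>p. H (snd p) (S (t - fst p) x))"
      using strongly_measurable_compose[OF ap m1] by simp
    moreover have "{p \<in> space lborel2. fst p < b} \<in> sets lborel2"
      "(\<lambda>p. a (fst p - snd p)) \<in> borel_measurable lborel2" by measurable
    ultimately show "strongly_measurable lborel2 F" unfolding F_def
      by (intro strongly_measurable_If strongly_measurable_scaleR strongly_measurable_const)
    fix s r
    have "norm (F (s, r)) \<le> a (s - r) * norm (H r (S (t - s) x))"
      using kernelD(2)[OF a] by (simp add: F_def)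
    also have "\<dots> \<le> a (s - r) * (C * \<kappa> r * norm (S (t - s) x))"
      by (intro mult_left_mono op_familyD(4)[OF H] kernelD(2)[OF a])
    also have "\<dots> \<le> a (s - r) * (C * \<kappa> r * (CS * k (t - s) * norm x))"
      using C1 kernelD(2)[OF a] kernelD(2)[OF \<kappa>] by (intro mult_left_mono op_familyD(4)[OF S]) auto
    finally show "norm (F (s, r)) \<le> (C * CS * norm x) * (k (t - s) * (a (s - r) * \<kappa> r))"
      by (simp add: mult_ac)
  qed
  note v' = vintegrable_swap[OF v]
  have refl: "AE r in lborel. vintegrable lborel (g r) \<and> vint (g r) = vint (\<lambda>s. F (s, r))"
    using vintegrable_section_AE[OF v']
  proof eventually_elim
    case (elim r)
    have "(\<lambda>v. F (t - v, r)) = g r" by (auto simp: F_def g_def algebra_simps)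
    then show ?case using vint_reflect[of "\<lambda>s. F (s, r)" t] elim by simp
  qed
  then show ae: "AE r in lborel. vintegrable lborel (g r)" by eventually_elim blast
  have vF: "vintegrable lborel (\<lambda>r. vint (\<lambda>s. F (s, r)))" using vint_iterated_bound(1)[OF v'] by simp
  have "(\<lambda>p. (fst p, snd p)) \<in> lborel2 \<rightarrow>\<^sub>M lborel2" by measurable
  have smg: "strongly_measurable lborel (\<lambda>r. vint (g r))"
  proof -
    have ap: "strongly_measurable lborel2 (\<lambda>(r, v). H r (S v x))"
      by (rule op_family_apply_measurable[OF H op_familyD(5)[OF S]])
    have m: "{p \<in> space lborel2. snd p \<le> t - b} \<in> sets lborel2"
      "(\<lambda>p. a (t - fst p - snd p)) \<in> borel_measurable lborel2" by measurable
    have "strongly_measurable lborel2 (\<lambda>p. if snd p \<le> t - b then a (t - fst p - snd p) *\<^sub>R H (fst p) (S (snd p) x) else 0)"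
      using ap m by (intro strongly_measurable_If strongly_measurable_scaleR strongly_measurable_const) (simp_all add: case_prod_unfold)
    from strongly_measurable_vint[OF this] show ?thesis unfolding g_def fst_conv snd_conv .
  qed
  have smF: "strongly_measurable lborel (\<lambda>r. vint (\<lambda>s. F (s, r)))" using vF by (simp add: vintegrable_def)
  have eqg: "AE r in lborel. vint (g r) = vint (\<lambda>s. F (s, r))" using refl by eventually_elim blast
  note cong = vint_cong_AE[OF smg smF eqg]
  show "vintegrable lborel (\<lambda>r. vint (g r))" using cong(2) vF by simp
  have smF1: "strongly_measurable lborel (\<lambda>s. vint (\<lambda>r. F (s, r)))"
    using v by (auto simp: vintegrable_def intro: strongly_measurable_vint)
  have "vint (\<lambda>s. if s < b then 0 else volterra a \<kappa> H s (S (t - s) x)) = vint (\<lambda>s. vint (\<lambda>r. F (s, r)))"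
  proof (rule vint_cong_AE(1)[OF _ smF1])
    show "strongly_measurable lborel (\<lambda>s. if s < b then 0 else volterra a \<kappa> H s (S (t - s) x))"
      by (intro strongly_measurable_If strongly_measurable_const
          op_family_apply_conv_measurable[OF op_family_volterra[OF A H \<kappa> a] S]) measurable
    show "AE s in lborel. (if s < b then 0 else volterra a \<kappa> H s (S (t - s) x)) = vint (\<lambda>r. F (s, r))"
      using pconv_kernel(3)[OF a \<kappa>]
      by eventually_elim (simp add: F_def volterra_eq_vint[OF a \<kappa>])
  qed
  also have "\<dots> = vint (\<lambda>r. vint (\<lambda>s. F (s, r)))" by (rule vint_Fubini[OF v])
  also have "\<dots> = vint (\<lambda>r. vint (g r))" by (rule cong(1)[symmetric])
  finally show "vint (\<lambda>s. if s < b then 0 else volterra a \<kappa> H s (S (t - s) x)) = vint (\<lambda>r. vint (g r))" .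
  have "nconv (nconv (\<lambda>s. ennreal (k s)) (\<lambda>s. ennreal (a s))) (\<lambda>s. ennreal (\<kappa> s)) t < \<infinity>"
    using fin' by (simp add: nconv_assoc)
  then have "AE r in lborel. nconv (\<lambda>s. ennreal (k s)) (\<lambda>s. ennreal (a s)) (t - r) * ennreal (\<kappa> r) \<noteq> \<infinity>"
    by (intro nn_integral_noteq_infinite) (auto simp: nconv_def[of "nconv _ _"])
  then show "AE r in lborel. b \<le> r \<longrightarrow> vint (g r) = H r (volterra a k S (t - r) x)"
  proof eventually_elim
    case (elim r)
    show ?case
    proof (intro impI, cases "\<kappa> r = 0")
      case True
      then have H0: "H r x = 0" for x by (rule op_family_zero[OF H])
      have "g r = (\<lambda>v. 0)" by (auto simp: g_def H0)
      then show "vint (g r) = H r (volterra a k S (t - r) x)" using H0 by simp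
    next
      case False
      assume r: "b \<le> r"
      have "0 < \<kappa> r" using False kernelD(2)[OF \<kappa>, of r] by simp
      then have fin3: "pconv_finite a k (t - r)"
        using elim nconv_commute[of "\<lambda>s. ennreal (k s)" "\<lambda>s. ennreal (a s)"]
        by (auto simp: ennreal_mult_eq_top_iff less_top)
      have "g r = (\<lambda>v. H r (a (t - r - v) *\<^sub>R S v x))"
      proof
        fix v
        show "g r v = H r (a (t - r - v) *\<^sub>R S v x)"
          using r kernelD(3)[OF a, of "t - r - v"]
          by (cases "v \<le> t - b") (simp_all add: g_def linear_simps[OF op_familyD(3)[OF H]])
      qed
      then show "vint (g r) = H r (volterra a k S (t - r) x)"
        using vint_bounded_linear[OF op_familyD(3)[OF H] volterra_vintegrable[OF A S a k fin3], of r x]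
        by (simp add: volterra_eq_vint[OF a k fin3])
    qed
  qed
qed

text \<open>\<open>conv_tail\<close> for the continued family, with its outer integral cut at b,
  yields the terms of the recursion. Up to b the family is R and the double integral stays; beyond b
  it is \<kappa>(u)I, leaving \<kappa>(u)(a*S)(t-u), and the reflection r = t - u gives the last
  term.\<close>

lemma extension_split:
  assumes R: "op_family D A C \<kappa> R" and \<kappa>: "kernel \<kappa>" and fin: "pconv_finite k (pconv a \<kappa>) t"
  shows "extension a k S b \<kappa> R t x =
      vint (\<lambda>u. if u \<le> b then vint (\<lambda>v. if v \<le> t - b then a (t - u - v) *\<^sub>R R u (S v x) else 0) else 0)
    + vint (\<lambda>r. if r < b then k (t - r) *\<^sub>R volterra a \<kappa> R r x else 0)
    + vint (\<lambda>r. if r \<le> t - b then \<kappa> (t - r) *\<^sub>R volterra a k S r x else 0)"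
    "vintegrable lborel (\<lambda>u. if u \<le> b then vint (\<lambda>v. if v \<le> t - b then a (t - u - v) *\<^sub>R R u (S v x) else 0) else 0)"
    "vintegrable lborel (\<lambda>r. if r < b then k (t - r) *\<^sub>R volterra a \<kappa> R r x else 0)"
    "vintegrable lborel (\<lambda>r. if r \<le> t - b then \<kappa> (t - r) *\<^sub>R volterra a k S r x else 0)"
    "AE u in lborel. u \<le> b \<longrightarrow> vintegrable lborel (\<lambda>v. if v \<le> t - b then a (t - u - v) *\<^sub>R R u (S v x) else 0)"
proof -
  define Rh where "Rh = hat b \<kappa> R"
  define Q where "Q = volterra a \<kappa> Rh"
  have Rh: "op_family D A C \<kappa> Rh" unfolding Rh_def by (rule op_family_hat[OF A R \<kappa>])
  have q: "kernel (pconv a \<kappa>)" by (rule pconv_kernel(1)[OF a \<kappa>])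
  have Q: "op_family D A C (pconv a \<kappa>) Q" unfolding Q_def by (rule op_family_volterra[OF A Rh \<kappa> a])
  have aS: "op_family D A CS (pconv a k) (volterra a k S)" by (rule op_family_volterra[OF A S k a])
  note [measurable] = kernelD(1)[OF a] kernelD(1)[OF k] kernelD(1)[OF \<kappa>]
  let ?T1 = "\<lambda>u. if u \<le> b then vint (\<lambda>v. if v \<le> t - b then a (t - u - v) *\<^sub>R R u (S v x) else 0) else 0"
  let ?T2 = "\<lambda>r. if r < b then k (t - r) *\<^sub>R volterra a \<kappa> R r x else 0"
  let ?T3 = "\<lambda>r. if r \<le> t - b then \<kappa> (t - r) *\<^sub>R volterra a k S r x else 0"
  let ?Q2 = "\<lambda>r. if r < b then 0 else Q r (S (t - r) x)"
  let ?g = "\<lambda>r v. if v \<le> t - b then a (t - r - v) *\<^sub>R Rh r (S v x) else 0"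
  let ?E = "\<lambda>r. if b < r then \<kappa> r *\<^sub>R volterra a k S (t - r) x else 0"
  note tail = conv_tail[OF Rh \<kappa> fin, of b x]
  note vg = glue_vintegrable[OF Q q fin, of b x]
  have split: "glue k S b Q r (t - r) x = ?T2 r + ?Q2 r" for r
    using volterra_hat[OF a, of r b \<kappa> R] by (simp add: glue_def Q_def Rh_def)
  have sm2: "strongly_measurable lborel ?T2"
    by (intro strongly_measurable_If strongly_measurable_scaleR strongly_measurable_const
        op_familyD(5)[OF op_family_volterra[OF A R \<kappa> a]]) measurable
  have smQ2: "strongly_measurable lborel ?Q2"
    by (intro strongly_measurable_If strongly_measurable_const op_family_apply_conv_measurable[OF Q S]) measurable
  have ng: "integrable lborel (\<lambda>r. norm (glue k S b Q r (t - r) x))" using vg by (simp add: vintegrable_def)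
  show v2: "vintegrable lborel ?T2"
    by (rule vintegrable_bound[OF sm2 ng]) (use volterra_hat[OF a, of _ b \<kappa> R] in \<open>auto simp: glue_def Q_def Rh_def\<close>)
  have vQ2: "vintegrable lborel ?Q2"
    by (rule vintegrable_bound[OF smQ2 ng]) (auto simp: glue_def)
  have "extension a k S b \<kappa> R t x = vint (\<lambda>r. glue k S b Q r (t - r) x)"
    unfolding Q_def Rh_def by (rule extension_eq_vint[OF \<kappa> fin])
  also have "\<dots> = vint ?T2 + vint ?Q2" unfolding split by (rule vint_add[OF v2 vQ2])
  also have "vint ?Q2 = vint (\<lambda>r. vint (?g r))" using tail(1) unfolding Q_def .
  finally have 1: "extension a k S b \<kappa> R t x = vint ?T2 + vint (\<lambda>r. vint (?g r))" .
  have smG: "strongly_measurable lborel (\<lambda>r. vint (?g r))" using tail(2) by (simp add: vintegrable_def)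
  have nG: "integrable lborel (\<lambda>r. norm (vint (?g r)))" using tail(2) by (simp add: vintegrable_def)
  have T1g: "?T1 = (\<lambda>r. if r \<le> b then vint (?g r) else 0)"
    by (auto simp: Rh_def hat_def fun_eq_iff cong: if_cong)
  show v1: "vintegrable lborel ?T1" unfolding T1g
    by (rule vintegrable_bound[OF strongly_measurable_If[OF smG] nG]) auto
  have smE: "strongly_measurable lborel ?E"
  proof (intro strongly_measurable_If strongly_measurable_scaleR strongly_measurable_const)
    show "strongly_measurable lborel (\<lambda>r. volterra a k S (t - r) x)"
      by (rule strongly_measurable_compose[OF op_familyD(5)[OF aS]]) measurable
  qed measurable
  have aeE: "AE r in lborel. ?E r = (if r \<le> b then 0 else vint (?g r))"
    using tail(4) by eventually_elim (simp add: Rh_def hat_def)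
  have vE: "vintegrable lborel ?E"
    by (rule vintegrable_bound[OF smE nG]) (use aeE in eventually_elim, simp)
  have E3: "vint ?E = vint ?T3" "vintegrable lborel ?T3"
  proof -
    note r = vint_reflect[OF vE, of t]
    have sm3: "strongly_measurable lborel ?T3"
      by (intro strongly_measurable_If strongly_measurable_scaleR strongly_measurable_const op_familyD(5)[OF aS]) measurable
    have smr: "strongly_measurable lborel (\<lambda>r. ?E (t - r))" using r by (simp only: vintegrable_def)
    \<comment> \<open>The reflected condition b < t - r is strict, while the recursion integrates
      over r \<le> t - b.\<close>
    have ae: "AE r in lborel. ?E (t - r) = ?T3 r"
      using AE_lborel_singleton[of "t - b"] by eventually_elim auto
    show "vint ?E = vint ?T3" "vintegrable lborel ?T3"
      using vint_cong_AE[OF smr sm3 ae] r by (simp_all only:)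
  qed
  have "vint (\<lambda>r. vint (?g r)) = vint (\<lambda>r. ?T1 r + ?E r)"
  proof (rule vint_cong_AE(1)[OF smG])
    show "strongly_measurable lborel (\<lambda>r. ?T1 r + ?E r)"
      using vintegrable_add[OF v1 vE] by (simp add: vintegrable_def)
    show "AE r in lborel. vint (?g r) = ?T1 r + ?E r"
      using aeE
    proof eventually_elim
      case (elim r)
      then show ?case using fun_cong[OF T1g, of r] by (cases "r \<le> b") simp_all
    qed
  qed
  also have "\<dots> = vint ?T1 + vint ?E" by (rule vint_add[OF v1 vE])
  also have "vint ?E = vint ?T3" by (rule E3(1))
  finally have 2: "vint (\<lambda>r. vint (?g r)) = vint ?T1 + vint ?T3" .
  show "extension a k S b \<kappa> R t x = vint ?T1 + vint ?T2 + vint ?T3"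
    unfolding 1 2 by (simp only: add_ac)
  show "vintegrable lborel ?T3" by (rule E3(2))
  show "AE u in lborel. u \<le> b \<longrightarrow> vintegrable lborel (\<lambda>v. if v \<le> t - b then a (t - u - v) *\<^sub>R R u (S v x) else 0)"
    using tail(3)
  proof eventually_elim
    case (elim u)
    show ?case
    proof
      assume "u \<le> b"
      then have eq: "Rh u = R u" by (simp add: Rh_def hat_def fun_eq_iff)
      from elim show "vintegrable lborel (\<lambda>v. if v \<le> t - b then a (t - u - v) *\<^sub>R R u (S v x) else 0)"
        unfolding eq .
    qed
  qed
qed

text \<open>Write Q' = Q + V, where V is \<open>a\<close> convolved with Z, the restriction of R -
  \<kappa>I to (b,b']. For r in the strip (b,b') the vector y = (a*S)(t-r)x lies in
  \<open>D\<close>, and Q'(r)(S-k)(t-r)x = Q'(r)Ay = AQ'(r)y = Z(r)y. Moving b to b' thus subtracts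
  the integral of Z(r)y over the strip and adds that of V(r)S(t-r)x over r \<ge> b; the two are
  equal by \<open>conv_tail\<close>.\<close>

lemma extension_independent:
  assumes R: "op_family D A C \<kappa> R" and \<kappa>: "kernel \<kappa>"
    and resR: "resolvent_on a D A b' \<kappa> R" and resS: "resolvent_on a D A T k S"
    and b: "b \<le> b'" and t: "t \<le> b + T" and fin: "pconv_finite k (pconv a \<kappa>) t"
  shows "extension a k S b' \<kappa> R t x = extension a k S b \<kappa> R t x"
proof -
  define Rh where "Rh = hat b \<kappa> R"
  define Rh' where "Rh' = hat b' \<kappa> R"
  define Z where "Z u x = (if b < u \<and> u \<le> b' then R u x - \<kappa> u *\<^sub>R x else 0)" for u x
  have q: "kernel (pconv a \<kappa>)" by (rule pconv_kernel(1)[OF a \<kappa>])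
  note [measurable] = kernelD(1)[OF a] kernelD(1)[OF k] kernelD(1)[OF \<kappa>]
  have Rh: "op_family D A C \<kappa> Rh" unfolding Rh_def by (rule op_family_hat[OF A R \<kappa>])
  have Rh': "op_family D A C \<kappa> Rh'" unfolding Rh'_def by (rule op_family_hat[OF A R \<kappa>])
  have Z_diff: "Z u x = Rh' u x - Rh u x" for u x
    using b by (auto simp: Z_def Rh_def Rh'_def hat_def)
  have scd: "c *\<^sub>C (y - z) = c *\<^sub>C y - c *\<^sub>C z" for c and y z :: 'a
    by (rule linear_diff[OF bounded_linear.linear[OF bounded_linear_scaleC]])
  have Z: "op_family D A (2 * C) \<kappa> Z"
    unfolding op_family_def
  proof (intro conjI allI ballI)
    show "1 \<le> 2 * C" using op_familyD(1)[OF R] by simp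
    show "bounded_clinear (Z u)" for u
      using op_familyD(2)[OF Rh', of u] op_familyD(2)[OF Rh, of u] scd
      by (auto simp: bounded_clinear_def Z_diff[abs_def] intro: bounded_linear_sub)
    show "norm (Z u x) \<le> 2 * C * \<kappa> u * norm x" for u x
      using norm_triangle_ineq4[of "Rh' u x" "Rh u x"] op_familyD(4)[OF Rh, of u x] op_familyD(4)[OF Rh', of u x]
      by (simp add: Z_diff)
    show "strongly_measurable lborel (\<lambda>u. Z u x)" for x
      unfolding Z_diff by (intro strongly_measurable_diff op_familyD(5)[OF Rh] op_familyD(5)[OF Rh'])
    fix u x assume x: "x \<in> D"
    have "Rh' u x + (-1) *\<^sub>R Rh u x \<in> D \<and> A (Rh' u x + (-1) *\<^sub>R Rh u x) = A (Rh' u x) + A ((-1) *\<^sub>R Rh u x)"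
      by (rule A[unfolded closed_operator_def, THEN conjunct2, THEN conjunct1, THEN bspec, THEN bspec,
            OF op_familyD(6)[OF Rh' x] closed_operator_scaleR(1)[OF A op_familyD(6)[OF Rh x], of "-1"]])
    then show "Z u x \<in> D" "A (Z u x) = Z u (A x)"
      using closed_operator_scaleR(2)[OF A op_familyD(6)[OF Rh x], where c="-1"]
      by (simp_all add: Z_diff op_familyD(7)[OF Rh x] op_familyD(7)[OF Rh' x])
  qed
  define Q where "Q = volterra a \<kappa> Rh"
  define Q' where "Q' = volterra a \<kappa> Rh'"
  define V where "V = volterra a \<kappa> Z"
  have Q: "op_family D A C (pconv a \<kappa>) Q" unfolding Q_def by (rule op_family_volterra[OF A Rh \<kappa> a])
  have Q': "op_family D A C (pconv a \<kappa>) Q'" unfolding Q'_def by (rule op_family_volterra[OF A Rh' \<kappa> a])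
  have V: "op_family D A (2 * C) (pconv a \<kappa>) V" unfolding V_def by (rule op_family_volterra[OF A Z \<kappa> a])
  have Q_sum: "Q' r y = Q r y + V r y" for r y
  proof (cases "pconv_finite a \<kappa> r")
    case True
    have eq: "(\<lambda>u. a (r - u) *\<^sub>R Rh' u y) = (\<lambda>u. a (r - u) *\<^sub>R Rh u y + a (r - u) *\<^sub>R Z u y)"
      by (simp add: Z_diff scaleR_diff_right)
    show ?thesis unfolding Q'_def Q_def V_def volterra_eq_vint[OF a \<kappa> True] eq
      by (rule vint_add[OF volterra_vintegrable[OF A Rh a \<kappa> True] volterra_vintegrable[OF A Z a \<kappa> True]])
  next
    case False
    then show ?thesis by (simp add: Q'_def Q_def V_def volterra_def opint_def nconv_kernel[OF a \<kappa>])
  qed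
  have V0: "V r y = 0" if "r \<le> b" for r y
  proof -
    have "(\<lambda>u. a (r - u) *\<^sub>R Z u y) = (\<lambda>u. 0)"
      using that kernelD(3)[OF a] by (auto simp: Z_def fun_eq_iff)
    then show ?thesis by (simp add: V_def volterra_def opint_def)
  qed
  note tail = conv_tail[OF Z \<kappa> fin, of b x]
  let ?g = "\<lambda>r v. if v \<le> t - b then a (t - r - v) *\<^sub>R Z r (S v x) else 0"
  let ?V = "\<lambda>r. if r < b then 0 else V r (S (t - r) x)"
  have v: "vintegrable lborel (\<lambda>r. glue k S b Q r (t - r) x)" by (rule glue_vintegrable[OF Q q fin])
  have v': "vintegrable lborel (\<lambda>r. glue k S b' Q' r (t - r) x)" by (rule glue_vintegrable[OF Q' q fin])
  have vV: "vintegrable lborel ?V"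
  proof (rule vintegrable_bound)
    have nv: "vintegrable lborel (\<lambda>r. glue k S b V r (t - r) x)" by (rule glue_vintegrable[OF V q fin])
    then show "integrable lborel (\<lambda>r. norm (glue k S b V r (t - r) x))" by (simp add: vintegrable_def)
    show "strongly_measurable lborel ?V"
      by (intro strongly_measurable_If strongly_measurable_const op_family_apply_conv_measurable[OF V S]) measurable
  qed (auto simp: glue_def)
  have ae: "AE r in lborel. glue k S b' Q' r (t - r) x = (glue k S b Q r (t - r) x + ?V r) - vint (?g r)"
    using resR[unfolded resolvent_on_def] AE_reflect[OF resS[unfolded resolvent_on_def], of t] tail(4) AE_lborel_singleton[of b] AE_lborel_singleton[of b']
  proof eventually_elim
    case (elim r)
    consider "r < b" | "b < r" "r < b'" | "b < r" "b' \<le> r" using elim(4) by linarith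
    then show ?case
    proof cases
      case 1
      then have "?g r = (\<lambda>v. 0)" by (auto simp: Z_def)
      then have "vint (?g r) = 0" by (simp only: vint_zero)
      then show ?thesis using 1 b V0[of r] by (simp add: glue_def Q_sum)
    next
      case 2
      define y where "y = volterra a k S (t - r) x"
      have y: "y \<in> D" "A y = S (t - r) x - k (t - r) *\<^sub>R x" using elim(2) 2 t by (auto simp: y_def)
      have "volterra a \<kappa> Rh' r = volterra a \<kappa> R r" unfolding Rh'_def by (rule volterra_hat[OF a]) (use 2 in simp)
      then have "A (Q' r y) = Z r y" using elim(1) 2 by (simp add: Q'_def Z_def)
      then have "Q' r (A y) = Z r y" using op_familyD(7)[OF Q' y(1)] by simp
      then have "Q' r (S (t - r) x) - k (t - r) *\<^sub>R Q' r x = vint (?g r)"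
        using elim(3) 2 y by (simp add: y_def linear_simps[OF op_familyD(3)[OF Q']])
      then show ?thesis using 2 by (simp add: glue_def Q_sum algebra_simps)
    next
      case 3
      then have "vint (?g r) = 0" using elim(3,5) by (simp add: Z_def)
      then show ?thesis using 3 by (simp add: glue_def Q_sum)
    qed
  qed
  have sums: "vintegrable lborel (\<lambda>r. (glue k S b Q r (t - r) x + ?V r) - vint (?g r))"
    by (intro vintegrable_diff vintegrable_add v vV tail(2))
  have "vint (\<lambda>r. glue k S b' Q' r (t - r) x) = vint (\<lambda>r. (glue k S b Q r (t - r) x + ?V r) - vint (?g r))"
    by (rule vint_cong_AE(1)[OF _ _ ae]) (use v' sums in \<open>simp_all only: vintegrable_def\<close>)
  also have "\<dots> = vint (\<lambda>r. glue k S b Q r (t - r) x) + vint ?V - vint (\<lambda>r. vint (?g r))"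
    by (simp only: vint_diff[OF vintegrable_add[OF v vV] tail(2)] vint_add[OF v vV])
  also have "vint ?V = vint (\<lambda>r. vint (?g r))" using tail(1) by (simp only: V_def)
  finally show ?thesis
    by (simp add: extension_eq_vint[OF \<kappa> fin] Q_def Q'_def Rh_def Rh'_def)
qed

end

section \<open>Finiteness and continuity\<close>

text \<open>The point r = t is left out because f may blow up at 0+ although f 0 = 0. For r > t the
  sequence is eventually 0.\<close>

lemma tendsto_translate_continuous_on:
  fixes f :: "real \<Rightarrow> 'a::real_normed_vector"
  assumes f: "continuous_on {0<..L} f" "\<And>v. v \<le> 0 \<Longrightarrow> f v = 0"
    and lim: "X \<longlonglongrightarrow> t" and r: "r \<noteq> t" and L: "t - r \<le> L" "\<And>j. X j - r \<le> L"
  shows "(\<lambda>j::nat. f (X j - r)) \<longlonglongrightarrow> f (t - r)"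
proof (cases "r < t")
  case True
  have "\<forall>\<^sub>F j in sequentially. r < X j" using order_tendstoD(1)[OF lim True] .
  then have ev: "\<forall>\<^sub>F j in sequentially. X j - r \<in> {0<..L}" by eventually_elim (use L in auto)
  show ?thesis
    by (rule continuous_on_tendsto_compose[OF f(1) _ _ ev]) (use True L in \<open>auto intro!: tendsto_diff lim\<close>)
next
  case False
  then have "\<forall>\<^sub>F j in sequentially. X j < r" using order_tendstoD(2)[OF lim, of r] r by simp
  then have "\<forall>\<^sub>F j in sequentially. f (X j - r) = f (t - r)"
    by eventually_elim (use False f(2) in simp)
  then show ?thesis by (rule tendsto_eventually)
qed

lemma AE_exists_in_interval:
  assumes "AE x in lborel. P (x::real)" "a < b"
  shows "\<exists>x\<in>{a<..<b}. P x"
proof (rule ccontr)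
  assume "\<not> ?thesis"
  then have "P x \<longrightarrow> x \<notin> {a<..<b}" for x by blast
  with assms(1) have "AE x in lborel. x \<notin> {a<..<b}" by (auto elim: eventually_mono)
  then have "emeasure lborel {a<..<b} = 0" by (subst (asm) AE_iff_null_sets[symmetric]) auto
  then show False using assms(2) by simp
qed

text \<open>At a point of divergence \<open>pconv\<close> is 0 by convention, so its continuity does
  not show finiteness directly. Points X j below t with finite convolution exist arbitrarily close
  to t; Fatou's lemma along X bounds the true value at t by the limit of the values of
  \<open>pconv\<close>.\<close>

lemma pconv_finite_of_continuous:
  assumes k: "kernel k" and g: "kernel g" and kc: "continuous_on {0<..L} k"
    and c: "continuous_on {0<..L} (pconv k g)" and t: "0 < t" "t \<le> L"
  shows "pconv_finite k g t"
proof -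
  note [measurable] = kernelD(1)[OF k] kernelD(1)[OF g]
  have "\<exists>x\<in>{max 0 (t - 1 / (real j + 1))<..<t}. pconv_finite k g x" for j :: nat
    by (rule AE_exists_in_interval[OF pconv_kernel(3)[OF k g]]) (use t in auto)
  then have "\<forall>j::nat. \<exists>x. x \<in> {max 0 (t - 1 / (real j + 1))<..<t} \<and> pconv_finite k g x" by blast
  from choice[OF this] obtain X :: "nat \<Rightarrow> real" where
    X0: "\<forall>j. X j \<in> {max 0 (t - 1 / (real j + 1))<..<t} \<and> pconv_finite k g (X j)" by blast
  have X: "0 < X j" "t - 1 / (real j + 1) < X j" "X j < t" "pconv_finite k g (X j)" for j
    using X0[THEN spec, of j] by auto
  have "(\<lambda>j. t - 1 / (real j + 1)) \<longlonglongrightarrow> t - 0"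
    by (intro tendsto_diff tendsto_const) (use LIMSEQ_inverse_real_of_nat in \<open>simp add: inverse_eq_divide add.commute\<close>)
  then have Xt: "X \<longlonglongrightarrow> t"
    by (intro tendsto_sandwich[of "\<lambda>j. t - 1 / (real j + 1)" X sequentially "\<lambda>_. t"])
       (use X(2,3) in \<open>auto intro!: always_eventually less_imp_le\<close>)
  have "(\<integral>\<^sup>+r. ennreal (k (t - r) * g r) \<partial>lborel) = (\<integral>\<^sup>+r. liminf (\<lambda>j. ennreal (k (X j - r) * g r)) \<partial>lborel)"
  proof (rule nn_integral_cong_AE)
    show "AE r in lborel. ennreal (k (t - r) * g r) = liminf (\<lambda>j. ennreal (k (X j - r) * g r))"
      using AE_lborel_singleton[of t]
    proof eventually_elim
      case (elim r)
      have "(\<lambda>j. ennreal (k (X j - r) * g r)) \<longlonglongrightarrow> ennreal (k (t - r) * g r)"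
      proof (cases "r \<le> 0")
        case True then show ?thesis using kernelD(3)[OF g] by simp
      next
        case False
        have "(\<lambda>j. k (X j - r)) \<longlonglongrightarrow> k (t - r)"
        proof (rule tendsto_translate_continuous_on[OF kc kernelD(3)[OF k] Xt elim])
          show "t - r \<le> L" using False t by simp
          show "X j - r \<le> L" for j using X(3)[of j] False t by linarith
        qed
        then show ?thesis by (intro tendsto_ennrealI tendsto_mult tendsto_const)
      qed
      then show ?case by (rule lim_imp_Liminf[symmetric, rotated]) simp
    qed
  qed
  also have "\<dots> \<le> liminf (\<lambda>j. \<integral>\<^sup>+r. ennreal (k (X j - r) * g r) \<partial>lborel)"
    by (rule nn_integral_liminf) measurable
  also have "(\<lambda>j. \<integral>\<^sup>+r. ennreal (k (X j - r) * g r) \<partial>lborel) = (\<lambda>j. ennreal (pconv k g (X j)))"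
    using X(4) by (simp add: pconv_def nconv_kernel[OF k g, symmetric] fun_eq_iff less_top)
  also have "liminf (\<lambda>j. ennreal (pconv k g (X j))) = ennreal (pconv k g t)"
  proof (rule lim_imp_Liminf)
    have "(\<lambda>j. pconv k g (X j)) \<longlonglongrightarrow> pconv k g t"
      by (rule continuous_on_tendsto_compose[OF c Xt])
         (use t X(1) less_imp_le[OF X(3)] in \<open>auto intro!: always_eventually intro: order_trans\<close>)
    then show "(\<lambda>j. ennreal (pconv k g (X j))) \<longlonglongrightarrow> ennreal (pconv k g t)" by (rule tendsto_ennrealI)
  qed simp
  finally show ?thesis by (simp add: nconv_kernel[OF k g] le_less_trans[OF _ ennreal_less_top])
qed

text \<open>The difficulty is that \<open>a\<close> is only integrable near t while K = k*a*\<kappa>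
  may blow up at 0. The integral of a(t-s)K(s) is cut at t/2. For s \<ge> t/2, K is at most B by
  compactness. For s < t/2 write K = h*a with h = k*\<kappa>; exchanging the integrals leaves at
  most a(r)(a*h)(t-r) = a(r)K(t-r) with r < t/2, where t - r is again in the range bounded by B.
  Each half is at most B times the integral of \<open>a\<close>.\<close>

lemma pconv_kernel_finite:
  assumes a: "kernel a" and k: "kernel k" and \<kappa>: "kernel \<kappa>"
    and c: "continuous_on {0<..L} (pconv k (pconv a \<kappa>))"
    and fin: "\<And>t. 0 < t \<Longrightarrow> t \<le> L \<Longrightarrow> pconv_finite k (pconv a \<kappa>) t"
    and t: "0 < t" "t \<le> L"
  shows "pconv_finite a (pconv k (pconv a \<kappa>)) t"
proof -
  define K where "K = pconv k (pconv a \<kappa>)"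
  have q: "kernel (pconv a \<kappa>)" by (rule pconv_kernel(1)[OF a \<kappa>])
  have K: "kernel K" unfolding K_def by (rule pconv_kernel(1)[OF k q])
  define h where "h = nconv (\<lambda>s. ennreal (k s)) (\<lambda>s. ennreal (\<kappa> s))"
  note [measurable] = kernelD(1)[OF a] kernelD(1)[OF k] kernelD(1)[OF \<kappa>] kernelD(1)[OF K]
    kernelD(5)[OF a] kernelD(5)[OF k] kernelD(5)[OF \<kappa>] kernelD(5)[OF K]
  have [measurable]: "h \<in> borel_measurable borel" unfolding h_def by measurable
  have h0: "h s = 0" if "s \<le> 0" for s
    unfolding h_def by (rule nconv_zero) (use that kernelD(3)[OF k] kernelD(3)[OF \<kappa>] in auto)
  have ka: "nconv (\<lambda>s. ennreal (k s)) (\<lambda>s. ennreal (pconv a \<kappa> s)) s = nconv (\<lambda>s. ennreal (a s)) h s" for s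
  proof -
    have "nconv (\<lambda>s. ennreal (k s)) (\<lambda>s. ennreal (pconv a \<kappa> s)) s
        = nconv (nconv (\<lambda>s. ennreal (k s)) (\<lambda>s. ennreal (a s))) (\<lambda>s. ennreal (\<kappa> s)) s"
      by (simp add: nconv_pconv_right[OF a \<kappa>] nconv_assoc)
    also have "nconv (\<lambda>s. ennreal (k s)) (\<lambda>s. ennreal (a s)) = nconv (\<lambda>s. ennreal (a s)) (\<lambda>s. ennreal (k s))"
      by (rule ext) (rule nconv_commute; measurable)
    finally show ?thesis by (simp add: h_def nconv_assoc)
  qed
  have K_eq: "ennreal (K s) = nconv (\<lambda>s. ennreal (a s)) h s" if "0 < s" "s \<le> L" for s
    using fin[OF that] unfolding K_def pconv_def[of k] by (simp add: ka less_top)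
  have "compact (K ` {t/2..t})"
    using c t by (intro compact_continuous_image continuous_on_subset[OF c[folded K_def]]) auto
  then obtain B where B: "\<And>s. s \<in> {t/2..t} \<Longrightarrow> K s \<le> B"
    using compact_imp_bounded bounded_imp_bdd_above unfolding bdd_above_def by (metis imageI)
  define I where "I = ennreal B * (\<integral>\<^sup>+s. ennreal (a s) \<partial>lborel)"
  have I: "I < \<infinity>" using kernelD(6)[OF a] by (simp add: I_def ennreal_mult_less_top)
  have "nconv (\<lambda>s. ennreal (a s)) (\<lambda>s. ennreal (K s)) t
     = (\<integral>\<^sup>+s. (if t/2 \<le> s then ennreal (a (t - s)) * ennreal (K s) else 0)
         + (if s < t/2 then ennreal (a (t - s)) * ennreal (K s) else 0) \<partial>lborel)"
    unfolding nconv_def by (intro nn_integral_cong) auto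
  also have "\<dots> = (\<integral>\<^sup>+s. (if t/2 \<le> s then ennreal (a (t - s)) * ennreal (K s) else 0) \<partial>lborel)
      + (\<integral>\<^sup>+s. (if s < t/2 then ennreal (a (t - s)) * ennreal (K s) else 0) \<partial>lborel)"
    by (rule nn_integral_add) measurable
  also have "\<dots> \<le> I + I"
  proof (rule add_mono)
    have "(\<integral>\<^sup>+s. (if t/2 \<le> s then ennreal (a (t - s)) * ennreal (K s) else 0) \<partial>lborel)
        \<le> (\<integral>\<^sup>+s. ennreal B * ennreal (a (t - s)) \<partial>lborel)"
    proof (rule nn_integral_mono)
      fix s
      show "(if t/2 \<le> s then ennreal (a (t - s)) * ennreal (K s) else 0) \<le> ennreal B * ennreal (a (t - s))"
        using B[of s] kernelD(3)[OF a, of "t - s"]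
        by (cases "s \<le> t") (auto simp: mult.commute intro!: mult_right_mono ennreal_leI)
    qed
    also have "\<dots> = I" unfolding I_def
      by (simp add: nn_integral_cmult nn_integral_reflect[of "\<lambda>s. ennreal (a s)"])
    finally show "(\<integral>\<^sup>+s. (if t/2 \<le> s then ennreal (a (t - s)) * ennreal (K s) else 0) \<partial>lborel) \<le> I" .
    have "(\<integral>\<^sup>+s. (if s < t/2 then ennreal (a (t - s)) * ennreal (K s) else 0) \<partial>lborel)
        = (\<integral>\<^sup>+s. (if s < t/2 then ennreal (a (t - s)) * nconv h (\<lambda>s. ennreal (a s)) s else 0) \<partial>lborel)"
    proof (rule nn_integral_cong)
      fix s :: real
      have "ennreal (K s) = nconv h (\<lambda>s. ennreal (a s)) s" if "s < t/2"
      proof (cases "0 < s")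
        case True
        then show ?thesis using K_eq[of s] that t nconv_commute[of h "\<lambda>s. ennreal (a s)" s] by simp
      next
        case False
        then have "nconv h (\<lambda>s. ennreal (a s)) s = 0"
          by (intro nconv_zero) (use h0 kernelD(3)[OF a] in auto)
        then show ?thesis using False kernelD(3)[OF K, of s] by simp
      qed
      then show "(if s < t/2 then ennreal (a (t - s)) * ennreal (K s) else 0)
          = (if s < t/2 then ennreal (a (t - s)) * nconv h (\<lambda>s. ennreal (a s)) s else 0)" by simp
    qed
    also have "\<dots> = (\<integral>\<^sup>+s. \<integral>\<^sup>+r. (if s < t/2 then ennreal (a (t - s)) * (h (s - r) * ennreal (a r)) else 0) \<partial>lborel \<partial>lborel)"
      unfolding nconv_def by (intro nn_integral_cong) (simp add: nn_integral_cmult)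
    also have "\<dots> = (\<integral>\<^sup>+r. \<integral>\<^sup>+s. (if s < t/2 then ennreal (a (t - s)) * (h (s - r) * ennreal (a r)) else 0) \<partial>lborel \<partial>lborel)"
      by (rule lborel_pair.Fubini') measurable
    also have "\<dots> \<le> (\<integral>\<^sup>+r. ennreal B * ennreal (a r) \<partial>lborel)"
    proof (rule nn_integral_mono)
      fix r
      consider "r \<le> 0" | "t/2 \<le> r" | "0 < r" "r < t/2" by linarith
      then show "(\<integral>\<^sup>+s. (if s < t/2 then ennreal (a (t - s)) * (h (s - r) * ennreal (a r)) else 0) \<partial>lborel) \<le> ennreal B * ennreal (a r)"
      proof cases
        case 1
        then have "(\<lambda>s. if s < t/2 then ennreal (a (t - s)) * (h (s - r) * ennreal (a r)) else 0) = (\<lambda>s. 0)"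
          using kernelD(3)[OF a, of r] by auto
        then show ?thesis by (simp only: nn_integral_const) simp
      next
        case 2
        then have "(\<lambda>s. if s < t/2 then ennreal (a (t - s)) * (h (s - r) * ennreal (a r)) else 0) = (\<lambda>s. 0)"
          using h0 by auto
        then show ?thesis by (simp only: nn_integral_const) simp
      next
        case 3
        have "(\<integral>\<^sup>+s. (if s < t/2 then ennreal (a (t - s)) * (h (s - r) * ennreal (a r)) else 0) \<partial>lborel)
            \<le> (\<integral>\<^sup>+s. (ennreal (a (t - s)) * h (s - r)) * ennreal (a r) \<partial>lborel)"
          by (intro nn_integral_mono) (simp add: mult.assoc)
        also have "\<dots> = (\<integral>\<^sup>+s. ennreal (a (t - s)) * h (s - r) \<partial>lborel) * ennreal (a r)"
          by (rule nn_integral_multc) measurable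
        also have "(\<integral>\<^sup>+s. ennreal (a (t - s)) * h (s - r) \<partial>lborel) = nconv (\<lambda>s. ennreal (a s)) h (t - r)"
          using nn_integral_shift[of "\<lambda>s. ennreal (a (t - r - s)) * h s" r] by (simp add: nconv_def algebra_simps)
        also have "\<dots> = ennreal (K (t - r))" using K_eq[of "t - r"] 3 t by simp
        also have "ennreal (K (t - r)) * ennreal (a r) \<le> ennreal B * ennreal (a r)"
          using B[of "t - r"] 3 by (intro mult_right_mono ennreal_leI) auto
        finally show ?thesis .
      qed
    qed
    also have "\<dots> = I" by (simp add: I_def nn_integral_cmult)
    finally show "(\<integral>\<^sup>+s. (if s < t/2 then ennreal (a (t - s)) * ennreal (K s) else 0) \<partial>lborel) \<le> I" .
  qed
  also have "\<dots> < \<infinity>" using I by simp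
  finally show ?thesis unfolding K_def .
qed

lemma nconv_pos:
  assumes f: "AE s in lborel. 0 < s \<and> s \<le> L \<longrightarrow> 0 < f s" and g: "AE s in lborel. 0 < s \<and> s \<le> L \<longrightarrow> 0 < g s"
    and [measurable]: "f \<in> borel_measurable borel" "g \<in> borel_measurable borel"
    and t: "0 < t" "t \<le> L"
  shows "0 < nconv f g t"
proof (rule ccontr)
  assume "\<not> ?thesis"
  then have "(\<integral>\<^sup>+s. f (t - s) * g s \<partial>lborel) = 0" by (simp add: nconv_def)
  then have "AE s in lborel. f (t - s) * g s = 0" by (subst (asm) nn_integral_0_iff_AE) auto
  then have "AE s in lborel. s \<notin> {0<..<t}"
    using AE_reflect[OF f, of t] g
  proof eventually_elim
    case (elim s)
    show ?case using elim t by (auto simp: less_imp_neq)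
  qed
  then have "emeasure lborel {0<..<t} = 0" by (subst (asm) AE_iff_null_sets[symmetric]) auto
  then show False using t by simp
qed

text \<open>A relative error \<epsilon> with respect to the kernel survives convolution with a
  nonnegative function. Stated as an inequality and not as a quotient, it also makes sense where
  kernels vanish, and it can be assumed for almost every u only.\<close>

lemma volterra_asymptotic:
  fixes H :: "real \<Rightarrow> 'a \<Rightarrow> 'a::complex_banach"
  assumes A: "closed_operator D A" and H: "op_family D A C \<kappa> H" and f: "kernel f" and \<kappa>: "kernel \<kappa>"
    and fin: "pconv_finite f \<kappa> t"
    and close: "AE u in lborel. u < t \<longrightarrow> norm (H u x - \<kappa> u *\<^sub>R x) \<le> \<epsilon> * \<kappa> u"
  shows "norm (volterra f \<kappa> H t x - pconv f \<kappa> t *\<^sub>R x) \<le> \<epsilon> * pconv f \<kappa> t"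
proof -
  note [measurable] = kernelD(1)[OF f] kernelD(1)[OF \<kappa>]
  have i: "integrable lborel (\<lambda>u. f (t - u) * \<kappa> u)"
    using fin kernelD(2)[OF f] kernelD(2)[OF \<kappa>] by (intro integrableI_nonneg) (auto simp: nconv_kernel[OF f \<kappa>])
  have p: "(\<integral>u. f (t - u) * \<kappa> u \<partial>lborel) = pconv f \<kappa> t"
    using integral_conv_eq[OF f \<kappa>, of t 0] by simp
  have v1: "vintegrable lborel (\<lambda>u. f (t - u) *\<^sub>R H u x)" by (rule volterra_vintegrable[OF A H f \<kappa> fin])
  have v2: "vintegrable lborel (\<lambda>u. f (t - u) *\<^sub>R \<kappa> u *\<^sub>R x)"
    using vintegrable_scaleR_left[OF i, of x] by simp
  have "vint (\<lambda>u. f (t - u) *\<^sub>R \<kappa> u *\<^sub>R x) = pconv f \<kappa> t *\<^sub>R x"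
    using vint_scaleR_left[OF i, of x] p by simp
  then have "norm (volterra f \<kappa> H t x - pconv f \<kappa> t *\<^sub>R x)
      = norm (vint (\<lambda>u. f (t - u) *\<^sub>R H u x - f (t - u) *\<^sub>R \<kappa> u *\<^sub>R x))"
    by (simp only: vint_diff[OF v1 v2] volterra_eq_vint[OF f \<kappa> fin])
  also have "\<dots> \<le> (\<integral>u. norm (f (t - u) *\<^sub>R H u x - f (t - u) *\<^sub>R \<kappa> u *\<^sub>R x) \<partial>lborel)"
    by (rule norm_vint_le[OF vintegrable_diff[OF v1 v2]])
  also have "\<dots> \<le> (\<integral>u. \<epsilon> * (f (t - u) * \<kappa> u) \<partial>lborel)"
  proof (rule integral_mono_AE)
    show "integrable lborel (\<lambda>u. norm (f (t - u) *\<^sub>R H u x - f (t - u) *\<^sub>R \<kappa> u *\<^sub>R x))"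
      using vintegrable_diff[OF v1 v2] by (simp add: vintegrable_def)
    show "integrable lborel (\<lambda>u. \<epsilon> * (f (t - u) * \<kappa> u))" using i by simp
    show "AE u in lborel. norm (f (t - u) *\<^sub>R H u x - f (t - u) *\<^sub>R \<kappa> u *\<^sub>R x) \<le> \<epsilon> * (f (t - u) * \<kappa> u)"
      using close
    proof eventually_elim
      case (elim u)
      have "norm (f (t - u) *\<^sub>R H u x - f (t - u) *\<^sub>R \<kappa> u *\<^sub>R x) = f (t - u) * norm (H u x - \<kappa> u *\<^sub>R x)"
        using kernelD(2)[OF f, of "t - u"] unfolding scaleR_diff_right[symmetric] norm_scaleR by simp
      also have "\<dots> \<le> f (t - u) * (\<epsilon> * \<kappa> u)"
      proof (cases "u < t")
        case True then show ?thesis using elim kernelD(2)[OF f] by (intro mult_left_mono) auto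
      next
        case False then show ?thesis using kernelD(3)[OF f, of "t - u"] by simp
      qed
      finally show ?case by (simp add: mult_ac)
    qed
  qed
  also have "\<dots> = \<epsilon> * pconv f \<kappa> t" by (simp add: p)
  finally show ?thesis .
qed

context resolvent_setting
begin

lemma extension_asymptotic:
  assumes R: "op_family D A C \<kappa> R" and \<kappa>: "kernel \<kappa>" and t: "t < b"
    and fin: "pconv_finite k (pconv a \<kappa>) t"
    and close: "AE u in lborel. u < t \<longrightarrow> norm (R u x - \<kappa> u *\<^sub>R x) \<le> \<epsilon> * \<kappa> u"
  shows "norm (extension a k S b \<kappa> R t x - pconv k (pconv a \<kappa>) t *\<^sub>R x) \<le> \<epsilon> * pconv k (pconv a \<kappa>) t"
proof -
  define Rh where "Rh = hat b \<kappa> R"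
  define Q where "Q = volterra a \<kappa> Rh"
  have Rh: "op_family D A C \<kappa> Rh" unfolding Rh_def by (rule op_family_hat[OF A R \<kappa>])
  have q: "kernel (pconv a \<kappa>)" by (rule pconv_kernel(1)[OF a \<kappa>])
  have Q: "op_family D A C (pconv a \<kappa>) Q" unfolding Q_def by (rule op_family_volterra[OF A Rh \<kappa> a])
  \<comment> \<open>As t < b, the branch r \<ge> b only meets negative times t - r, at which k and S
    vanish. Below the break point the extension is therefore k*(a*R).\<close>
  have eq: "(\<lambda>r. glue k S b Q r (t - r) x) = (\<lambda>r. k (t - r) *\<^sub>R Q r x)"
  proof
    fix r
    show "glue k S b Q r (t - r) x = k (t - r) *\<^sub>R Q r x"
    proof (cases "r < b")
      case False
      then have k0: "k (t - r) = 0" using t by (intro kernelD(3)[OF k]) simp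
      then have "S (t - r) x = 0" by (rule op_family_zero[OF S])
      then show ?thesis using False k0 linear_0[OF bounded_linear.linear[OF op_familyD(3)[OF Q]]]
        by (simp add: glue_def)
    qed (simp add: glue_def)
  qed
  have "extension a k S b \<kappa> R t x = vint (\<lambda>r. glue k S b Q r (t - r) x)"
    unfolding Q_def Rh_def by (rule extension_eq_vint[OF \<kappa> fin])
  also have "\<dots> = volterra k (pconv a \<kappa>) Q t x"
    by (simp only: eq volterra_eq_vint[OF k q fin])
  finally have ext: "extension a k S b \<kappa> R t x = volterra k (pconv a \<kappa>) Q t x" .
  show ?thesis unfolding ext
  proof (rule volterra_asymptotic[OF A Q k q fin])
    show "AE r in lborel. r < t \<longrightarrow> norm (Q r x - pconv a \<kappa> r *\<^sub>R x) \<le> \<epsilon> * pconv a \<kappa> r"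
      using pconv_kernel(3)[OF a \<kappa>]
    proof eventually_elim
      case (elim r)
      show ?case
      proof
        assume r: "r < t"
        show "norm (Q r x - pconv a \<kappa> r *\<^sub>R x) \<le> \<epsilon> * pconv a \<kappa> r"
          unfolding Q_def
        proof (rule volterra_asymptotic[OF A Rh a \<kappa> elim])
          show "AE u in lborel. u < r \<longrightarrow> norm (Rh u x - \<kappa> u *\<^sub>R x) \<le> \<epsilon> * \<kappa> u"
            using close by eventually_elim (use r t in \<open>simp add: Rh_def hat_def\<close>)
        qed
      qed
    qed
  qed
qed

text \<open>If k blows up at 0, its translates may have no common integrable majorant, so the
  majorant has to depend on the time s. Its integral is a multiple of the new kernel at s, and the
  assumed continuity of that kernel is what \<open>L1_convergence_varying_bound\<close> asks for.
  Pointwise convergence only involves continuity of k and S, because \<open>Q r\<close> stays fixed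
  while s moves.\<close>

lemma extension_continuous:
  assumes R: "op_family D A C \<kappa> R" and \<kappa>: "kernel \<kappa>"
    and kc: "continuous_on {0<..L} k" and Sc: "\<And>x. continuous_on {0<..T} (\<lambda>v. S v x)"
    and L: "L \<le> b + T"
    and c: "continuous_on {0<..L} (pconv k (pconv a \<kappa>))"
    and fin: "\<And>t. 0 < t \<Longrightarrow> t \<le> L \<Longrightarrow> pconv_finite k (pconv a \<kappa>) t"
  shows "continuous_on {0<..L} (\<lambda>t. extension a k S b \<kappa> R t x)"
  unfolding continuous_on_sequentially
proof (intro allI ballI impI, elim conjE)
  fix X :: "nat \<Rightarrow> real" and t
  assume t: "t \<in> {0<..L}" and X0: "\<forall>n. X n \<in> {0<..L}" and lim: "X \<longlonglongrightarrow> t"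
  have X: "0 < X j" "X j \<le> L" for j using X0 by auto
  define q where "q = pconv a \<kappa>"
  define Q where "Q = volterra a \<kappa> (hat b \<kappa> R)"
  have q: "kernel q" unfolding q_def by (rule pconv_kernel(1)[OF a \<kappa>])
  have Q: "op_family D A C q Q" unfolding Q_def q_def
    by (rule op_family_volterra[OF A op_family_hat[OF A R \<kappa>] \<kappa> a])
  note [measurable] = kernelD(1)[OF k] kernelD(1)[OF q]
  define F where "F s r = glue k S b Q r (s - r) x" for s r
  define G where "G s r = (C * CS * norm x) * (k (s - r) * q r)" for s r
  have fq: "pconv_finite k q s" if "0 < s" "s \<le> L" for s using fin[OF that] by (simp only: q_def)
  have vF: "vintegrable lborel (F s)" if "0 < s" "s \<le> L" for s
    using glue_vintegrable[OF Q q fq[OF that], of b x] unfolding F_def .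
  have iG: "integrable lborel (G s)" if "0 < s" "s \<le> L" for s
  proof -
    have "integrable lborel (\<lambda>r. k (s - r) * q r)"
      using fq[OF that] kernelD(2)[OF k] kernelD(2)[OF q] by (intro integrableI_nonneg) (auto simp: nconv_kernel[OF k q])
    then show ?thesis unfolding G_def[abs_def] by (rule integrable_mult_right)
  qed
  have intG: "(\<integral>r. G s r \<partial>lborel) = (C * CS * norm x) * pconv k q s" for s
    using integral_conv_eq[OF k q, of s 0] by (simp add: G_def)
  have bnd: "norm (F s r) \<le> G s r" for s r
    using op_familyD(4)[OF op_family_glue(1)[OF Q q, where t=s and b=b], of r x] by (simp add: F_def G_def mult_ac)
  have ptw: "(\<lambda>j. k (X j - r)) \<longlonglongrightarrow> k (t - r)" if "r \<noteq> t" "0 < r" for r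
  proof (rule tendsto_translate_continuous_on[OF kc kernelD(3)[OF k] lim that(1)])
    show "t - r \<le> L" using t that by simp
    show "X j - r \<le> L" for j using X(2)[of j] that(2) by linarith
  qed
  have limG: "AE r in lborel. (\<lambda>j. G (X j) r) \<longlonglongrightarrow> G t r"
    using AE_lborel_singleton[of t]
  proof eventually_elim
    case (elim r)
    show ?case
    proof (cases "r \<le> 0")
      case True then show ?thesis using kernelD(3)[OF q] by (simp add: G_def)
    next
      case False then show ?thesis unfolding G_def by (intro tendsto_mult tendsto_const ptw elim) simp
    qed
  qed
  have limF: "AE r in lborel. (\<lambda>j. F (X j) r) \<longlonglongrightarrow> F t r"
    using AE_lborel_singleton[of t]
  proof eventually_elim
    case (elim r)
    show ?case
    proof (cases "r \<le> 0")
      case True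
      then have "Q r y = 0" for y using op_family_zero[OF Q] kernelD(3)[OF q] by blast
      then show ?thesis by (simp add: F_def glue_def)
    next
      case r: False
      show ?thesis
      proof (cases "r < b")
        case True then show ?thesis unfolding F_def glue_def using r
          by (auto intro!: tendsto_scaleR tendsto_const ptw elim)
      next
        case False
        have "(\<lambda>j. S (X j - r) x) \<longlonglongrightarrow> S (t - r) x"
        proof (rule tendsto_translate_continuous_on[OF Sc _ lim elim])
          show "S v x = 0" if "v \<le> 0" for v using op_family_zero[OF S kernelD(3)[OF k that]] .
          show "t - r \<le> T" using t False L by simp
          show "X j - r \<le> T" for j using X(2)[of j] False L by linarith
        qed
        then have "(\<lambda>j. Q r (S (X j - r) x)) \<longlonglongrightarrow> Q r (S (t - r) x)"
          by (rule bounded_linear.tendsto[OF op_familyD(3)[OF Q]])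
        then show ?thesis using False by (simp add: F_def glue_def)
      qed
    qed
  qed
  have t': "0 < t" "t \<le> L" using t by auto
  have "(\<lambda>j. \<integral>r. norm (F (X j) r - F t r) \<partial>lborel) \<longlonglongrightarrow> 0"
  proof (rule L1_convergence_varying_bound[OF vF[OF X] vF[OF t'] iG[OF X] iG[OF t'] limF limG bnd bnd])
    have "(\<lambda>j. pconv k q (X j)) \<longlonglongrightarrow> pconv k q t"
      using continuous_on_tendsto_compose[OF c lim t] X0 by (simp add: q_def)
    then show "(\<lambda>j. \<integral>r. G (X j) r \<partial>lborel) \<longlonglongrightarrow> (\<integral>r. G t r \<partial>lborel)"
      unfolding intG by (intro tendsto_mult tendsto_const)
  qed
  then have "(\<lambda>j. vint (F (X j))) \<longlonglongrightarrow> vint (F t)"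
    by (rule vint_LIMSEQ_L1[OF vF[OF X] vF[OF t']])
  moreover have "extension a k S b \<kappa> R s x = vint (F s)" if "0 < s" "s \<le> L" for s
    unfolding F_def Q_def by (rule extension_eq_vint[OF \<kappa> fin[OF that]])
  ultimately show "((\<lambda>t. extension a k S b \<kappa> R t x) \<circ> X) \<longlonglongrightarrow> extension a k S b \<kappa> R t x"
    using X t' by (simp add: o_def)
qed

text \<open>\<open>R\<close> enters the extension only under an integral and only up to b. Hence
  families known up to a null set determine their extension at every t.\<close>

lemma extension_cong:
  assumes ae: "AE u in lborel. u \<le> b \<longrightarrow> (\<forall>x. R u x = R' u x)" and \<kappa>: "kernel \<kappa>"
    and R: "op_family D A C \<kappa> R" and R': "op_family D A C' \<kappa> R'"
  shows "extension a k S b \<kappa> R t x = extension a k S b \<kappa> R' t x"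
proof -
  have "volterra a \<kappa> (hat b \<kappa> R) r y = volterra a \<kappa> (hat b \<kappa> R') r y" for r y
  proof -
    have "vint (\<lambda>u. a (r - u) *\<^sub>R hat b \<kappa> R u y) = vint (\<lambda>u. a (r - u) *\<^sub>R hat b \<kappa> R' u y)"
    proof (rule vint_cong_AE(1))
      show "strongly_measurable lborel (\<lambda>u. a (r - u) *\<^sub>R hat b \<kappa> R u y)"
        by (rule op_familyD(5)[OF op_family_volterra_integrand[OF A op_family_hat[OF A R \<kappa>] \<kappa> a]])
      show "strongly_measurable lborel (\<lambda>u. a (r - u) *\<^sub>R hat b \<kappa> R' u y)"
        by (rule op_familyD(5)[OF op_family_volterra_integrand[OF A op_family_hat[OF A R' \<kappa>] \<kappa> a]])
      show "AE u in lborel. a (r - u) *\<^sub>R hat b \<kappa> R u y = a (r - u) *\<^sub>R hat b \<kappa> R' u y"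
        using ae by eventually_elim (simp add: hat_def)
    qed
    then show ?thesis by (simp add: volterra_def opint_def)
  qed
  then have "volterra a \<kappa> (hat b \<kappa> R) = volterra a \<kappa> (hat b \<kappa> R')" by (intro ext)
  then show ?thesis unfolding extension_def by (simp only:)
qed

end

section \<open>Iterating the extension step\<close>

context resolvent_setting
begin

text \<open>This is (k*a)^{*m}*k, bracketed so that it is literally the majorant supplied by
  \<open>op_family_extension\<close>.\<close>

primrec kern :: "nat \<Rightarrow> real \<Rightarrow> real" where
  "kern 0 = k"
| "kern (Suc m) = pconv k (pconv a (kern m))"

text \<open>\<open>fam T m\<close> obeys its resolvent equation up to (m+1)T, so this is the next
  break point.\<close>

primrec fam :: "real \<Rightarrow> nat \<Rightarrow> real \<Rightarrow> 'a \<Rightarrow> 'a" where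
  "fam T 0 = S"
| "fam T (Suc m) = extension a k S (real (Suc m) * T) (kern m) (fam T m)"

lemma kernel_kern: "kernel (kern m)"
  by (induction m) (simp_all add: k pconv_kernel(1)[OF k pconv_kernel(1)[OF a]])

lemma op_family_fam: "\<exists>C. op_family D A C (kern m) (fam T m)"
proof (induction m)
  case 0 then show ?case using S by auto
next
  case (Suc m)
  then obtain C where "op_family D A C (kern m) (fam T m)" by blast
  from op_family_extension[OF this kernel_kern] show ?case by auto
qed

lemma resolvent_fam:
  assumes "resolvent_on a D A T k S"
  shows "resolvent_on a D A (real (Suc m) * T) (kern m) (fam T m)"
proof (induction m)
  case 0 then show ?case using assms by simp
next
  case (Suc m)
  obtain C where R: "op_family D A C (kern m) (fam T m)" using op_family_fam by blast
  note K = kernel_kern[of m] kernel_kern[of "Suc m"]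
  show ?case
    unfolding resolvent_on_def
    using pconv_kernel(3)[OF k pconv_kernel(1)[OF a K(1)]] pconv_kernel(3)[OF a K(2)]
  proof eventually_elim
    case (elim t)
    show ?case
    proof (intro impI allI)
      fix x assume "t \<le> real (Suc (Suc m)) * T"
      then have t: "t \<le> real (Suc m) * T + T" by (simp add: algebra_simps)
      show "volterra a (kern (Suc m)) (fam T (Suc m)) t x \<in> D \<and>
        A (volterra a (kern (Suc m)) (fam T (Suc m)) t x) = fam T (Suc m) t x - kern (Suc m) t *\<^sub>R x"
        using extension_resolvent_equation[OF R K(1) Suc assms t elim(1) elim(2)[unfolded kern.simps], of x] by simp
    qed
  qed
qed

text \<open>The inner family is exchanged while the break point stays at (m+1)T, below which both
  agree almost everywhere; after that the break point moves to (m+1)T'. The second move concerns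
  \<open>fam T' m\<close>, whose resolvent equation reaches that far.\<close>

lemma fam_independent_Suc:
  assumes res: "resolvent_on a D A T' k S" and T: "0 \<le> T" "T \<le> T'"
    and ae: "AE u in lborel. u \<le> real (Suc m) * T \<longrightarrow> (\<forall>x. fam T m u x = fam T' m u x)"
    and t: "t \<le> real (Suc (Suc m)) * T" and fin: "pconv_finite k (pconv a (kern m)) t"
  shows "fam T (Suc m) t x = fam T' (Suc m) t x"
proof -
  obtain C where R: "op_family D A C (kern m) (fam T m)" using op_family_fam by blast
  obtain C' where R': "op_family D A C' (kern m) (fam T' m)" using op_family_fam by blast
  have "fam T (Suc m) t x = extension a k S (real (Suc m) * T) (kern m) (fam T' m) t x"
    using extension_cong[OF ae kernel_kern R R'] by simp
  also have "\<dots> = fam T' (Suc m) t x"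
  proof -
    have "t \<le> real (Suc m) * T + T'" using t T by (simp add: algebra_simps)
    moreover have "real (Suc m) * T \<le> real (Suc m) * T'" using T by (intro mult_left_mono) auto
    ultimately show ?thesis
      using extension_independent[OF R' kernel_kern resolvent_fam[OF res] res _ _ fin, of "real (Suc m) * T" x] by simp
  qed
  finally show ?thesis .
qed

lemma fam_independent_AE:
  assumes res: "resolvent_on a D A T' k S" and T: "0 \<le> T" "T \<le> T'"
  shows "AE u in lborel. u \<le> real (Suc m) * T \<longrightarrow> (\<forall>x. fam T m u x = fam T' m u x)"
proof (induction m)
  case 0 then show ?case by simp
next
  case (Suc m)
  show ?case
    using pconv_kernel(3)[OF k pconv_kernel(1)[OF a kernel_kern[of m]]]
    by eventually_elim (use fam_independent_Suc[OF res T Suc] in blast)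
qed

text \<open>The almost everywhere form carries the induction through kernels that may be infinite on
  a null set; the pointwise form is for the last kernel.\<close>

lemma fam_asymptotic:
  assumes T: "0 < T"
    and S0: "\<And>\<epsilon>. 0 < \<epsilon> \<Longrightarrow> \<exists>\<delta>>0. AE u in lborel. u < \<delta> \<longrightarrow> norm (S u x - k u *\<^sub>R x) \<le> \<epsilon> * k u"
    and "0 < \<epsilon>"
  shows "\<exists>\<delta>>0. AE u in lborel. u < \<delta> \<longrightarrow> norm (fam T m u x - kern m u *\<^sub>R x) \<le> \<epsilon> * kern m u"
    "\<exists>\<delta>>0. \<forall>t<\<delta>. pconv_finite k (pconv a (kern m)) t \<longrightarrow>
        norm (fam T (Suc m) t x - kern (Suc m) t *\<^sub>R x) \<le> \<epsilon> * kern (Suc m) t"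
proof -
  have step: "\<exists>\<delta>>0. \<forall>t<\<delta>. pconv_finite k (pconv a (kern m)) t \<longrightarrow>
        norm (fam T (Suc m) t x - kern (Suc m) t *\<^sub>R x) \<le> \<epsilon> * kern (Suc m) t"
    if IH: "\<exists>\<delta>>0. AE u in lborel. u < \<delta> \<longrightarrow> norm (fam T m u x - kern m u *\<^sub>R x) \<le> \<epsilon> * kern m u" for m
  proof -
    obtain C where R: "op_family D A C (kern m) (fam T m)" using op_family_fam by blast
    obtain \<delta> where \<delta>: "\<delta> > 0" and ae: "AE u in lborel. u < \<delta> \<longrightarrow> norm (fam T m u x - kern m u *\<^sub>R x) \<le> \<epsilon> * kern m u"
      using IH by blast
    show ?thesis
    proof (intro exI[of _ "min \<delta> (real (Suc m) * T)"] conjI allI impI)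
      show "0 < min \<delta> (real (Suc m) * T)" using \<delta> T by simp
      fix t assume t: "t < min \<delta> (real (Suc m) * T)" and fin: "pconv_finite k (pconv a (kern m)) t"
      have "norm (extension a k S (real (Suc m) * T) (kern m) (fam T m) t x - pconv k (pconv a (kern m)) t *\<^sub>R x)
          \<le> \<epsilon> * pconv k (pconv a (kern m)) t"
      proof (rule extension_asymptotic[OF R kernel_kern _ fin])
        show "t < real (Suc m) * T" using t by simp
        show "AE u in lborel. u < t \<longrightarrow> norm (fam T m u x - kern m u *\<^sub>R x) \<le> \<epsilon> * kern m u"
          using ae by eventually_elim (use t in auto)
      qed
      then show "norm (fam T (Suc m) t x - kern (Suc m) t *\<^sub>R x) \<le> \<epsilon> * kern (Suc m) t" by simp
    qed
  qed
  show 1: "\<exists>\<delta>>0. AE u in lborel. u < \<delta> \<longrightarrow> norm (fam T m u x - kern m u *\<^sub>R x) \<le> \<epsilon> * kern m u" for m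
  proof (induction m)
    case 0 then show ?case using S0[OF \<open>0 < \<epsilon>\<close>] by simp
  next
    case (Suc m)
    obtain \<delta> where \<delta>: "\<delta> > 0" and *: "\<And>t. t < \<delta> \<Longrightarrow> pconv_finite k (pconv a (kern m)) t \<Longrightarrow>
        norm (fam T (Suc m) t x - kern (Suc m) t *\<^sub>R x) \<le> \<epsilon> * kern (Suc m) t"
      using step[OF Suc] by blast
    have "AE u in lborel. u < \<delta> \<longrightarrow> norm (fam T (Suc m) u x - kern (Suc m) u *\<^sub>R x) \<le> \<epsilon> * kern (Suc m) u"
      using pconv_kernel(3)[OF k pconv_kernel(1)[OF a kernel_kern[of m]]]
      by eventually_elim (use * in blast)
    then show ?case using \<delta> by blast
  qed
  show "\<exists>\<delta>>0. \<forall>t<\<delta>. pconv_finite k (pconv a (kern m)) t \<longrightarrow>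
        norm (fam T (Suc m) t x - kern (Suc m) t *\<^sub>R x) \<le> \<epsilon> * kern (Suc m) t"
    by (rule step[OF 1])
qed

lemma kern_pos:
  assumes a0: "AE s in lborel. 0 < s \<and> s \<le> L \<longrightarrow> 0 < a s" and k0: "\<And>s. 0 < s \<Longrightarrow> s \<le> L \<Longrightarrow> 0 < k s"
  shows "AE s in lborel. 0 < s \<and> s \<le> L \<longrightarrow> 0 < kern m s"
    "0 < t \<Longrightarrow> t \<le> L \<Longrightarrow> pconv_finite k (pconv a (kern m)) t \<Longrightarrow> 0 < kern (Suc m) t"
proof -
  have conv_pos: "0 < pconv f g t" if "AE s in lborel. 0 < s \<and> s \<le> L \<longrightarrow> 0 < f s"
    "AE s in lborel. 0 < s \<and> s \<le> L \<longrightarrow> 0 < g s" "kernel f" "kernel g" "0 < t" "t \<le> L" "pconv_finite f g t" for f g t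
  proof -
    have "0 < nconv (\<lambda>s. ennreal (f s)) (\<lambda>s. ennreal (g s)) t"
      by (rule nconv_pos[of L]) (use that kernelD(5) in \<open>auto simp: ennreal_less_zero_iff\<close>)
    then show ?thesis using that(7) by (simp add: pconv_def enn2real_positive_iff)
  qed
  have conv_pos_AE: "AE t in lborel. 0 < t \<and> t \<le> L \<longrightarrow> 0 < pconv f g t"
    if "AE s in lborel. 0 < s \<and> s \<le> L \<longrightarrow> 0 < f s"
    "AE s in lborel. 0 < s \<and> s \<le> L \<longrightarrow> 0 < g s" "kernel f" "kernel g" for f g
    using pconv_kernel(3)[OF that(3,4)] by eventually_elim (use conv_pos[OF that] in blast)
  have k0': "AE s in lborel. 0 < s \<and> s \<le> L \<longrightarrow> 0 < k s" using k0 by simp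
  show 1: "AE s in lborel. 0 < s \<and> s \<le> L \<longrightarrow> 0 < kern m s" for m
  proof (induction m)
    case 0 then show ?case using k0' by simp
  next
    case (Suc m)
    show ?case unfolding kern.simps
      by (intro conv_pos_AE a0 k0' Suc k a kernel_kern pconv_kernel(1))
  qed
  show "0 < kern (Suc m) t" if "0 < t" "t \<le> L" "pconv_finite k (pconv a (kern m)) t"
    unfolding kern.simps
    by (intro conv_pos conv_pos_AE a0 k0' 1 k a kernel_kern pconv_kernel(1) that)
qed

end

section \<open>Comparison with the recursive definition\<close>

lemma vint_eq_integral_Icc:
  assumes f: "vintegrable lborel f" and ae: "AE s in lborel. f s = (if s \<in> {0..c} then g s else 0)"
  shows "g integrable_on {0..c}" "integral {0..c} g = vint f"
  using vint_eq_integral_AE[OF f ae] by (simp_all only: integrable_restrict_UNIV integral_restrict_UNIV)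

text \<open>Both sides are \<open>0\<close> where the convolution is infinite.\<close>

lemma convolution_eq_pconv:
  fixes f' g' :: "real \<Rightarrow> real"
  assumes f: "kernel f" and g: "kernel g"
    and eq: "AE s in lborel. 0 < s \<and> s < t \<longrightarrow> f' (t - s) * g' s = f (t - s) * g s"
  shows "convolution f' g' t = pconv f g t"
proof -
  note [measurable] = kernelD(1)[OF f] kernelD(1)[OF g]
  define h where "h s = f (t - s) * g s" for s
  have [measurable]: "h \<in> borel_measurable borel" unfolding h_def by measurable
  have h0: "0 \<le> h s" for s using kernelD(2)[OF f] kernelD(2)[OF g] by (simp add: h_def)
  have p: "pconv f g t = (\<integral>s. h s \<partial>lborel)"
    using integral_conv_eq[OF f g, of t 0] by (simp add: h_def)
  have ae: "AE s in lborel. h s = (if s \<in> {0..t} then f' (t - s) *\<^sub>R g' s else 0)"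
    using eq AE_lborel_singleton[of 0] AE_lborel_singleton[of t]
  proof eventually_elim
    case (elim s)
    then show ?case using kernelD(3)[OF f, of "t - s"] kernelD(3)[OF g, of s]
      by (cases "0 < s"; cases "s < t") (auto simp: h_def)
  qed
  show ?thesis
  proof (cases "integrable lborel h")
    case True
    then have v: "vintegrable lborel h"
      by (auto simp: vintegrable_def intro!: strongly_measurable_of_borel)
    show ?thesis
      unfolding convolution_def vint_eq_integral_Icc(2)[OF v ae] vint_eq[OF v] p by (rule integral_lborel[OF True])
  next
    case False
    \<comment> \<open>A nonnegative gauge integrable function is Lebesgue integrable. So if h is
      not, the gauge integral does not exist either and takes its default 0.\<close>
    have "\<not> (\<lambda>s. f' (t - s) *\<^sub>R g' s) integrable_on {0..t}"
    proof
      assume "(\<lambda>s. f' (t - s) *\<^sub>R g' s) integrable_on {0..t}"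
      then have "(\<lambda>s. if s \<in> {0..t} then f' (t - s) *\<^sub>R g' s else 0) integrable_on UNIV"
        by (simp only: integrable_restrict_UNIV)
      then have "h integrable_on UNIV"
        by (rule integrable_spike[OF _ negligible_AE_lborel[OF ae]]) auto
      then have "h absolutely_integrable_on UNIV"
        using h0 by (intro nonnegative_absolutely_integrable_1) auto
      then have "integrable lebesgue h" by (simp add: set_integrable_def)
      then have "integrable lborel h" by (subst (asm) integrable_completion) auto
      with False show False ..
    qed
    then show ?thesis using False
      by (simp add: convolution_def p not_integrable_integral not_integrable_integral_eq)
  qed
qed

lemma convolution_eq_volterra:
  fixes H' :: "real \<Rightarrow> 'a \<Rightarrow> 'a::complex_banach"
  assumes A: "closed_operator D A" and H: "op_family D A C \<kappa> H" and f: "kernel f" and \<kappa>: "kernel \<kappa>"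
    and fin: "pconv_finite f \<kappa> t"
    and eq: "AE s in lborel. 0 < s \<and> s < t \<longrightarrow> f' (t - s) *\<^sub>R h s = f (t - s) *\<^sub>R H s x"
  shows "convolution f' h t = volterra f \<kappa> H t x" "convolution_exists f' h t"
proof -
  have v: "vintegrable lborel (\<lambda>s. f (t - s) *\<^sub>R H s x)" by (rule volterra_vintegrable[OF A H f \<kappa> fin])
  have ae: "AE s in lborel. f (t - s) *\<^sub>R H s x = (if s \<in> {0..t} then f' (t - s) *\<^sub>R h s else 0)"
    using eq AE_lborel_singleton[of 0] AE_lborel_singleton[of t]
  proof eventually_elim
    case (elim s)
    then show ?case using kernelD(3)[OF f, of "t - s"] op_family_zero[OF H kernelD(3)[OF \<kappa>], of s x]
      by (cases "0 < s"; cases "s < t") auto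
  qed
  have vn: "vintegrable lborel (\<lambda>s. norm (f (t - s) *\<^sub>R H s x))"
    using v by (auto simp: vintegrable_def intro!: strongly_measurable_of_borel)
  have aen: "AE s in lborel. norm (f (t - s) *\<^sub>R H s x) = (if s \<in> {0..t} then norm (f' (t - s) *\<^sub>R h s) else 0)"
    using ae by eventually_elim auto
  show "convolution f' h t = volterra f \<kappa> H t x"
    unfolding convolution_def vint_eq_integral_Icc(2)[OF v ae] by (rule volterra_eq_vint[OF f \<kappa> fin, symmetric])
  show "convolution_exists f' h t"
    unfolding convolution_exists_def
    using vint_eq_integral_Icc(1)[OF v ae] vint_eq_integral_Icc(1)[OF vn aen] by blast
qed

text \<open>Primed names stand for the given data, plain names for their extensions by 0.
  \<open>a'\<close> is merely Lebesgue measurable, so a Borel version agrees with it only almost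
  everywhere; \<open>k'\<close> and \<open>S'\<close> are matched at every point of (0,L] and
  (0,T].\<close>

locale recursion_setting = resolvent_setting a k D A S CS
  for a k :: "real \<Rightarrow> real" and D :: "'a::complex_banach set" and A S CS +
  fixes a' k' :: "real \<Rightarrow> real" and S' :: "real \<Rightarrow> 'a \<Rightarrow> 'a" and T L :: real
  assumes a': "AE s in lborel. 0 < s \<and> s \<le> L \<longrightarrow> a' s = a s"
    and k': "\<And>s. 0 < s \<Longrightarrow> s \<le> L \<Longrightarrow> k' s = k s"
    and S': "\<And>s. 0 < s \<Longrightarrow> s \<le> T \<Longrightarrow> S' s = S s" and Tpos: "0 < T"
begin

text \<open>Equality holds even where a convolution diverges, because the defaults of
  \<open>integral\<close> and \<open>pconv\<close> coincide. Thereby continuity of the given kernel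
  passes to \<open>kern\<close>.\<close>

lemma convolution_power_eq_kern:
  assumes t: "0 < t" "t \<le> L"
  shows "convolution_power (convolution k' a') m k' t = kern m t"
  using t
proof (induction m arbitrary: t)
  case 0 then show ?case using k' by (simp add: convolution_power_def)
next
  case (Suc m)
  have ka: "convolution k' a' t = pconv k a t" if "0 < t" "t \<le> L" for t
    by (rule convolution_eq_pconv[OF k a])
       (use a' in eventually_elim, use that k' in simp)
  have "convolution_power (convolution k' a') (Suc m) k' t
      = convolution (convolution k' a') (convolution_power (convolution k' a') m k') t"
    by (simp add: convolution_power_def)
  also have "\<dots> = pconv (pconv k a) (kern m) t"
    by (rule convolution_eq_pconv[OF pconv_kernel(1)[OF k a] kernel_kern])
       (use Suc ka in simp)
  also have "\<dots> = kern (Suc m) t"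
    using kernelD(5)[OF k] kernelD(5)[OF a] kernelD(5)[OF kernel_kern[of m]]
    by (simp add: pconv_def[of "pconv k a"] pconv_def[of k "pconv a _"]
        nconv_pconv_left[OF k a] nconv_pconv_right[OF a kernel_kern] nconv_assoc)
  finally show ?case .
qed

text \<open>The terms of \<open>extension_split\<close> are matched one by one with those of the
  recursion. For t \<le> b only the middle term survives, since S and a*S vanish at nonpositive
  times.\<close>

lemma extended_family_eq_fam:
  assumes ae: "AE u in lborel. 0 < u \<and> u \<le> real (Suc m) * T \<longrightarrow> (\<forall>x. extended_family a' k' S' T m u x = fam T m u x)"
    and t: "0 < t" "t \<le> real (Suc (Suc m)) * T" "t \<le> L"
    and fin: "pconv_finite k (pconv a (kern m)) t"
  shows "extended_family a' k' S' T (Suc m) t x = fam T (Suc m) t x"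
proof -
  define b where "b = real (Suc m) * T"
  define R where "R = fam T m"
  define R' where "R' = extended_family a' k' S' T m"
  define \<kappa> where "\<kappa> = kern m"
  have \<kappa>: "kernel \<kappa>" unfolding \<kappa>_def by (rule kernel_kern)
  have q: "kernel (pconv a \<kappa>)" by (rule pconv_kernel(1)[OF a \<kappa>])
  obtain C where R: "op_family D A C \<kappa> R" unfolding \<kappa>_def R_def using op_family_fam by blast
  note fin = fin[folded \<kappa>_def]
  have b0: "0 < b" using Tpos by (simp add: b_def)
  have tb: "t - b \<le> T" using t(2) by (simp add: b_def algebra_simps)
  have aeR: "AE u in lborel. 0 < u \<and> u \<le> b \<longrightarrow> (\<forall>x. R' u x = R u x)"
    using ae by (simp add: b_def R_def R'_def)
  have aet: "AE s in lborel. 0 < r - s \<and> r - s \<le> L \<longrightarrow> a' (r - s) = a (r - s)" for r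
    using AE_reflect[OF a', of r] .
  have convR: "convolution a' (\<lambda>s. R' s x) r = volterra a \<kappa> R r x"
    if "0 < r" "r \<le> b" "r \<le> L" "pconv_finite a \<kappa> r" for r
  proof (rule convolution_eq_volterra(1)[OF A R a \<kappa> that(4)])
    show "AE s in lborel. 0 < s \<and> s < r \<longrightarrow> a' (r - s) *\<^sub>R R' s x = a (r - s) *\<^sub>R R s x"
      using aeR aet[of r] by eventually_elim (use that in auto)
  qed
  have convS: "convolution a' (\<lambda>s. S' s x) r = volterra a k S r x"
    if "0 < r" "r \<le> T" "r \<le> L" "pconv_finite a k r" for r
  proof (rule convolution_eq_volterra(1)[OF A S a k that(4)])
    show "AE s in lborel. 0 < s \<and> s < r \<longrightarrow> a' (r - s) *\<^sub>R S' s x = a (r - s) *\<^sub>R S s x"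
      using aet[of r] by eventually_elim (use that S' in auto)
  qed
  let ?T1 = "\<lambda>u. if u \<le> b then vint (\<lambda>v. if v \<le> t - b then a (t - u - v) *\<^sub>R R u (S v x) else 0) else 0"
  let ?T2 = "\<lambda>r. if r < b then k (t - r) *\<^sub>R volterra a \<kappa> R r x else 0"
  let ?T3 = "\<lambda>r. if r \<le> t - b then \<kappa> (t - r) *\<^sub>R volterra a k S r x else 0"
  note split = extension_split[OF R \<kappa> fin, of b x]
  have S0: "S v y = 0" if "v \<le> 0" for v y by (rule op_family_zero[OF S kernelD(3)[OF k that]])
  have R0: "R u y = 0" if "u \<le> 0" for u y by (rule op_family_zero[OF R kernelD(3)[OF \<kappa> that]])
  have Rlin0: "R u 0 = 0" for u by (rule linear_0[OF bounded_linear.linear[OF op_familyD(3)[OF R]]])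
  have V0: "volterra a k S r x = 0" if "r \<le> 0" for r
    by (rule op_family_zero[OF op_family_volterra[OF A S k a] kernelD(3)[OF pconv_kernel(1)[OF a k] that]])
  have VR0: "volterra a \<kappa> R r x = 0" if "r \<le> 0" for r
    by (rule op_family_zero[OF op_family_volterra[OF A R \<kappa> a] kernelD(3)[OF q that]])
  \<comment> \<open>The upper limit min t b serves both branches of the recursion, as k(t-r) = 0
    beyond t.\<close>
  have T2: "vint ?T2 = integral {0..c} (\<lambda>r. k' (t - r) *\<^sub>R convolution a' (\<lambda>s. R' s x) r)"
    if c: "c = min t b" for c
  proof (rule vint_eq_integral_Icc(2)[OF split(3), symmetric])
    show "AE r in lborel. ?T2 r = (if r \<in> {0..c} then k' (t - r) *\<^sub>R convolution a' (\<lambda>s. R' s x) r else 0)"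
      using pconv_kernel(3)[OF a \<kappa>] AE_lborel_singleton[of 0] AE_lborel_singleton[of b] AE_lborel_singleton[of t]
    proof eventually_elim
      case (elim r)
      consider "r < 0" | "0 < r" "r < c" | "c < r" using elim c by (auto simp: min_def split: if_splits) linarith+
      then show ?case
      proof cases
        case 1 then show ?thesis using VR0[of r] by simp
      next
        case 2
        then have "convolution a' (\<lambda>s. R' s x) r = volterra a \<kappa> R r x"
          using c t by (intro convR elim) auto
        moreover have "k' (t - r) = k (t - r)" using 2 c t by (intro k') auto
        ultimately show ?thesis using 2 c by simp
      next
        case 3
        then show ?thesis using c kernelD(3)[OF k, of "t - r"] by (auto simp: min_def split: if_splits)
      qed
    qed
  qed
  have ext: "fam T (Suc m) t x = vint ?T1 + vint ?T2 + vint ?T3"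
    using split(1) by (simp add: b_def R_def \<kappa>_def)
  show ?thesis
  proof (cases "t \<le> b")
    case True
    have "?T1 = (\<lambda>u. 0)"
    proof
      fix u
      have "(\<lambda>v. if v \<le> t - b then a (t - u - v) *\<^sub>R R u (S v x) else 0) = (\<lambda>v. 0)"
        using True S0 Rlin0 by auto
      then show "?T1 u = 0" by (simp only: vint_zero if_cancel)
    qed
    moreover have "?T3 = (\<lambda>r. 0)" using True V0 by auto
    ultimately have "fam T (Suc m) t x = vint ?T2" using ext by (simp only: vint_zero add_0 add_0_right)
    also have "\<dots> = convolution k' (convolution a' (\<lambda>s. R' s x)) t"
      unfolding convolution_def[of k'] by (rule T2) (use True in simp)
    also have "\<dots> = extended_family a' k' S' T (Suc m) t x"
      using True by (simp add: Let_def b_def R'_def)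
    finally show ?thesis by simp
  next
    case False
    have T3: "vint ?T3 = integral {0..t - b} (\<lambda>r. convolution_power (convolution k' a') m k' (t - r) *\<^sub>R convolution a' (\<lambda>s. S' s x) r)"
    proof (rule vint_eq_integral_Icc(2)[OF split(4), symmetric])
      show "AE r in lborel. ?T3 r = (if r \<in> {0..t - b} then
          convolution_power (convolution k' a') m k' (t - r) *\<^sub>R convolution a' (\<lambda>s. S' s x) r else 0)"
        using pconv_kernel(3)[OF a k] AE_lborel_singleton[of 0]
      proof eventually_elim
        case (elim r)
        show ?case
        proof (cases "0 < r \<and> r \<le> t - b")
          case True
          then have "convolution a' (\<lambda>s. S' s x) r = volterra a k S r x"
            using tb t b0 by (intro convS elim) auto
          moreover have "convolution_power (convolution k' a') m k' (t - r) = \<kappa> (t - r)"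
            unfolding \<kappa>_def by (rule convolution_power_eq_kern) (use True t b0 in auto)
          ultimately show ?thesis using True by simp
        next
          case False then show ?thesis using V0[of r] elim by auto
        qed
      qed
    qed
    have T1: "vint ?T1 = convolution2 (\<lambda>t s. a' (t + s)) (\<lambda>u v. R' u (S' v x)) b (t - b)"
      unfolding convolution2_def
    proof (rule vint_eq_integral_Icc(2)[OF split(2), symmetric])
      show "AE u in lborel. ?T1 u = (if u \<in> {0..b} then
          integral {0..t - b} (\<lambda>v. a' (b - u + (t - b - v)) *\<^sub>R R' u (S' v x)) else 0)"
        using aeR split(5) AE_lborel_singleton[of 0]
      proof eventually_elim
        case (elim u)
        show ?case
        proof (cases "0 < u \<and> u \<le> b")
          case True
          let ?f = "\<lambda>v. if v \<le> t - b then a (t - u - v) *\<^sub>R R u (S v x) else 0"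
          have "AE v in lborel. ?f v = (if v \<in> {0..t - b} then a' (b - u + (t - b - v)) *\<^sub>R R' u (S' v x) else 0)"
            using aet[of "t - u"] AE_lborel_singleton[of 0] AE_lborel_singleton[of "t - u"]
          proof eventually_elim
            case (elim v)
            show ?case
            proof (cases "0 < v \<and> v \<le> t - b")
              case v: True
              have "a' (t - u - v) = a (t - u - v)"
              proof -
                \<comment> \<open>From u \<le> b and v \<le> t - b follows u + v \<le> t; equality
                  has been removed as the single point v = t - u.\<close>
                have "0 < t - u - v" using v True elim by linarith
                moreover have "t - u - v \<le> L" using v True t(3) by linarith
                ultimately show ?thesis using elim(1) by blast
              qed
              moreover have "S' v = S v" using v tb by (intro S') auto
              moreover have "R' u y = R u y" for y using True \<open>0 < u \<and> u \<le> b \<longrightarrow> (\<forall>x. R' u x = R u x)\<close> by blast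
              moreover have e: "b - u + (t - b - v) = t - u - v" by simp
              ultimately show ?thesis unfolding e using v by simp
            next
              case v: False
              then show ?thesis using S0[of v x] Rlin0 elim(2) by auto
            qed
          qed
          from vint_eq_integral_Icc(2)[OF _ this] elim(2) True show ?thesis by simp
        next
          case False
          then consider "u < 0" | "b < u" using elim by linarith
          then show ?thesis
          proof cases
            case 1
            then have "(\<lambda>v. if v \<le> t - b then a (t - u - v) *\<^sub>R R u (S v x) else 0) = (\<lambda>v. 0)"
              using R0 by auto
            then have "vint (\<lambda>v. if v \<le> t - b then a (t - u - v) *\<^sub>R R u (S v x) else 0) = 0"
              by (simp only: vint_zero)
            then show ?thesis using 1 by simp
          next
            case 2 then show ?thesis by simp
          qed
        qed
      qed
    qed
    have "extended_family a' k' S' T (Suc m) t x = vint ?T1 + vint ?T2 + vint ?T3"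
      unfolding T1 T3 T2[OF refl] using False
      by (simp add: Let_def b_def R'_def min_def)
    then show ?thesis using ext by simp
  qed
qed

lemma extended_family_eq_fam_AE:
  assumes L: "real (Suc m) * T \<le> L"
  shows "AE u in lborel. 0 < u \<and> u \<le> real (Suc m) * T \<longrightarrow> (\<forall>x. extended_family a' k' S' T m u x = fam T m u x)"
  using L
proof (induction m)
  case 0 then show ?case using S' by simp
next
  case (Suc m)
  have "real (Suc m) * T \<le> real (Suc (Suc m)) * T" using Tpos by simp
  then have IH: "AE u in lborel. 0 < u \<and> u \<le> real (Suc m) * T \<longrightarrow> (\<forall>x. extended_family a' k' S' T m u x = fam T m u x)"
    using Suc by linarith
  show ?case
    using pconv_kernel(3)[OF k pconv_kernel(1)[OF a kernel_kern[of m]]]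
  proof eventually_elim
    case (elim u)
    show ?case
      using extended_family_eq_fam[OF IH _ _ _ elim] Suc.prems by auto
  qed
qed

end

section \<open>From the given data to kernels on the line\<close>

text \<open>A Lebesgue measurable function has a Borel version up to a null set. Taking the positive
  part and cutting off outside (0,L] restores sign and support; on (0,L] this changes nothing almost
  everywhere because f is positive there.\<close>

lemma borel_kernel_exists:
  fixes f :: "real \<Rightarrow> real"
  assumes f: "f absolutely_integrable_on {0..L}" and pos: "\<And>s. 0 < s \<Longrightarrow> s \<le> L \<Longrightarrow> 0 < f s"
  obtains g where "kernel g" "AE s in lborel. 0 < s \<and> s \<le> L \<longrightarrow> f s = g s"
proof -
  define f0 where "f0 s = indicat_real {0..L} s *\<^sub>R f s" for s
  have i0: "integrable lebesgue f0" using f by (simp add: set_integrable_def f0_def[abs_def])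
  then have "f0 \<in> borel_measurable (completion lborel)" by (rule borel_measurable_integrable)
  then obtain g where g: "g \<in> borel_measurable lborel" and ae: "AE s in lborel. f0 s = g s"
    using completion_ex_borel_measurable_real by blast
  have [measurable]: "g \<in> borel_measurable borel" using g by simp
  have "integrable lebesgue g"
    by (rule integrable_cong_AE_imp[OF i0]) (use g AE_completion[OF ae] in \<open>auto intro: measurable_completion\<close>)
  then have ig: "integrable lborel g" by (subst (asm) integrable_completion) auto
  define h where "h s = (if 0 < s \<and> s \<le> L then max 0 (g s) else 0)" for s
  have "kernel h" unfolding kernel_def
  proof (intro conjI allI impI)
    show m: "h \<in> borel_measurable borel" unfolding h_def by measurable
    show "integrable lborel h"
      by (rule Bochner_Integration.integrable_bound[OF ig]) (use m in \<open>auto simp: h_def\<close>)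
  qed (auto simp: h_def)
  moreover have "AE s in lborel. 0 < s \<and> s \<le> L \<longrightarrow> f s = h s"
    using ae by eventually_elim (use pos in \<open>force simp: h_def f0_def\<close>)
  ultimately show ?thesis by (rule that)
qed

lemma continuous_kernel:
  fixes f :: "real \<Rightarrow> real"
  assumes f: "f absolutely_integrable_on {0..L}" and pos: "\<And>s. 0 < s \<Longrightarrow> s \<le> L \<Longrightarrow> 0 < f s"
    and c: "continuous_on {0<..L} f"
  shows "kernel (\<lambda>s. if 0 < s \<and> s \<le> L then f s else 0)"
  unfolding kernel_def
proof (intro conjI allI impI)
  have "(\<lambda>s. indicat_real {0<..L} s *\<^sub>R f s) \<in> borel_measurable borel"
    by (rule borel_measurable_continuous_on_indicator[OF _ c]) simp
  moreover have eq: "(\<lambda>s. indicat_real {0<..L} s *\<^sub>R f s) = (\<lambda>s. if 0 < s \<and> s \<le> L then f s else 0)"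
    by (auto simp: indicator_def)
  ultimately show m: "(\<lambda>s. if 0 < s \<and> s \<le> L then f s else 0) \<in> borel_measurable borel" by simp
  have "f absolutely_integrable_on {0<..L}"
    by (rule set_integrable_subset[OF f]) auto
  then have "integrable lebesgue (\<lambda>s. if 0 < s \<and> s \<le> L then f s else 0)"
    unfolding set_integrable_def eq .
  then show "integrable lborel (\<lambda>s. if 0 < s \<and> s \<le> L then f s else 0)"
    by (subst (asm) integrable_completion) (use m in auto)
qed (use pos less_imp_le in auto)

lemma resolvent_familyD:
  assumes "regularized_resolvent_family J a k D A S"
  shows "closed_operator D A" "continuous_on J k" "continuous_on J (\<lambda>t. S t x)"
    "((\<lambda>t. (1 / k t) *\<^sub>R S t x) \<longlongrightarrow> x) (at_right 0)"
    "t \<in> J \<Longrightarrow> bounded_clinear (S t)"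
    "t \<in> J \<Longrightarrow> y \<in> D \<Longrightarrow> S t y \<in> D" "t \<in> J \<Longrightarrow> y \<in> D \<Longrightarrow> A (S t y) = S t (A y)"
    "t \<in> J \<Longrightarrow> convolution_exists a (\<lambda>s. S s x) t"
    "t \<in> J \<Longrightarrow> convolution a (\<lambda>s. S s x) t \<in> D"
    "t \<in> J \<Longrightarrow> A (convolution a (\<lambda>s. S s x) t) = S t x - k t *\<^sub>R x"
  using assms unfolding regularized_resolvent_family_def by blast+

text \<open>Each orbit of S t / k t is bounded: near 0 because it converges, on the remaining
  compact interval by continuity. Uniform boundedness then gives one constant, and the maximum with
  1 meets the requirement of \<open>op_family\<close>.\<close>

lemma resolvent_family_bound:
  assumes S: "regularized_resolvent_family J a k D A S" and J: "{0<..T} \<subseteq> J" and k: "\<And>t. t \<in> {0<..T} \<Longrightarrow> 0 < k t"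
  obtains C where "1 \<le> C" "\<And>t x. t \<in> {0<..T} \<Longrightarrow> norm (S t x) \<le> C * k t * norm x"
proof -
  have lin: "bounded_linear (\<lambda>x. (1 / k t) *\<^sub>R S t x)" if "t \<in> {0<..T}" for t
  proof -
    have "bounded_linear (S t)"
      using resolvent_familyD(5)[OF S subsetD[OF J that]] by (simp add: bounded_clinear_def)
    then show ?thesis by (rule bounded_linear_compose[OF bounded_linear_scaleR_right])
  qed
  have bdd: "\<exists>M. \<forall>t\<in>{0<..T}. norm ((1 / k t) *\<^sub>R S t x) \<le> M" for x
  proof -
    have "((\<lambda>t. (1 / k t) *\<^sub>R S t x) \<longlongrightarrow> x) (at_right 0)" by (rule resolvent_familyD(4)[OF S])
    then have "\<forall>\<^sub>F t in at_right 0. norm ((1 / k t) *\<^sub>R S t x) < norm x + 1"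
      by (intro order_tendstoD(2)[OF tendsto_norm]) auto
    then obtain d where d: "d > 0" "\<And>t. 0 < t \<Longrightarrow> t < d \<Longrightarrow> norm ((1 / k t) *\<^sub>R S t x) < norm x + 1"
      unfolding eventually_at_right_field by auto
    have "continuous_on {d/2..T} (\<lambda>t. (1 / k t) *\<^sub>R S t x)"
    proof (intro continuous_intros)
      have sub: "{d/2..T} \<subseteq> J" using J d(1) by auto
      show "continuous_on {d/2..T} k" "continuous_on {d/2..T} (\<lambda>t. S t x)"
        using resolvent_familyD(2,3)[OF S] sub by (auto intro: continuous_on_subset)
      show "\<forall>t\<in>{d/2..T}. k t \<noteq> 0"
      proof
        fix t assume "t \<in> {d/2..T}"
        then show "k t \<noteq> 0" using k[of t] d(1) by auto
      qed
    qed
    then have "bounded ((\<lambda>t. (1 / k t) *\<^sub>R S t x) ` {d/2..T})"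
      by (intro compact_imp_bounded compact_continuous_image) auto
    then obtain M where M: "\<And>t. t \<in> {d/2..T} \<Longrightarrow> norm ((1 / k t) *\<^sub>R S t x) \<le> M"
      unfolding bounded_iff by blast
    have "norm ((1 / k t) *\<^sub>R S t x) \<le> max M (norm x + 1)" if "t \<in> {0<..T}" for t
    proof (cases "t < d")
      case True then show ?thesis using d(2)[of t] that by simp
    next
      case False
      then have "t \<in> {d/2..T}" using that d(1) by auto
      then show ?thesis using M[of t] by simp
    qed
    then show ?thesis by blast
  qed
  obtain C where C: "C \<ge> 0" "\<And>t x. t \<in> {0<..T} \<Longrightarrow> norm ((1 / k t) *\<^sub>R S t x) \<le> C * norm x"
    using uniform_boundedness[of "{0<..T}" "\<lambda>t x. (1 / k t) *\<^sub>R S t x", OF lin bdd] by blast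
  show thesis
  proof (rule that[of "max 1 C"])
    fix t x assume t: "t \<in> {0<..T}"
    have k0: "0 < k t" by (rule k[OF t])
    have "norm (S t x) = k t * norm ((1 / k t) *\<^sub>R S t x)" using k0 by simp
    also have "\<dots> \<le> k t * (max 1 C * norm x)"
      using k0 C(2)[OF t, of x] mult_right_mono[of C "max 1 C" "norm x"] by (intro mult_left_mono) auto
    finally show "norm (S t x) \<le> max 1 C * k t * norm x" by (simp add: mult_ac)
  qed simp
qed

lemma setting_exists:
  fixes S' :: "real \<Rightarrow> 'a::complex_banach \<Rightarrow> 'a"
  assumes aint: "a' absolutely_integrable_on {0..L}" and kint: "k' absolutely_integrable_on {0..L}"
    and apos: "\<And>s. 0 < s \<Longrightarrow> s \<le> L \<Longrightarrow> 0 < a' s" and kpos: "\<And>s. 0 < s \<Longrightarrow> s \<le> L \<Longrightarrow> 0 < k' s"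
    and kc: "continuous_on {0<..L} k'"
    and S': "regularized_resolvent_family J a' k' D A S'" and J: "{0<..T} \<subseteq> J" and T: "0 < T" "T \<le> L"
  obtains a k S C where "recursion_setting a k D A S C a' k' S' T L" "resolvent_on a D A T k S"
    "\<And>x. continuous_on {0<..T} (\<lambda>v. S v x)"
    "\<And>x \<epsilon>. 0 < \<epsilon> \<Longrightarrow> \<exists>\<delta>>0. AE u in lborel. u < \<delta> \<longrightarrow> norm (S u x - k u *\<^sub>R x) \<le> \<epsilon> * k u"
proof -
  obtain a where a: "kernel a" and ae: "AE s in lborel. 0 < s \<and> s \<le> L \<longrightarrow> a' s = a s"
    using borel_kernel_exists[OF aint apos] by blast
  define k where "k s = (if 0 < s \<and> s \<le> L then k' s else 0)" for s
  have k: "kernel k" unfolding k_def by (rule continuous_kernel[OF kint kpos kc])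
  \<comment> \<open>The kernels reach up to \<open>L\<close> but the family only up to
    \<open>T\<close>. This suffices: for t \<le> b + T the extension evaluates S at times t - r with
    r \<ge> b.\<close>
  define S where "S v x = (if 0 < v \<and> v \<le> T then S' v x else 0)" for v x
  have S_eq: "S v = S' v" if "0 < v" "v \<le> T" for v using that by (simp add: S_def fun_eq_iff)
  have k_eq: "k v = k' v" if "0 < v" "v \<le> L" for v using that by (simp add: k_def)
  have A: "closed_operator D A" by (rule resolvent_familyD(1)[OF S'])
  obtain C where C: "1 \<le> C" "\<And>t x. t \<in> {0<..T} \<Longrightarrow> norm (S' t x) \<le> C * k' t * norm x"
  proof (rule resolvent_family_bound[OF S' J])
    show "0 < k' t" if "t \<in> {0<..T}" for t using that T by (intro kpos) auto
  qed (rule that)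
  have Sc': "continuous_on {0<..T} (\<lambda>t. S' t x)" for x
    by (rule continuous_on_subset[OF resolvent_familyD(3)[OF S'] J])
  have Sc: "continuous_on {0<..T} (\<lambda>v. S v x)" for x
    by (rule continuous_on_cong[THEN iffD1, OF refl _ Sc']) (simp add: S_def)
  have Sop: "op_family D A C k S"
    unfolding op_family_def
  proof (intro conjI allI ballI C(1))
    have "c *\<^sub>C (0::'a) = 0" for c
      by (rule linear_0[OF bounded_linear.linear[OF bounded_linear_scaleC]])
    then have z: "bounded_clinear (\<lambda>x::'a. 0::'a)" by (simp add: bounded_clinear_def)
    show "bounded_clinear (S u)" for u
    proof (cases "0 < u \<and> u \<le> T")
      case True then show ?thesis using resolvent_familyD(5)[OF S', of u] J S_eq[of u] by (auto simp: subset_iff)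
    next
      case False then have "S u = (\<lambda>x. 0)" by (auto simp: S_def)
      then show ?thesis using z by simp
    qed
    show "norm (S u x) \<le> C * k u * norm x" for u x
      using C(2)[of u x] C(1) T kernelD(2)[OF k, of u] by (auto simp: S_def k_def)
    show "strongly_measurable lborel (\<lambda>u. S u x)" for x
      using strongly_measurable_continuous_on[OF Sc'] unfolding S_def .
    fix u x assume x: "x \<in> D"
    show "S u x \<in> D" "A (S u x) = S u (A x)"
      using resolvent_familyD(6,7)[OF S' _ x, of u] J closed_operator_zero[OF A] by (auto simp: S_def subset_iff)
  qed
  have setting: "recursion_setting a k D A S C a' k' S' T L"
    by unfold_locales (fact a k A Sop ae k_eq[symmetric] S_eq[symmetric] T(1))+
  have res: "resolvent_on a D A T k S"
    unfolding resolvent_on_def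
    using pconv_kernel(3)[OF a k]
  proof eventually_elim
    case (elim r)
    show ?case
    proof (intro impI allI)
      fix x assume r: "r \<le> T"
      show "volterra a k S r x \<in> D \<and> A (volterra a k S r x) = S r x - k r *\<^sub>R x"
      proof (cases "0 < r")
        case False
        then have k0: "k r = 0" and p0: "pconv a k r = 0"
          using kernelD(3)[OF k] kernelD(3)[OF pconv_kernel(1)[OF a k]] by auto
        have "volterra a k S r x = 0" by (rule op_family_zero[OF op_family_volterra[OF A Sop k a] p0])
        then show ?thesis using closed_operator_zero[OF A] k0 op_family_zero[OF Sop k0] by simp
      next
        case True
        have "convolution a' (\<lambda>s. S' s x) r = volterra a k S r x"
        proof (rule convolution_eq_volterra(1)[OF A Sop a k elim])
          show "AE s in lborel. 0 < s \<and> s < r \<longrightarrow> a' (r - s) *\<^sub>R S' s x = a (r - s) *\<^sub>R S s x"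
            using AE_reflect[OF ae, of r] by eventually_elim (use r T in \<open>auto simp: S_def\<close>)
        qed
        moreover have "r \<in> J" using J True r by auto
        ultimately show ?thesis
          using resolvent_familyD(9,10)[OF S', of r x] True r T k_eq[of r] S_eq[of r] by simp
      qed
    qed
  qed
  have S0: "\<exists>\<delta>>0. AE u in lborel. u < \<delta> \<longrightarrow> norm (S u x - k u *\<^sub>R x) \<le> \<epsilon> * k u" if "0 < \<epsilon>" for x \<epsilon>
  proof -
    have "((\<lambda>t. (1 / k' t) *\<^sub>R S' t x) \<longlongrightarrow> x) (at_right 0)" by (rule resolvent_familyD(4)[OF S'])
    from tendstoD[OF this \<open>0 < \<epsilon>\<close>]
    obtain d where d: "d > 0" "\<And>t. 0 < t \<Longrightarrow> t < d \<Longrightarrow> dist ((1 / k' t) *\<^sub>R S' t x) x < \<epsilon>"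
      unfolding eventually_at_right_field by auto
    have "norm (S u x - k u *\<^sub>R x) \<le> \<epsilon> * k u" if u: "u < min d T" for u
    proof (cases "0 < u")
      case False then show ?thesis by (simp add: S_def k_def)
    next
      case True
      then have k0: "0 < k u" and Su: "S u x = S' u x" "k u = k' u" using u T kpos by (auto simp: S_def k_def)
      have "S u x - k u *\<^sub>R x = k u *\<^sub>R ((1 / k' u) *\<^sub>R S' u x - x)"
        using k0 Su by (simp add: scaleR_diff_right)
      then have "norm (S u x - k u *\<^sub>R x) = k u * dist ((1 / k' u) *\<^sub>R S' u x) x"
        using k0 by (simp add: dist_norm)
      also have "\<dots> \<le> k u * \<epsilon>" using d(2)[of u] True u k0 by (intro mult_left_mono) auto
      finally show ?thesis by (simp add: mult.commute)
    qed
    then show ?thesis using d(1) T by (intro exI[of _ "min d T"]) auto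
  qed
  show thesis
    by (rule that[OF setting res Sc S0])
qed

section \<open>Assembly for fixed T and on the whole interval\<close>

lemma time_interval_scale:
  assumes "0 < T" "ereal T < \<tau>" "0 < t" "t \<le> N * T" "0 < N"
  shows "t \<in> time_interval (ereal N * \<tau>)"
proof (cases \<tau>)
  case (real r)
  then have "N * T < N * r" using assms by simp
  with assms(4) have "t < N * r" by (rule le_less_trans)
  then show ?thesis using real assms by (simp add: time_interval_def)
next
  case PInf then show ?thesis using assms by (simp add: time_interval_def)
next
  case MInf then show ?thesis using assms by simp
qed

lemma time_interval_exhaust:
  assumes "t \<in> time_interval (ereal N * \<tau>)" "0 < N" "0 < \<tau>"
  shows "\<exists>T. 0 < T \<and> ereal T < \<tau> \<and> t < N * T"
proof (cases \<tau>)
  case (real r)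
  then have t: "0 < t" "t < N * r" using assms by (auto simp: time_interval_def)
  then have "t / N < r" using assms(2) by (simp add: field_simps)
  then obtain T where T: "t / N < T" "T < r" using dense by blast
  have "0 < t / N" using t assms(2) by simp
  then have "0 < T" using T(1) by (rule less_trans)
  moreover have "t < N * T" using T(1) assms(2) by (simp add: pos_divide_less_eq mult.commute)
  ultimately show ?thesis using real T(2) by auto
next
  case PInf
  have "0 < t" using assms by (simp add: time_interval_def)
  then show ?thesis using PInf assms(2)
    by (intro exI[of _ "t / N + 1"]) (simp add: distrib_left add_pos_pos)
next
  case MInf then show ?thesis using assms by simp
qed

lemma time_interval_subset: "ereal T < \<tau> \<Longrightarrow> {0<..T} \<subseteq> time_interval \<tau>"
  by (auto simp: time_interval_def intro: le_less_trans[of "ereal _" "ereal T"])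

lemma kernel_absolutely_integrable:
  fixes f :: "real \<Rightarrow> real"
  assumes g: "kernel g" and eq: "\<And>s. 0 < s \<Longrightarrow> s \<le> t \<Longrightarrow> f s = g s"
  shows "f absolutely_integrable_on {0..t}"
proof -
  have "integrable lborel g" by (rule kernelD(4)[OF g])
  then have "integrable lebesgue g"
    using integrable_completion[of g lborel] kernelD(1)[OF g] by simp
  then have "g absolutely_integrable_on UNIV" by (simp add: set_integrable_def)
  then have "g absolutely_integrable_on {0..t}" by (rule set_integrable_subset) auto
  then show ?thesis
    by (rule absolutely_integrable_spike[of _ _ "{0}"]) (use eq in auto)
qed

declare extended_family.simps(2) [simp del]

text \<open>The truncated data for one T, with the kernels cut off at the final length (m+2)T.
  Continuity of the last kernel is recorded here for \<open>kern\<close>, to which finiteness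
  applies.\<close>

locale continuous_recursion = recursion_setting a k D A S CS a0 k0 S1 T "real (Suc (Suc m)) * T"
  for a k :: "real \<Rightarrow> real" and D :: "'a::complex_banach set" and A S CS a0 k0 S1 T and m :: nat +
  assumes res: "resolvent_on a D A T k S"
    and Sc: "\<And>x. continuous_on {0<..T} (\<lambda>v. S v x)"
    and S0: "\<And>x \<epsilon>. 0 < \<epsilon> \<Longrightarrow> \<exists>\<delta>>0. AE u in lborel. u < \<delta> \<longrightarrow> norm (S u x - k u *\<^sub>R x) \<le> \<epsilon> * k u"
    and kcont: "continuous_on {0<..real (Suc (Suc m)) * T} k"
    and kern_cont: "continuous_on {0<..real (Suc (Suc m)) * T} (kern (Suc m))"
begin

lemma fin: "0 < t \<Longrightarrow> t \<le> real (Suc (Suc m)) * T \<Longrightarrow> pconv_finite k (pconv a (kern m)) t"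
  by (rule pconv_finite_of_continuous[OF k pconv_kernel(1)[OF a kernel_kern] kcont kern_cont[unfolded kern.simps]])

end

locale extension_problem =
  fixes a0 k0 :: "real \<Rightarrow> real" and D :: "'a::complex_banach set" and A :: "'a \<Rightarrow> 'a"
    and S1 :: "real \<Rightarrow> 'a \<Rightarrow> 'a" and m :: nat and \<tau> :: ereal
  assumes \<tau>: "0 < \<tau>"
    and aloc: "locally_integrable (time_interval (ereal (real (Suc (Suc m))) * \<tau>)) a0"
    and kloc: "locally_integrable (time_interval (ereal (real (Suc (Suc m))) * \<tau>)) k0"
    and apos: "\<forall>t\<in>time_interval (ereal (real (Suc (Suc m))) * \<tau>). 0 < a0 t"
    and kpos: "\<forall>t\<in>time_interval (ereal (real (Suc (Suc m))) * \<tau>). 0 < k0 t"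
    and kc: "continuous_on (time_interval (ereal (real (Suc (Suc m))) * \<tau>)) k0"
    and \<kappa>c: "continuous_on (time_interval (ereal (real (Suc (Suc m))) * \<tau>))
           (convolution_power (convolution k0 a0) (Suc m) k0)"
    and S1: "regularized_resolvent_family (time_interval \<tau>) a0 k0 D A S1"
begin

abbreviation \<kappa>0 :: "real \<Rightarrow> real" where
  "\<kappa>0 \<equiv> convolution_power (convolution k0 a0) (Suc m) k0"

lemma in_interval:
  assumes "0 < T" "ereal T < \<tau>" "0 < t" "t \<le> real (Suc (Suc m)) * T"
  shows "t \<in> time_interval (ereal (real (Suc (Suc m))) * \<tau>)"
  by (rule time_interval_scale[OF assms]) simp

lemma setting:
  assumes T: "0 < T" "ereal T < \<tau>"
  obtains a k S C where "continuous_recursion a k D A S C a0 k0 S1 T m"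
proof -
  define L where "L = real (Suc (Suc m)) * T"
  have sub: "{0<..L} \<subseteq> time_interval (ereal (real (Suc (Suc m))) * \<tau>)"
    using in_interval[OF T] by (auto simp: L_def)
  have L0: "0 < L" using T by (simp add: L_def)
  then have Lin: "L \<in> time_interval (ereal (real (Suc (Suc m))) * \<tau>)" using sub by auto
  have kc': "continuous_on {0<..L} k0" by (rule continuous_on_subset[OF kc sub])
  have TL: "T \<le> L" using T by (simp add: L_def)
  obtain a k S C where set: "recursion_setting a k D A S C a0 k0 S1 T L" and res: "resolvent_on a D A T k S"
    and Sc: "\<And>x. continuous_on {0<..T} (\<lambda>v. S v x)"
    and S0: "\<And>x \<epsilon>. 0 < \<epsilon> \<Longrightarrow> \<exists>\<delta>>0. AE u in lborel. u < \<delta> \<longrightarrow> norm (S u x - k u *\<^sub>R x) \<le> \<epsilon> * k u"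
  proof (rule setting_exists[OF _ _ _ _ kc' S1 time_interval_subset[OF T(2)] T(1) TL])
    show "a0 absolutely_integrable_on {0..L}" "k0 absolutely_integrable_on {0..L}"
      using aloc kloc Lin by (auto simp: locally_integrable_def)
    show "0 < a0 s" "0 < k0 s" if "0 < s" "s \<le> L" for s
      using apos kpos sub that by auto
  qed (rule that)
  interpret recursion_setting a k D A S C a0 k0 S1 T L by (rule set)
  have c: "continuous_on {0<..L} (kern (Suc m))"
    by (rule continuous_on_cong[THEN iffD1, OF refl _ continuous_on_subset[OF \<kappa>c sub]])
       (simp add: convolution_power_eq_kern del: kern.simps)
  have kc2: "continuous_on {0<..L} k"
    by (rule continuous_on_cong[THEN iffD1, OF refl _ kc']) (use k' in simp)
  have "continuous_recursion a k D A S C a0 k0 S1 T m"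
    using set res Sc S0 kc2 c unfolding continuous_recursion_def continuous_recursion_axioms_def L_def by blast
  then show thesis by (rule that)
qed

lemma extended_family_resolvent:
  assumes T: "0 < T" "ereal T < \<tau>"
  shows "regularized_resolvent_family {0<..real (Suc (Suc m)) * T} a0 \<kappa>0 D A (extended_family a0 k0 S1 T (Suc m))"
proof -
  define L where "L = real (Suc (Suc m)) * T"
  define U where "U = extended_family a0 k0 S1 T (Suc m)"
  have L0: "0 < L" using T by (simp add: L_def)
  have L_eq: "L = real (Suc m) * T + T" by (simp add: L_def algebra_simps)
  have sub: "{0<..L} \<subseteq> time_interval (ereal (real (Suc (Suc m))) * \<tau>)"
    using in_interval[OF T] by (auto simp: L_def)
  obtain a k S C where set: "continuous_recursion a k D A S C a0 k0 S1 T m" by (rule setting[OF T])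
  interpret continuous_recursion a k D A S C a0 k0 S1 T m by (rule set)
  note fin = fin[folded L_def] and aeq = a'[folded L_def] and keq = k'[folded L_def]
    and \<kappa>eq = convolution_power_eq_kern[folded L_def]
  have c: "continuous_on {0<..L} (pconv k (pconv a (kern m)))"
    using kern_cont by (simp only: L_def kern.simps)
  obtain C' where R: "op_family D A C' (kern m) (fam T m)" using op_family_fam by blast
  obtain C2 where U': "op_family D A C2 (kern (Suc m)) (fam T (Suc m))" using op_family_fam by blast
  have smL: "real (Suc m) * T \<le> L" using T by (simp add: L_def)
  have U_eq: "U t = fam T (Suc m) t" if "0 < t" "t \<le> L" for t
    unfolding U_def
    by (rule ext, rule extended_family_eq_fam[OF extended_family_eq_fam_AE[OF smL[unfolded L_def]] that(1) that(2)[unfolded L_def] that(2)[unfolded L_def] fin[OF that]])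
  \<comment> \<open>The resolvent equation is required at each t, so \<open>a\<close> convolved with
    the last kernel has to be finite at each t as well.\<close>
  have afin: "pconv_finite a (kern (Suc m)) t" if "0 < t" "t \<le> L" for t
    using pconv_kernel_finite[OF a k kernel_kern c fin that] by simp
  have pos0: "0 < a0 s" "0 < k0 s" if "0 < s" "s \<le> L" for s
    using apos[THEN bspec, OF subsetD[OF sub]] kpos[THEN bspec, OF subsetD[OF sub]] that by simp_all
  have apos': "AE s in lborel. 0 < s \<and> s \<le> L \<longrightarrow> 0 < a s"
    using aeq
  proof eventually_elim
    case (elim s)
    then show ?case using pos0(1)[of s] by auto
  qed
  have kpos': "0 < k s" if "0 < s" "s \<le> L" for s using keq[OF that] pos0[OF that] by simp
  have \<kappa>pos: "0 < \<kappa>0 t" if "0 < t" "t \<le> L" for t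
    using kern_pos(2)[OF apos' kpos' that fin[OF that]] \<kappa>eq[OF that] by simp
  have conv: "convolution a0 (\<lambda>s. U s x) t = volterra a (kern (Suc m)) (fam T (Suc m)) t x"
    "convolution_exists a0 (\<lambda>s. U s x) t" if "0 < t" "t \<le> L" for t x
  proof -
    have "AE s in lborel. 0 < s \<and> s < t \<longrightarrow> a0 (t - s) *\<^sub>R U s x = a (t - s) *\<^sub>R fam T (Suc m) s x"
      using AE_reflect[OF aeq, of t] by eventually_elim (use that U_eq in auto)
    from convolution_eq_volterra[OF A U' a kernel_kern afin[OF that] this]
    show "convolution a0 (\<lambda>s. U s x) t = volterra a (kern (Suc m)) (fam T (Suc m)) t x"
      "convolution_exists a0 (\<lambda>s. U s x) t" by blast+
  qed
  have res_eq: "convolution a0 (\<lambda>s. U s x) t \<in> D \<and> A (convolution a0 (\<lambda>s. U s x) t) = U t x - \<kappa>0 t *\<^sub>R x"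
    if "0 < t" "t \<le> L" for t x
  proof -
    have t: "t \<le> real (Suc m) * T + T" using that(2) unfolding L_eq .
    show ?thesis
      using extension_resolvent_equation[OF R kernel_kern resolvent_fam[OF res] res t fin[OF that] afin[OF that, unfolded kern.simps], of x]
      unfolding conv(1)[OF that] U_eq[OF that] \<kappa>eq[OF that] by simp
  qed
  have lim: "((\<lambda>t. (1 / \<kappa>0 t) *\<^sub>R U t x) \<longlongrightarrow> x) (at_right 0)" for x
  proof (rule tendstoI)
    fix e :: real assume "e > 0"
    \<comment> \<open>Halving turns the weak asymptotic bound into the strict inequality in the
      definition of the limit.\<close>
    then have e2: "0 < e / 2" by simp
    obtain d where d: "d > 0" "\<And>t. t < d \<Longrightarrow> pconv_finite k (pconv a (kern m)) t \<Longrightarrow>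
        norm (fam T (Suc m) t x - kern (Suc m) t *\<^sub>R x) \<le> e / 2 * kern (Suc m) t"
      using fam_asymptotic(2)[OF T(1) S0 e2, where x=x and m=m] by blast
    have "dist ((1 / \<kappa>0 t) *\<^sub>R U t x) x < e" if t: "0 < t" "t < min d L" for t
    proof -
      have tL: "t \<le> L" using t by simp
      note pos = \<kappa>pos[OF t(1) tL]
      have "norm (U t x - \<kappa>0 t *\<^sub>R x) \<le> e / 2 * \<kappa>0 t"
        using d(2)[of t] t fin[OF t(1) tL] U_eq[OF t(1) tL] \<kappa>eq[OF t(1) tL] by simp
      then have "(1 / \<kappa>0 t) * norm (U t x - \<kappa>0 t *\<^sub>R x) \<le> (1 / \<kappa>0 t) * (e / 2 * \<kappa>0 t)"
        using pos by (intro mult_left_mono) auto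
      moreover have "(1 / \<kappa>0 t) * norm (U t x - \<kappa>0 t *\<^sub>R x) = dist ((1 / \<kappa>0 t) *\<^sub>R U t x) x"
      proof -
        have "(1 / \<kappa>0 t) *\<^sub>R U t x - x = (1 / \<kappa>0 t) *\<^sub>R (U t x - \<kappa>0 t *\<^sub>R x)"
          using pos by (simp add: scaleR_diff_right)
        then show ?thesis using pos unfolding dist_norm by simp
      qed
      moreover have "(1 / \<kappa>0 t) * (e / 2 * \<kappa>0 t) = e / 2" using pos by simp
      ultimately show ?thesis using \<open>e > 0\<close> by linarith
    qed
    then show "\<forall>\<^sub>F t in at_right 0. dist ((1 / \<kappa>0 t) *\<^sub>R U t x) x < e"
      unfolding eventually_at_right_field using d(1) L0 by (intro exI[of _ "min d L"]) auto
  qed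
  show ?thesis
    unfolding regularized_resolvent_family_def L_def[symmetric] U_def[symmetric]
  proof (intro conjI allI ballI)
    show "locally_integrable {0<..L} a0"
      using aloc sub by (auto simp: locally_integrable_def)
    show "locally_integrable {0<..L} \<kappa>0"
      unfolding locally_integrable_def
    proof
      fix t assume "t \<in> {0<..L}"
      then show "\<kappa>0 absolutely_integrable_on {0..t}"
        by (intro kernel_absolutely_integrable[OF kernel_kern \<kappa>eq]) auto
    qed
    show "continuous_on {0<..L} \<kappa>0" by (rule continuous_on_subset[OF \<kappa>c sub])
    have "\<kappa>0 t \<noteq> 0" if "t \<in> {0<..L}" for t using \<kappa>pos[of t] that by auto
    then show "\<exists>\<sigma>>0. \<forall>t\<in>{0<..L}. t < \<sigma> \<longrightarrow> \<kappa>0 t \<noteq> 0" by (intro exI[of _ 1]) auto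
    show "closed_operator D A" by (rule A)
    show "bounded_clinear (U t)" if "t \<in> {0<..L}" for t
      using that U_eq[of t] op_familyD(2)[OF U'] by simp
    show "continuous_on {0<..L} (\<lambda>t. U t x)" for x
    proof (rule continuous_on_cong[THEN iffD1, OF refl])
      have "L \<le> real (Suc m) * T + T" by (simp only: L_eq order_refl)
      then show "continuous_on {0<..L} (\<lambda>t. extension a k S (real (Suc m) * T) (kern m) (fam T m) t x)"
        by (rule extension_continuous[OF R kernel_kern kcont[folded L_def] Sc _ c fin])
      show "extension a k S (real (Suc m) * T) (kern m) (fam T m) t x = U t x" if "t \<in> {0<..L}" for t
        using that U_eq[of t] by simp
    qed
    show "((\<lambda>t. (1 / \<kappa>0 t) *\<^sub>R U t x) \<longlongrightarrow> x) (at_right 0)" for x by (rule lim)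
    show "U t x \<in> D" "A (U t x) = U t (A x)" if "t \<in> {0<..L}" "x \<in> D" for t x
      using that U_eq[of t] op_familyD(6,7)[OF U'] by simp_all
    show "convolution_exists a0 (\<lambda>s. U s x) t" "convolution a0 (\<lambda>s. U s x) t \<in> D"
      "A (convolution a0 (\<lambda>s. U s x) t) = U t x - \<kappa>0 t *\<^sub>R x" if "t \<in> {0<..L}" for t x
      using conv(2)[of t x] res_eq[of t x] that by auto
  qed
qed

text \<open>One choice of truncated data, made for the larger T', serves both recursions; Borel
  versions obtained from two separate choices never have to be compared.\<close>

lemma extended_family_independent:
  assumes T: "0 < T" "T \<le> T'" "ereal T' < \<tau>" and t: "0 < t" "t \<le> real (Suc (Suc m)) * T"
  shows "extended_family a0 k0 S1 T (Suc m) t = extended_family a0 k0 S1 T' (Suc m) t"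
proof
  fix x
  define L where "L = real (Suc (Suc m)) * T'"
  have T': "0 < T'" using T by simp
  obtain a k S C where set: "continuous_recursion a k D A S C a0 k0 S1 T' m" by (rule setting[OF T' T(3)])
  interpret T': continuous_recursion a k D A S C a0 k0 S1 T' m by (rule set)
  have TT: "real (Suc (Suc m)) * T \<le> L" "real (Suc m) * T' \<le> L"
    unfolding L_def using T T' by (intro mult_left_mono mult_right_mono; simp)+
  have TT2: "real (Suc m) * T \<le> L"
    using order_trans[OF mult_left_mono[OF T(2), of "real (Suc m)"] TT(2)] by simp
  have tL: "t \<le> L" using t TT by linarith
  note fint = T'.fin[OF t(1) tL[unfolded L_def]]
  \<comment> \<open>The same a, k, S and the same length \<open>L\<close>, with the break points of
    the smaller T.\<close>
  interpret T: recursion_setting a k D A S C a0 k0 S1 T L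
    by unfold_locales (use T'.a' T'.k' T'.S' T in \<open>auto simp only: L_def\<close>)
  have "extended_family a0 k0 S1 T (Suc m) t x = T'.fam T (Suc m) t x"
    by (rule T.extended_family_eq_fam[OF T.extended_family_eq_fam_AE[OF TT2] t tL fint])
  also have "\<dots> = T'.fam T' (Suc m) t x"
    by (rule T'.fam_independent_Suc[OF T'.res less_imp_le[OF T(1)] T(2)
          T'.fam_independent_AE[OF T'.res less_imp_le[OF T(1)] T(2)] t(2) fint])
  also have "\<dots> = extended_family a0 k0 S1 T' (Suc m) t x"
    by (rule T'.extended_family_eq_fam[symmetric, OF T'.extended_family_eq_fam_AE[OF TT(2)[unfolded L_def]]
          t(1) tL[unfolded L_def] tL[unfolded L_def] fint])
  finally show "extended_family a0 k0 S1 T (Suc m) t x = extended_family a0 k0 S1 T' (Suc m) t x" .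
qed

lemma extended_family_global:
  "\<exists>S. regularized_resolvent_family (time_interval (ereal (real (Suc (Suc m))) * \<tau>)) a0 \<kappa>0 D A S \<and>
     (\<forall>T. 0 < T \<and> ereal T < \<tau> \<longrightarrow>
       (\<forall>t\<in>{0<..real (Suc (Suc m)) * T}. S t = extended_family a0 k0 S1 T (Suc m) t))"
proof -
  define N where "N = real (Suc (Suc m))"
  define J where "J = time_interval (ereal N * \<tau>)"
  have N0: "0 < N" by (simp add: N_def)
  have "\<forall>t. \<exists>T. t \<in> J \<longrightarrow> 0 < T \<and> ereal T < \<tau> \<and> t < N * T"
    using time_interval_exhaust[OF _ N0 \<tau>] by (auto simp: J_def)
  \<comment> \<open>The strict inequality puts t in the interior of the interval belonging to
    \<open>Tf t\<close>, so continuity at t can be read off from one family on an open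
    neighbourhood.\<close>
  then obtain Tf where Tf: "\<And>t. t \<in> J \<Longrightarrow> 0 < Tf t \<and> ereal (Tf t) < \<tau> \<and> t < N * Tf t" by metis
  define S where "S t = extended_family a0 k0 S1 (Tf t) (Suc m) t" for t
  have J_in: "t \<in> J" if "0 < T" "ereal T < \<tau>" "0 < t" "t \<le> N * T" for t T
    unfolding J_def by (rule time_interval_scale[OF that N0])
  have S_eq: "S t = extended_family a0 k0 S1 T (Suc m) t" if "0 < T" "ereal T < \<tau>" "0 < t" "t \<le> N * T" for t T
  proof -
    note Tt = Tf[OF J_in[OF that]]
    show ?thesis
    proof (cases "T \<le> Tf t")
      case True
      then show ?thesis unfolding S_def
        using extended_family_independent[OF that(1) True _ that(3)] Tt that(4) by (simp add: N_def)
    next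
      case False
      then show ?thesis unfolding S_def
        using extended_family_independent[of "Tf t" T t] Tt that by (simp add: N_def)
    qed
  qed
  let ?E = "\<lambda>T. extended_family a0 k0 S1 T (Suc m)"
  have res: "regularized_resolvent_family {0<..N * T} a0 \<kappa>0 D A (?E T)" if "0 < T" "ereal T < \<tau>" for T
    unfolding N_def by (rule extended_family_resolvent[OF that])
  have J0: "0 < t" if "t \<in> J" for t using that by (simp add: J_def time_interval_def)
  have at_t: "t \<in> {0<..N * Tf t}" if "t \<in> J" for t using Tf[OF that] J0[OF that] by auto
  have res_t: "regularized_resolvent_family {0<..N * Tf t} a0 \<kappa>0 D A (?E (Tf t))" if "t \<in> J" for t
    using Tf[OF that] by (intro res) auto
  have conv: "convolution a0 (\<lambda>s. S s x) t = convolution a0 (\<lambda>s. ?E (Tf t) s x) t \<and>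
      (convolution_exists a0 (\<lambda>s. S s x) t \<longleftrightarrow> convolution_exists a0 (\<lambda>s. ?E (Tf t) s x) t)" if t: "t \<in> J" for t x
  proof -
    \<comment> \<open>At s = 0 the two sides may differ, since \<open>Tf 0\<close> is arbitrary; a
      single point does not affect the integrals.\<close>
    have eq: "S s x = ?E (Tf t) s x" if "s \<in> {0..t} - {0}" for s
      using S_eq[of "Tf t" s] Tf[OF t] that by simp
    have 1: "integral {0..t} (\<lambda>s. a0 (t - s) *\<^sub>R S s x) = integral {0..t} (\<lambda>s. a0 (t - s) *\<^sub>R ?E (Tf t) s x)"
      by (rule integral_spike[of "{0}"]) (use eq in auto)
    have 2: "(\<lambda>s. a0 (t - s) *\<^sub>R S s x) integrable_on {0..t} \<longleftrightarrow> (\<lambda>s. a0 (t - s) *\<^sub>R ?E (Tf t) s x) integrable_on {0..t}"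
      by (rule integrable_spike_finite_eq[of "{0}"]) (use eq in auto)
    have 3: "(\<lambda>s. norm (a0 (t - s) *\<^sub>R S s x)) integrable_on {0..t} \<longleftrightarrow> (\<lambda>s. norm (a0 (t - s) *\<^sub>R ?E (Tf t) s x)) integrable_on {0..t}"
      by (rule integrable_spike_finite_eq[of "{0}"]) (use eq in auto)
    show ?thesis unfolding convolution_def convolution_exists_def using 1 2 3 by blast
  qed
  have "regularized_resolvent_family J a0 \<kappa>0 D A S"
    unfolding regularized_resolvent_family_def
  proof (intro conjI allI ballI)
    show "locally_integrable J a0" using aloc by (simp add: J_def N_def)
    show "locally_integrable J \<kappa>0" unfolding locally_integrable_def
    proof
      fix t assume t: "t \<in> J"
      then show "\<kappa>0 absolutely_integrable_on {0..t}"
        using res_t[OF t] at_t[OF t] by (simp add: regularized_resolvent_family_def locally_integrable_def)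
    qed
    show "continuous_on J \<kappa>0" using \<kappa>c by (simp add: J_def N_def)
    obtain T where T: "0 < T" "ereal T < \<tau>"
      using \<tau> ereal_dense2[of 0 \<tau>] by (auto simp: zero_ereal_def)
    from res[OF this] obtain \<sigma> where \<sigma>: "\<sigma> > 0" "\<forall>t\<in>{0<..N * T}. t < \<sigma> \<longrightarrow> \<kappa>0 t \<noteq> 0"
      unfolding regularized_resolvent_family_def by blast
    have "\<kappa>0 t \<noteq> 0" if "t \<in> J" "t < min \<sigma> (N * T)" for t
      using \<sigma>(2) that J0[OF that(1)] by auto
    then show "\<exists>\<sigma>>0. \<forall>t\<in>J. t < \<sigma> \<longrightarrow> \<kappa>0 t \<noteq> 0"
      using \<sigma>(1) T N0 by (intro exI[of _ "min \<sigma> (N * T)"]) auto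
    show "closed_operator D A" by (rule resolvent_familyD(1)[OF S1])
    show "bounded_clinear (S t)" if "t \<in> J" for t
      unfolding S_def by (rule resolvent_familyD(5)[OF res_t[OF that] at_t[OF that]])
    show "continuous_on J (\<lambda>t. S t x)" for x
    proof (rule continuous_at_imp_continuous_on, rule ballI)
      fix t assume t: "t \<in> J"
      have "continuous_on {0<..<N * Tf t} (\<lambda>s. ?E (Tf t) s x)"
        by (rule continuous_on_subset[OF resolvent_familyD(3)[OF res_t[OF t]]]) auto
      moreover have "?E (Tf t) s x = S s x" if "s \<in> {0<..<N * Tf t}" for s
        using S_eq[of "Tf t" s] Tf[OF t] that by simp
      ultimately have "continuous_on {0<..<N * Tf t} (\<lambda>s. S s x)"
        by (rule continuous_on_eq)
      moreover have "t \<in> {0<..<N * Tf t}" using Tf[OF t] J0[OF t] by auto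
      ultimately show "isCont (\<lambda>t. S t x) t"
        by (simp add: continuous_on_eq_continuous_at)
    qed
    show "((\<lambda>t. (1 / \<kappa>0 t) *\<^sub>R S t x) \<longlongrightarrow> x) (at_right 0)" for x
    proof (rule Lim_transform_eventually[OF resolvent_familyD(4)[OF res[OF T]]])
      show "\<forall>\<^sub>F t in at_right 0. (1 / \<kappa>0 t) *\<^sub>R ?E T t x = (1 / \<kappa>0 t) *\<^sub>R S t x"
        unfolding eventually_at_right_field using S_eq[OF T] T N0
        by (intro exI[of _ "N * T"]) auto
    qed
    show "S t x \<in> D" "A (S t x) = S t (A x)" if "t \<in> J" "x \<in> D" for t x
      unfolding S_def using resolvent_familyD(6,7)[OF res_t[OF that(1)] at_t[OF that(1)] that(2)] by blast+
    show "convolution_exists a0 (\<lambda>s. S s x) t" "convolution a0 (\<lambda>s. S s x) t \<in> D"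
      "A (convolution a0 (\<lambda>s. S s x) t) = S t x - \<kappa>0 t *\<^sub>R x" if t: "t \<in> J" for t x
      using conv[OF t, of x] resolvent_familyD(8,9,10)[OF res_t[OF t] at_t[OF t], of x] by (simp_all add: S_def[of t])
  qed
  then show ?thesis using S_eq by (intro exI[of _ S]) (auto simp: J_def N_def)
qed

end

theorem theorem3:
  fixes a k :: "real \<Rightarrow> real"
    and D :: "'a::complex_banach set" and A :: "'a \<Rightarrow> 'a"
    and S\<^sub>1 :: "real \<Rightarrow> 'a \<Rightarrow> 'a"
    and n :: nat and \<tau> :: ereal
  assumes "n \<ge> 1" and "0 < \<tau>"
    and "locally_integrable (time_interval (ereal (real (n + 1)) * \<tau>)) a"
    and "locally_integrable (time_interval (ereal (real (n + 1)) * \<tau>)) k"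
    and "\<forall>t\<in>time_interval (ereal (real (n + 1)) * \<tau>). 0 < a t"
    and "\<forall>t\<in>time_interval (ereal (real (n + 1)) * \<tau>). 0 < k t"
    and "continuous_on (time_interval (ereal (real (n + 1)) * \<tau>)) k"
    and "continuous_on (time_interval (ereal (real (n + 1)) * \<tau>))
           (convolution_power (convolution k a) n k)"
    and "regularized_resolvent_family (time_interval \<tau>) a k D A S\<^sub>1"
  shows "(\<forall>T. 0 < T \<and> ereal T < \<tau> \<longrightarrow>
            regularized_resolvent_family {0<..real (n + 1) * T}
              a (convolution_power (convolution k a) n k) D A (extended_family a k S\<^sub>1 T n)) \<and>
         (\<exists>S. regularized_resolvent_family (time_interval (ereal (real (n + 1)) * \<tau>))
                a (convolution_power (convolution k a) n k) D A S \<and>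
              (\<forall>T. 0 < T \<and> ereal T < \<tau> \<longrightarrow>
                 (\<forall>t\<in>{0<..real (n + 1) * T}. S t = extended_family a k S\<^sub>1 T n t)))"
proof -
  obtain m where n: "n = Suc m" using assms(1) by (cases n) auto
  have n1: "n + 1 = Suc (Suc m)" by (simp add: n)
  interpret extension_problem a k D A S\<^sub>1 m \<tau>
    by unfold_locales (fact assms(2-)[unfolded n1, unfolded n])+
  show ?thesis
    unfolding n1 unfolding n using extended_family_resolvent extended_family_global by blast
qed

end
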